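(* Let $V,U\ge 0$ be independent random variables with $\mathbb{E}[V]=\mathbb{E}[U]=1$, variances satisfying $0<\sigma_V^2+\sigma_U^2<\infty$, and such that for some $\delta_0>0$ the functions $z\mapsto \mathbb{E}[e^{zV}]$ and $z\mapsto\mathbb{E}[e^{zU}]$ are analytic in an open strip containing $-\delta_0\le \mathrm{Re}(z)\le\delta_0$. Assume moreover that the separation assumption (A) of the context holds. Let $\rho_n\in(0,1)$, $n=1,2,\dots$, be such that there are fixed $0<\beta_1\le\beta_2<\infty$ with $(1-\rho_n)\sqrt n\in[\beta_1,\beta_2]$ for all $n$. Let $W_n$ be the steady-state waiting time of the nearly deterministic $\mathrm{GI}_n/\mathrm{G}_n/1$ queue built from $V,U,\rho_n$. For $n$ sufficiently large, let $\zeta_{sp}$ be the saddle point on the negative real axis of $h(\zeta)=\log\psi(-\zeta;\rho_n)$, and put $\sigma_n=(h''(\zeta_{sp}))^{1/2}$ and $\beta_n=-\zeta_{sp}\,\sigma_n\sqrt n$. Then for every fixed $k=1,2,\dots$ $$\mathbb{E}\Big[\Big(\frac{\sqrt n}{\sigma_n}\,W_n\Big)^k\Big]=m_k(\beta_n)+O\Big(\frac1{\sqrt n}\Big),\qquad n\to\infty,$$ where $m_k(\beta)=\mathbb{E}[M_\beta^k]$.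
   Context: Nearly deterministic $\mathrm{GI}_n/\mathrm{G}_n/1$ queue: $V_n=\frac1n\sum_{k=1}^n V_{n,k}$ and $U_n=\frac1n\sum_{k=1}^nU_{n,k}$, where the $V_{n,k}$ are i.i.d. copies of $V$, the $U_{n,k}$ are i.i.d. copies of $U$, and all of these are independent. The steady-state waiting time $W_n\ge0$ is the (finite) random variable whose distribution is the stationary solution of $W_n\stackrel{d}{=}\big(W_n+V_n-\frac1{\rho_n}U_n\big)^+$, where $x^+=\max\{0,x\}$ and on the right-hand side $W_n,V_n,U_n$ are independent. For $\rho\in(0,1]$ let $\psi(s)=\psi(s;\rho)=\mathbb{E}\big[e^{s(V-\frac1\rho U)}\big]$. Assumption (A): there are $\delta>0$ (with $\mathbb{E}[e^{\delta V}]<\infty$, so that the quantities below are defined) and $\varepsilon>0$ such that for all $\rho\in[\frac12,1)$, all $x\in[-\delta,0)$ and all $y\in\mathbb{R}$ with $|y|>\delta$ one has $|\psi(-x+iy;\rho)|<\psi(-x;\rho)-\varepsilon$. Saddle point: $h(\zeta)=\log\psi(-\zeta;\rho_n)$ is, on a sufficiently small fixed interval $[-\delta',0]$, a convex function with $h(0)=0$, $h'(0)=\frac1{\rho_n}-1>0$; for $\rho_n$ sufficiently close to 1 (hence $n$ sufficiently large) it has a unique point $\zeta_{sp}\in[-\delta',0]$ with $h'(\zeta_{sp})=0$. This $\zeta_{sp}$ (depending on $n$) is the saddle point. Gaussian random walk: for $\beta>0$, $M_\beta=\max_{k\ge0}S_k$, where $S_0=0$ and $S_k$ is the sum of $k$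 i.i.d. normal random variables with mean $-\beta$ and variance 1. *)

theory Defs
  imports "HOL-Probability.Probability" "HOL-Library.Landau_Symbols"
begin

text \<open>Integrability is demanded separately because the Bochner integral of a non-integrable
  function is 0 by convention.\<close>

definition mgf_analytic_on_strip :: "'a measure \<Rightarrow> ('a \<Rightarrow> real) \<Rightarrow> real \<Rightarrow> bool" where
  "mgf_analytic_on_strip M X \<delta>\<^sub>0 \<longleftrightarrow>
    (\<exists>a b. a < - \<delta>\<^sub>0 \<and> \<delta>\<^sub>0 < b \<and>
      (\<forall>z::complex. a < Re z \<and> Re z < b \<longrightarrow> integrable M (\<lambda>\<omega>. exp (z * of_real (X \<omega>)))) \<and>
      (\<lambda>z::complex. LINT \<omega>|M. exp (z * of_real (X \<omega>))) analytic_on {z. a < Re z \<and> Re z < b})"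

text \<open>Polymorphic in the argument, so that the same function is available at real and at
  complex \<open>s\<close>.\<close>

definition psi :: "'a measure \<Rightarrow> ('a \<Rightarrow> real) \<Rightarrow> ('a \<Rightarrow> real) \<Rightarrow> real
    \<Rightarrow> 'b \<Rightarrow> 'b::{real_normed_field, banach, second_countable_topology}" where
  "psi M V U \<rho> s = (LINT \<omega>|M. exp (s * of_real (V \<omega> - U \<omega> / \<rho>)))"

definition separation_assumption :: "'a measure \<Rightarrow> ('a \<Rightarrow> real) \<Rightarrow> ('a \<Rightarrow> real) \<Rightarrow> bool" where
  "separation_assumption M V U \<longleftrightarrow>
    (\<exists>\<delta>>0. \<exists>\<epsilon>>0. integrable M (\<lambda>\<omega>. exp (\<delta> * V \<omega>)) \<and>
      (\<forall>\<rho>\<in>{1/2..<1}. \<forall>x\<in>{-\<delta>..<0}. \<forall>y::real. \<bar>y\<bar> > \<delta> \<longrightarrow>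
        norm (psi M V U \<rho> (Complex (- x) y)) < psi M V U \<rho> (- x) - \<epsilon>))"

text \<open>Law of the mean of \<open>n\<close> independent random variables with law \<open>D\<close>.\<close>

definition sample_mean_law :: "real measure \<Rightarrow> nat \<Rightarrow> real measure" where
  "sample_mean_law D n = distr (PiM {1..n} (\<lambda>_. D)) borel (\<lambda>x. (\<Sum>k=1..n. x k) / real n)"

text \<open>\<open>L\<close> is a stationary law of the Lindley recursion; the product measure expresses
  the independence of the three variables on the right-hand side.\<close>

definition stationary_waiting_law ::
    "real measure \<Rightarrow> real measure \<Rightarrow> real \<Rightarrow> nat \<Rightarrow> real measure \<Rightarrow> bool" where
  "stationary_waiting_law D\<^sub>V D\<^sub>U \<rho> n L \<longleftrightarrow>
    prob_space L \<and> sets L = sets borel \<and>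
    L = distr (L \<Otimes>\<^sub>M (sample_mean_law D\<^sub>V n \<Otimes>\<^sub>M sample_mean_law D\<^sub>U n)) borel
          (\<lambda>(w, v, u). max 0 (w + v - u / \<rho>))"

definition log_psi :: "'a measure \<Rightarrow> ('a \<Rightarrow> real) \<Rightarrow> ('a \<Rightarrow> real) \<Rightarrow> real \<Rightarrow> real \<Rightarrow> real" where
  "log_psi M V U \<rho> \<zeta> = ln (psi M V U \<rho> (- \<zeta>))"

definition is_saddle_point :: "(real \<Rightarrow> real) \<Rightarrow> real \<Rightarrow> real \<Rightarrow> bool" where
  "is_saddle_point h \<delta> \<zeta> \<longleftrightarrow> \<zeta> \<in> {-\<delta>..0} \<and> (h has_real_derivative 0) (at \<zeta>)"

text \<open>Meaningful only when the saddle point in the given interval exists and is unique.\<close>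

definition saddle_point :: "(real \<Rightarrow> real) \<Rightarrow> real \<Rightarrow> real" where
  "saddle_point h \<delta> = (THE \<zeta>. is_saddle_point h \<delta> \<zeta>)"

definition saddle_sigma :: "(real \<Rightarrow> real) \<Rightarrow> real \<Rightarrow> real" where
  "saddle_sigma h \<delta> = sqrt (deriv (deriv h) (saddle_point h \<delta>))"

definition saddle_beta :: "(real \<Rightarrow> real) \<Rightarrow> real \<Rightarrow> nat \<Rightarrow> real" where
  "saddle_beta h \<delta> n = - saddle_point h \<delta> * saddle_sigma h \<delta> * sqrt (real n)"

text \<open>The canonical space of the increments, which are i.i.d. normal with mean \<open>-\<beta>\<close> and
  variance 1.\<close>

definition gaussian_increments :: "real \<Rightarrow> (nat \<Rightarrow> real) measure" where
  "gaussian_increments \<beta> =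
    PiM UNIV (\<lambda>_. density lborel (\<lambda>x. ennreal (normal_density (- \<beta>) 1 x)))"

text \<open>For \<open>\<beta> > 0\<close> the partial sums tend to minus infinity almost surely, so that the
  real-valued supremum is almost surely finite and attained.\<close>

definition walk_max :: "(nat \<Rightarrow> real) \<Rightarrow> real" where
  "walk_max x = (SUP k. \<Sum>i<k. x i)"

definition walk_max_moment :: "nat \<Rightarrow> real \<Rightarrow> real" where
  "walk_max_moment k \<beta> = (LINT x|gaussian_increments \<beta>. walk_max x ^ k)"

end

theory Submission
  imports Defs "HOL-Real_Asymp.Real_Asymp"
begin

text \<open>In the scaling of the theorem the waiting time is the stationary solution of a Lindley recursion
  whose increment is a normalised sum of \<open>n\<close> independent variables, and the maximum of the Gaussian
  walk is the stationary solution for a normal increment. Measure distances between laws by the \<open>L1\<close>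
  distance of their tails with weight \<open>exp (\<theta> t)\<close>. One Lindley step with an increment of negative
  drift contracts this distance by the factor \<open>E (exp (\<theta> G)) < 1\<close>, so the distance of the two
  stationary laws, and hence the difference of their moments, is at most a constant times the
  distance of the two increment laws. The latter is of order \<open>1 / sqrt n\<close> by Stein's method, applied
  to one half-line at a time and integrated with the exponential weight. Up to terms of the same
  order, \<open>\<beta>\<close> and \<open>\<sigma>\<close> computed from the saddle point agree with the drift and the standard deviation,
  by Taylor expansion of the cumulant generating function.\<close>

section \<open>The normal tail and the Mills ratio\<close>

text \<open>A bound on the tails that is uniform in the level \<open>s\<close> would meet the jump
  of the Stein derivative at \<open>s\<close>, whose control asks for a concentration inequality for
  the leave-one-out sums. Integrating over \<open>s\<close> avoids this: the increment of the Stein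
  derivative between two points, integrated over \<open>s\<close> with the exponential weight, is at
  most a weighted constant times their distance, and this is all that a third-moment expansion
  needs. The contraction asks for a distance on which a convolution acts as multiplication by an
  exponential moment; an L1 norm with exponential weight does this. The weight dominates every
  power, so one distance serves all moments. In this scaling the drift of the increment stays
  between positive constants, so one exponent \<theta> and one factor \<gamma> < 1 serve all large n
  and both increment laws. The increments change with \<rho>, but a single variable \<open>Q\<close>
  with an exponential moment dominates all of them after centring, which makes every constant
  uniform. The exponential moment of a stationary law is not known to be finite in advance; this is
  derived from stationarity by truncation and iteration.\<close>

definition normal_tail :: "real \<Rightarrow> real" where
  "normal_tail x = measure std_normal_distribution {x<..}"

interpretation std_normal: real_distribution std_normal_distribution
  by (rule real_dist_normal_dist)

lemma normal_tail_nonneg [simp]: "0 \<le> normal_tail x"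
  by (simp add: normal_tail_def)

lemma normal_tail_le_1 [simp]: "normal_tail x \<le> 1"
  by (simp add: normal_tail_def)

lemma has_real_derivative_std_normal_density [derivative_intros]:
  "(f has_real_derivative f') (at x within S) \<Longrightarrow>
   ((\<lambda>x. std_normal_density (f x)) has_real_derivative - f x * std_normal_density (f x) * f') (at x within S)"
  unfolding std_normal_density_def
  by (auto intro!: derivative_eq_intros simp: field_simps power2_eq_square)

lemma std_normal_density_pos: "0 < std_normal_density x"
  by (simp add: normal_density_pos)

lemma std_normal_density_minus [simp]: "std_normal_density (- x) = std_normal_density x"
  by (simp add: std_normal_density_def)

lemma normal_tail_eq_integral:
  assumes "a \<le> x"
  shows "normal_tail x = normal_tail a - integral {a..x} std_normal_density"
proof -
  have "normal_tail a = normal_tail x + measure std_normal_distribution {a<..x}"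
    unfolding normal_tail_def
    by (subst std_normal.finite_measure_Union[symmetric]) (use assms in \<open>auto intro!: arg_cong2[where f=measure]\<close>)
  also have "measure std_normal_distribution {a<..x} = integral {a..x} std_normal_density"
  proof -
    have int: "set_integrable lborel {a..x} std_normal_density"
      unfolding set_integrable_def by (intro integrable_mult_indicator) auto
    have "emeasure std_normal_distribution {a<..x} = (\<integral>\<^sup>+ t. ennreal (std_normal_density t) * indicator {a<..x} t \<partial>lborel)"
      by (simp add: emeasure_density)
    also have "\<dots> = (\<integral>\<^sup>+ t. ennreal (indicator {a..x} t *\<^sub>R std_normal_density t) \<partial>lborel)"
      by (rule nn_integral_cong_AE, rule AE_mp[OF AE_lborel_singleton[of a]])
         (auto split: split_indicator)
    also have "\<dots> = ennreal (LINT t:{a..x}|lborel. std_normal_density t)"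
      using int unfolding set_lebesgue_integral_def set_integrable_def
      by (intro nn_integral_eq_integral) auto
    also have "(LINT t:{a..x}|lborel. std_normal_density t) = integral {a..x} std_normal_density"
      using int by (rule set_borel_integral_eq_integral)
    finally show ?thesis
      by (simp add: measure_def integral_nonneg integrable_on_def set_borel_integral_eq_integral(1)[OF int, unfolded integrable_on_def])
  qed
  finally show ?thesis by simp
qed

lemma has_real_derivative_normal_tail [derivative_intros]:
  assumes "(f has_real_derivative f') (at x within S)"
  shows "((\<lambda>x. normal_tail (f x)) has_real_derivative - std_normal_density (f x) * f') (at x within S)"
proof -
  have "(normal_tail has_real_derivative - std_normal_density y) (at y)" for y
  proof -
    have cont: "continuous_on {y-1..y+1} std_normal_density"
      unfolding std_normal_density_def by (intro continuous_intros) auto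
    have "((\<lambda>u. integral {y-1..u} std_normal_density) has_real_derivative std_normal_density y) (at y within {y-1..y+1})"
      using cont by (rule integral_has_real_derivative) auto
    then have "((\<lambda>u. integral {y-1..u} std_normal_density) has_real_derivative std_normal_density y) (at y)"
      by (subst (asm) at_within_interior) auto
    then have "((\<lambda>u. normal_tail (y-1) - integral {y-1..u} std_normal_density) has_real_derivative - std_normal_density y) (at y)"
      by (auto intro!: derivative_eq_intros)
    then show ?thesis
      by (rule DERIV_cong_ev[THEN iffD1, rotated -1, of _ _ _ y])
         (auto intro!: eventually_mono[OF eventually_gt_at_top] simp: eventually_nhds
           intro!: exI[of _ "{y-1<..}"] normal_tail_eq_integral[symmetric])
  qed
  from DERIV_chain2[OF this assms] show ?thesis .
qed

text \<open>The density is even, so \<open>F\<close> below has derivative 0 and is constant; the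
  constant is its limit along the integers, where one summand tends to 0 and the other to 1.\<close>

lemma normal_tail_minus: "normal_tail (- x) = 1 - normal_tail x"
proof -
  define F where "F = (\<lambda>x. normal_tail (- x) + normal_tail x)"
  have "(F has_real_derivative 0) (at x)" for x
    unfolding F_def by (auto intro!: derivative_eq_intros)
  then have *: "F x = F y" for x y
    by (intro DERIV_const_ratio_const2[of x y F 0, simplified] DERIV_isconst_all) auto
  have lim0: "(\<lambda>n. normal_tail (real n)) \<longlonglongrightarrow> 0"
  proof -
    have "(\<lambda>n. measure std_normal_distribution {real n<..}) \<longlonglongrightarrow> measure std_normal_distribution (\<Inter>n. {real n<..})"
      by (rule std_normal.finite_Lim_measure_decseq) (auto simp: decseq_def)
    also have "(\<Inter>n. {real n<..}) = {}"
      by (auto simp: not_less) (metis less_le_not_le reals_Archimedean2)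
    finally show ?thesis by (simp add: normal_tail_def)
  qed
  have lim1: "(\<lambda>n. normal_tail (- real n)) \<longlonglongrightarrow> 1"
  proof -
    have "(\<lambda>n. measure std_normal_distribution {- real n<..}) \<longlonglongrightarrow> measure std_normal_distribution (\<Union>n. {- real n<..})"
      by (rule std_normal.finite_Lim_measure_incseq) (auto simp: incseq_def)
    also have "(\<Union>n. {- real n<..}) = space std_normal_distribution"
    proof (intro equalityI subsetI)
      fix x :: real
      obtain n where "- x < real n" using reals_Archimedean2 by blast
      then show "x \<in> (\<Union>n. {- real n<..})" by (auto intro!: exI[of _ n])
    qed auto
    finally show ?thesis using std_normal.prob_space by (simp add: normal_tail_def)
  qed
  have "(\<lambda>n. F (real n)) \<longlonglongrightarrow> 1 + 0"
    unfolding F_def by (intro tendsto_add lim0 lim1)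
  moreover have "(\<lambda>n. F (real n)) = (\<lambda>n. F x)" using * by blast
  ultimately have "F x = 1" by (simp add: LIMSEQ_const_iff)
  then show ?thesis by (simp add: F_def)
qed

text \<open>Chernoff's bound with exponent 1 suffices to make all the boundary terms at infinity vanish.\<close>

lemma normal_tail_le_exp: "normal_tail x \<le> exp (1 / 2 - x)"
proof -
  have eq: "std_normal_density t * exp t = exp (1/2) * normal_density 1 1 t" for t
    by (simp add: normal_density_def mult_exp_exp power2_eq_square field_simps)
  have "emeasure std_normal_distribution {x<..} = (\<integral>\<^sup>+ t. ennreal (std_normal_density t) * indicator {x<..} t \<partial>lborel)"
    by (simp add: emeasure_density)
  also have "\<dots> \<le> (\<integral>\<^sup>+ t. ennreal (exp (1/2 - x) * normal_density 1 1 t) \<partial>lborel)"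
  proof (rule nn_integral_mono)
    fix t
    have "exp (1/2 - x) * normal_density 1 1 t = exp (- x) * (exp (1/2) * normal_density 1 1 t)"
      by (simp add: mult_exp_exp flip: mult.assoc)
    also have "\<dots> = exp (- x) * (std_normal_density t * exp t)"
      by (simp only: eq)
    also have "\<dots> = std_normal_density t * exp (t - x)"
      by (simp add: exp_diff exp_minus field_simps)
    finally have *: "exp (1/2 - x) * normal_density 1 1 t = std_normal_density t * exp (t - x)" .
    show "ennreal (std_normal_density t) * indicator {x<..} t \<le> ennreal (exp (1/2 - x) * normal_density 1 1 t)"
      unfolding * by (auto split: split_indicator intro!: ennreal_leI mult_left_mono simp: mult_le_cancel_left1 std_normal_density_pos not_less)
  qed
  also have "\<dots> = ennreal (exp (1/2 - x))"
    by (subst nn_integral_eq_integral) (auto intro!: integrable_mult_right)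
  finally show ?thesis
    by (simp add: normal_tail_def measure_def enn2real_leI)
qed

lemma poly_normal_tail_tendsto_0: "((\<lambda>x. x ^ k * normal_tail x) \<longlongrightarrow> 0) at_top"
proof (rule tendsto_sandwich)
  show "\<forall>\<^sub>F x in at_top. x ^ k * normal_tail x \<le> x ^ k * exp (1 / 2 - x)"
    using eventually_ge_at_top[of 0] by eventually_elim (simp add: mult_left_mono normal_tail_le_exp)
  show "\<forall>\<^sub>F x in at_top. 0 \<le> x ^ k * normal_tail x"
    using eventually_ge_at_top[of 0] by eventually_elim simp
  show "((\<lambda>x::real. x ^ k * exp (1 / 2 - x)) \<longlongrightarrow> 0) at_top"
    by real_asymp
qed simp

lemma poly_std_normal_density_tendsto_0: "((\<lambda>x. x ^ k * std_normal_density x) \<longlongrightarrow> 0) at_top"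
  unfolding std_normal_density_def by real_asymp

text \<open>A decreasing function lies above its limit. This turns the sign of a derivative into the
  sign of the function, and lets nonnegativity climb from the tail to \<open>mills1\<close>,
  \<open>mills2\<close> and \<open>mills3\<close>.\<close>

lemma pos_if_decreasing_to_0:
  fixes F :: "real \<Rightarrow> real"
  assumes "\<And>x. x \<ge> a \<Longrightarrow> (F has_real_derivative F' x) (at x)" "\<And>x. x \<ge> a \<Longrightarrow> F' x \<le> 0"
    and "(F \<longlongrightarrow> 0) at_top" "x \<ge> a"
  shows "0 \<le> F x"
proof (rule tendsto_upperbound[OF assms(3)])
  show "\<forall>\<^sub>F y in at_top. F y \<le> F x"
    using eventually_ge_at_top[of x]
  proof eventually_elim
    case (elim y)
    show ?case
      by (rule DERIV_nonpos_imp_nonincreasing[OF elim]) (use assms in \<open>meson order_trans\<close>)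
  qed
qed simp

text \<open>The Mills ratio and, up to sign, its first three derivatives: each function is minus the
  derivative of the preceding one. Multiplied by the density, \<open>mills1\<close>,
  \<open>mills2\<close> and \<open>mills3\<close> are the expectations of the first, second and
  third power of (Z - x)^+ for a standard normal Z.\<close>

definition mills0 :: "real \<Rightarrow> real" where "mills0 x = normal_tail x / std_normal_density x"
definition mills1 :: "real \<Rightarrow> real" where "mills1 x = 1 - x * mills0 x"
definition mills2 :: "real \<Rightarrow> real" where "mills2 x = mills0 x - x * mills1 x"
definition mills3 :: "real \<Rightarrow> real" where "mills3 x = 2 * mills1 x - x * mills2 x"

lemma mills0_nonneg: "0 \<le> mills0 x"
  using std_normal_density_pos[of x] by (simp add: mills0_def)

lemma has_real_derivative_mills0:
  "(mills0 has_real_derivative - mills1 x) (at x)"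
  unfolding mills0_def[abs_def] mills1_def
  using std_normal_density_pos[of x]
  by (auto intro!: derivative_eq_intros simp: field_simps)

lemma has_real_derivative_mills1:
  "(mills1 has_real_derivative - mills2 x) (at x)"
  unfolding mills1_def[abs_def] mills2_def
  by (rule derivative_eq_intros has_real_derivative_mills0 refl)+ (simp add: mills1_def algebra_simps)

lemma has_real_derivative_mills2:
  "(mills2 has_real_derivative - mills3 x) (at x)"
  unfolding mills2_def[abs_def] mills3_def
  by (rule derivative_eq_intros has_real_derivative_mills0 has_real_derivative_mills1 refl)+
     (simp add: mills2_def algebra_simps)

lemma mills_density:
  "std_normal_density x * mills0 x = normal_tail x"
  "std_normal_density x * mills1 x = std_normal_density x - x * normal_tail x"
  "std_normal_density x * mills2 x = (1 + x\<^sup>2) * normal_tail x - x * std_normal_density x"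
  "std_normal_density x * mills3 x = (2 + x\<^sup>2) * std_normal_density x - (3 * x + x ^ 3) * normal_tail x"
proof -
  have m: "std_normal_density x * mills0 x = normal_tail x"
    using std_normal_density_pos[of x] by (simp add: mills0_def)
  then show "std_normal_density x * mills0 x = normal_tail x" .
  show "std_normal_density x * mills1 x = std_normal_density x - x * normal_tail x"
    "std_normal_density x * mills2 x = (1 + x\<^sup>2) * normal_tail x - x * std_normal_density x"
    "std_normal_density x * mills3 x = (2 + x\<^sup>2) * std_normal_density x - (3 * x + x ^ 3) * normal_tail x"
    unfolding mills1_def mills2_def mills3_def m[symmetric]
    by (simp_all add: algebra_simps power2_eq_square power3_eq_cube)
qed

lemma density_mills_tendsto_0:
  "((\<lambda>x. std_normal_density x * mills1 x) \<longlongrightarrow> 0) at_top"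
  "((\<lambda>x. std_normal_density x * mills2 x) \<longlongrightarrow> 0) at_top"
  "((\<lambda>x. std_normal_density x * mills3 x) \<longlongrightarrow> 0) at_top"
proof -
  have t: "((\<lambda>x. c1 * (x ^ k1 * normal_tail x) + c2 * (x ^ k2 * normal_tail x)
      + (c3 * (x ^ k3 * std_normal_density x) + c4 * (x ^ k4 * std_normal_density x))) \<longlongrightarrow> 0) at_top"
    for c1 c2 c3 c4 k1 k2 k3 k4
    by (auto intro!: tendsto_add_zero tendsto_mult_right_zero poly_normal_tail_tendsto_0 poly_std_normal_density_tendsto_0)
  show "((\<lambda>x. std_normal_density x * mills1 x) \<longlongrightarrow> 0) at_top"
    using t[of "-1" 1 0 0 1 0 0 0] unfolding mills_density by (simp add: algebra_simps)
  show "((\<lambda>x. std_normal_density x * mills2 x) \<longlongrightarrow> 0) at_top"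
    using t[of 1 0 1 2 "-1" 1 0 0] unfolding mills_density by (simp add: algebra_simps)
  show "((\<lambda>x. std_normal_density x * mills3 x) \<longlongrightarrow> 0) at_top"
    using t[of "-3" 1 "-1" 3 2 0 1 2] unfolding mills_density by (simp add: algebra_simps)
qed

text \<open>For a standard normal Z these are the rules that E ((Z - x)^+)^j has derivative - j E
  ((Z - x)^+)^(j - 1). Each function is thus an integral of the preceding one up to a factor, and
  inherits its sign by \<open>pos_if_decreasing_to_0\<close>.\<close>

lemma has_real_derivative_density_mills:
  "((\<lambda>x. std_normal_density x * mills1 x) has_real_derivative - normal_tail x) (at x)"
  "((\<lambda>x. std_normal_density x * mills2 x) has_real_derivative - (2 * (std_normal_density x * mills1 x))) (at x)"
  "((\<lambda>x. std_normal_density x * mills3 x) has_real_derivative - (3 * (std_normal_density x * mills2 x))) (at x)"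
  unfolding mills_density
  by (auto intro!: derivative_eq_intros simp: algebra_simps power2_eq_square power3_eq_cube)

lemma mills1_nonneg: "0 \<le> mills1 x"
proof -
  have "0 \<le> std_normal_density x * mills1 x"
    by (rule pos_if_decreasing_to_0[OF has_real_derivative_density_mills(1) _ density_mills_tendsto_0(1), of x]) auto
  then show ?thesis using std_normal_density_pos[of x] by (simp add: zero_le_mult_iff)
qed

lemma mills2_nonneg: "0 \<le> mills2 x"
proof -
  have "0 \<le> std_normal_density x * mills2 x"
    by (rule pos_if_decreasing_to_0[OF has_real_derivative_density_mills(2) _ density_mills_tendsto_0(2), of x])
       (auto simp: mills1_nonneg)
  then show ?thesis using std_normal_density_pos[of x] by (simp add: zero_le_mult_iff)
qed

lemma mills3_nonneg: "0 \<le> mills3 x"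
proof -
  have "0 \<le> std_normal_density x * mills3 x"
    by (rule pos_if_decreasing_to_0[OF has_real_derivative_density_mills(3) _ density_mills_tendsto_0(3), of x])
       (auto simp: mills2_nonneg)
  then show ?thesis using std_normal_density_pos[of x] by (simp add: zero_le_mult_iff)
qed

lemma mills0_antimono: "x \<le> y \<Longrightarrow> mills0 y \<le> mills0 x"
  by (rule DERIV_nonpos_imp_nonincreasing) (use has_real_derivative_mills0 mills1_nonneg in \<open>auto intro!: exI\<close>)

lemma mills1_antimono: "x \<le> y \<Longrightarrow> mills1 y \<le> mills1 x"
  by (rule DERIV_nonpos_imp_nonincreasing) (use has_real_derivative_mills1 mills2_nonneg in \<open>auto intro!: exI\<close>)

lemma mills2_antimono: "x \<le> y \<Longrightarrow> mills2 y \<le> mills2 x"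
  by (rule DERIV_nonpos_imp_nonincreasing) (use has_real_derivative_mills2 mills3_nonneg in \<open>auto intro!: exI\<close>)

lemma mills1_diff_le:
  assumes "y \<le> x" shows "mills1 y - mills1 x \<le> (x - y) * mills2 y"
proof (cases "y = x")
  case False
  with assms have "y < x" by simp
  from MVT2[OF this has_real_derivative_mills1] obtain z where z: "y < z" "z < x"
    "mills1 x - mills1 y = (x - y) * (- mills2 z)" by auto
  have "mills2 z \<le> mills2 y" using z by (intro mills2_antimono) auto
  then have "(x - y) * mills2 z \<le> (x - y) * mills2 y" using assms by (intro mult_left_mono) auto
  moreover have "mills1 y - mills1 x = (x - y) * mills2 z" using z by simp
  ultimately show ?thesis by simp
qed simp

text \<open>The functions \<open>mills1 x\<close> and \<open>mills1 (- x)\<close> both solve y'' = x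
  y' + 2 y, so their Wronskian is a constant multiple of the reciprocal density;
  \<open>normal_tail_minus\<close> supplies the constant. The second identity says that the
  one-sided values of the Stein derivative at its kink differ by exactly 1.\<close>

lemma mills_wronskian:
  "std_normal_density x * (mills2 x * mills1 (- x) + mills2 (- x) * mills1 x) = 1"
  "normal_tail (- x) * mills1 x + normal_tail x * mills1 (- x) = 1"
proof -
  have *: "std_normal_density x * (mills0 x + mills0 (- x)) = 1"
    using mills_density(1)[of x] mills_density(1)[of "- x"] normal_tail_minus[of x] by (simp add: distrib_left)
  have "mills2 x * mills1 (- x) + mills2 (- x) * mills1 x = mills0 x + mills0 (- x)"
    unfolding mills2_def mills1_def by (simp add: algebra_simps)
  with * show "std_normal_density x * (mills2 x * mills1 (- x) + mills2 (- x) * mills1 x) = 1" by simp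
  have "normal_tail (- x) * mills1 x + normal_tail x * mills1 (- x)
      = std_normal_density x * (mills0 (- x) * mills1 x + mills0 x * mills1 (- x))"
    using mills_density(1)[of x] mills_density(1)[of "- x"] by (simp add: algebra_simps)
  also have "mills0 (- x) * mills1 x + mills0 x * mills1 (- x) = mills0 x + mills0 (- x)"
    unfolding mills1_def by (simp add: algebra_simps)
  finally show "normal_tail (- x) * mills1 x + normal_tail x * mills1 (- x) = 1"
    using * by simp
qed

text \<open>As the left-hand side is the density minus x times the tail, the claim amounts to the
  lower bound density / (1 + x) for the tail. The tail minus this bound tends to 0 at infinity and
  decreases on the positive half-line, hence it is nonnegative there.\<close>

lemma density_mills1_le_tail:
  assumes "0 \<le> x" shows "std_normal_density x * mills1 x \<le> normal_tail x"
proof -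
  have "0 \<le> normal_tail x - std_normal_density x / (1 + x)"
  proof (rule pos_if_decreasing_to_0[where a = 0 and F = "\<lambda>x. normal_tail x - std_normal_density x / (1 + x)" and F' = "\<lambda>x. - (std_normal_density x * (x / (1 + x)\<^sup>2))"])
    fix y :: real assume y: "0 \<le> y"
    then show "((\<lambda>x. normal_tail x - std_normal_density x / (1 + x)) has_real_derivative
        - (std_normal_density y * (y / (1 + y)\<^sup>2))) (at y)"
      apply -
      apply (rule derivative_eq_intros refl | simp)+
      apply (simp add: divide_simps power2_eq_square)
      apply (simp add: algebra_simps)
      done
    show "- (std_normal_density y * (y / (1 + y)\<^sup>2)) \<le> 0" using y by simp
  next
    show "((\<lambda>x. normal_tail x - std_normal_density x / (1 + x)) \<longlongrightarrow> 0) at_top"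
    proof -
      have "((\<lambda>x. std_normal_density x / (1 + x)) \<longlongrightarrow> 0) at_top"
        unfolding std_normal_density_def by real_asymp
      from tendsto_diff[OF poly_normal_tail_tendsto_0[of 0] this] show ?thesis by simp
    qed
  qed (use assms in auto)
  then have "std_normal_density x \<le> (1 + x) * normal_tail x"
    using assms by (simp add: field_simps)
  then show ?thesis unfolding mills_density by (simp add: algebra_simps)
qed

lemma normal_tail_antimono: "x \<le> y \<Longrightarrow> normal_tail y \<le> normal_tail x"
  unfolding normal_tail_def by (intro std_normal.finite_measure_mono) auto

lemma normal_tail_0: "normal_tail 0 = 1 / 2"
  using normal_tail_minus[of 0] by simp

lemma std_normal_density_le_tail:
  assumes "x \<le> 0" shows "std_normal_density x \<le> normal_tail x"
proof -
  have "2 \<le> sqrt (2 * pi)"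
    by (rule real_le_rsqrt) (use pi_ge_two in simp)
  then have "std_normal_density x \<le> 1 / 2 * 1"
    unfolding std_normal_density_def by (intro mult_mono) (auto simp: field_simps)
  also have "\<dots> \<le> normal_tail x"
    using normal_tail_antimono[OF assms] by (simp add: normal_tail_0)
  finally show ?thesis .
qed

text \<open>Serves \<open>nn_integral_exp_tail_le\<close>: differentiating the weight exp (a * s)
  there produces the left-hand side, and the tail has to absorb it. For nonnegative s this is
  \<open>density_mills1_le_tail\<close> together with 2 * a \<le> 1.\<close>

lemma exp_density_mills1_le_tail:
  assumes "0 \<le> a" "a \<le> 1 / 2"
  shows "2 * a * exp (a * s) * (std_normal_density s * mills1 s) \<le> (1 + exp (a * s)) * normal_tail s"
proof (cases "0 \<le> s")
  case True
  have "2 * a * exp (a * s) * (std_normal_density s * mills1 s) \<le> 1 * exp (a * s) * normal_tail s"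
    using assms density_mills1_le_tail[OF True] mills1_nonneg[of s] by (intro mult_mono) auto
  also have "\<dots> \<le> (1 + exp (a * s)) * normal_tail s" by (simp add: distrib_right)
  finally show ?thesis .
next
  case False
  \<comment> \<open>For negative s the factor 1 - s from the bound on the density is paid by the
    decay of exp (- t), because 2 * t * exp (- t) never exceeds 1.\<close>
  define t where "t = - (a * s)"
  have t: "0 \<le> t" using assms False by (simp add: t_def mult_nonneg_nonpos)
  have "2 * t \<le> exp t"
  proof -
    have "2 * t \<le> 1 + t + t\<^sup>2 / 2" using sum_squares_bound[of t 1] by (simp add: power2_eq_square)
    with exp_lower_Taylor_quadratic[OF t] show ?thesis by linarith
  qed
  then have 1: "2 * t * exp (- t) \<le> 1" by (simp add: exp_minus field_simps)
  have 2: "2 * a * exp (- t) \<le> 1 * exp (- t)" using assms by (intro mult_right_mono) auto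
  have "std_normal_density s * mills1 s \<le> (1 - s) * normal_tail s"
    using std_normal_density_le_tail[of s] False unfolding mills_density by (simp add: algebra_simps)
  then have "2 * a * exp (a * s) * (std_normal_density s * mills1 s) \<le> 2 * a * exp (a * s) * ((1 - s) * normal_tail s)"
    using assms by (intro mult_left_mono) auto
  also have "\<dots> = (2 * a * exp (- t) + 2 * t * exp (- t)) * normal_tail s"
    by (simp add: t_def algebra_simps)
  also have "\<dots> \<le> (exp (- t) + 1) * normal_tail s"
  proof (rule mult_right_mono)
    show "2 * a * exp (- t) + 2 * t * exp (- t) \<le> exp (- t) + 1" using 1 2 by linarith
  qed simp
  finally show ?thesis by (simp add: t_def algebra_simps)
qed

section \<open>Stein's equation for half-lines\<close>

text \<open>The bounded solution of Stein's equation for the indicator of a half-line, and its derivative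
  away from the kink.\<close>

definition stein_sol :: "real \<Rightarrow> real \<Rightarrow> real" where
  "stein_sol s x = (if s < x then - normal_tail (- s) * mills0 x else - normal_tail s * mills0 (- x))"

definition stein_deriv :: "real \<Rightarrow> real \<Rightarrow> real" where
  "stein_deriv s x = (if s < x then normal_tail (- s) * mills1 x else - normal_tail s * mills1 (- x))"

lemma borel_measurable_normal_tail [measurable]: "normal_tail \<in> borel_measurable borel"
  by (intro borel_measurable_continuous_onI continuous_at_imp_continuous_on ballI
      DERIV_isCont[OF has_real_derivative_normal_tail[OF DERIV_ident]])

lemma borel_measurable_mills [measurable]:
  "mills0 \<in> borel_measurable borel" "mills1 \<in> borel_measurable borel"
  unfolding mills1_def[abs_def] mills0_def[abs_def] by measurable

lemma borel_measurable_stein [measurable]: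
  assumes [measurable]: "f \<in> borel_measurable M" "g \<in> borel_measurable M"
  shows "(\<lambda>\<omega>. stein_sol (f \<omega>) (g \<omega>)) \<in> borel_measurable M"
    and "(\<lambda>\<omega>. stein_deriv (f \<omega>) (g \<omega>)) \<in> borel_measurable M"
  unfolding stein_sol_def stein_deriv_def by measurable

text \<open>At the kink \<open>stein_deriv\<close> takes the value of the left branch, so the
  equation holds at every x and not only almost everywhere. This matters because the sums to which
  it is applied may have atoms.\<close>

lemma stein_equation:
  "stein_deriv s x = x * stein_sol s x + indicator {s<..} x - normal_tail s"
  unfolding stein_deriv_def stein_sol_def mills1_def
  by (auto simp: algebra_simps normal_tail_minus)

text \<open>By monotonicity of \<open>mills1\<close> each branch is largest in absolute value next
  to the kink, and there the absolute values of the two branches add up to 1.\<close>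

lemma abs_stein_deriv_le_1: "\<bar>stein_deriv s x\<bar> \<le> 1"
proof -
  have w: "normal_tail (- s) * mills1 s + normal_tail s * mills1 (- s) = 1"
    by (rule mills_wronskian)
  have n: "0 \<le> normal_tail (- s) * mills1 s" "0 \<le> normal_tail s * mills1 (- s)"
    by (simp_all add: mills1_nonneg)
  show ?thesis
  proof (cases "s < x")
    case True
    have "normal_tail (- s) * mills1 x \<le> normal_tail (- s) * mills1 s"
      using True by (intro mult_left_mono mills1_antimono) auto
    then have "normal_tail (- s) * mills1 x \<le> 1" using w n by linarith
    then show ?thesis using True by (simp add: stein_deriv_def abs_mult mills1_nonneg)
  next
    case False
    have "normal_tail s * mills1 (- x) \<le> normal_tail s * mills1 (- s)"
      using False by (intro mult_left_mono mills1_antimono) auto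
    then have "normal_tail s * mills1 (- x) \<le> 1" using w n by linarith
    then show ?thesis using False by (simp add: stein_deriv_def abs_mult mills1_nonneg)
  qed
qed

lemma tail_mills0_eq: "normal_tail (- s) * mills0 s = normal_tail s * mills0 (- s)"
  by (simp add: mills0_def)

text \<open>For a nonnegative argument of \<open>mills0\<close>, the tail factor is at most 1 and
  \<open>mills0\<close> at most its value at 0. A negative argument is first moved to the kink,
  where \<open>tail_mills0_eq\<close> trades it for a positive one. A crude constant suffices, since
  the bound only serves integrability.\<close>

lemma abs_stein_sol_le: "\<bar>stein_sol s x\<bar> \<le> mills0 0"
proof -
  have tail_mult: "normal_tail t * mills0 y \<le> mills0 0" if "0 \<le> y" for t y
  proof -
    have "normal_tail t * mills0 y \<le> 1 * mills0 0"
      using that by (intro mult_mono mills0_antimono) (auto simp: mills0_nonneg)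
    then show ?thesis by simp
  qed
  have *: "normal_tail (- s) * mills0 x \<le> mills0 0" if "s \<le> x" for s x
  proof (cases "0 \<le> x")
    case False
    have "normal_tail (- s) * mills0 x \<le> normal_tail (- s) * mills0 s"
      using that by (intro mult_left_mono mills0_antimono) auto
    also have "\<dots> \<le> mills0 0"
      unfolding tail_mills0_eq using False that by (intro tail_mult) auto
    finally show ?thesis .
  qed (rule tail_mult)
  show ?thesis
    using *[of s x] *[of "- s" "- x"]
    by (auto simp: stein_sol_def abs_mult mills0_nonneg)
qed

lemma continuous_on_stein_sol: "continuous_on UNIV (stein_sol s)"
proof -
  have 1: "continuous_on A (\<lambda>x. - normal_tail (- s) * mills0 x)" "continuous_on A (\<lambda>x. - normal_tail s * mills0 (- x))" for A
  proof -
    have m: "continuous_on UNIV mills0"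
      by (intro continuous_at_imp_continuous_on ballI DERIV_isCont[OF has_real_derivative_mills0])
    show "continuous_on A (\<lambda>x. - normal_tail (- s) * mills0 x)" "continuous_on A (\<lambda>x. - normal_tail s * mills0 (- x))"
      by (intro continuous_intros continuous_on_compose2[OF m]; auto)+
  qed
  have "continuous_on ({s..} \<union> {..s}) (\<lambda>x. if s \<le> x then - normal_tail (- s) * mills0 x else - normal_tail s * mills0 (- x))"
    by (rule continuous_on_cases) (auto intro!: 1[simplified] simp: tail_mills0_eq)
  also have "{s..} \<union> {..s} = UNIV" by auto
  also have "(\<lambda>x. if s \<le> x then - normal_tail (- s) * mills0 x else - normal_tail s * mills0 (- x)) = stein_sol s"
    by (auto simp: stein_sol_def fun_eq_iff tail_mills0_eq)
  finally show ?thesis .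
qed

lemma has_real_derivative_stein_sol:
  assumes "x \<noteq> s" shows "(stein_sol s has_real_derivative stein_deriv s x) (at x)"
proof (cases "s < x")
  case True
  have "((\<lambda>x. - normal_tail (- s) * mills0 x) has_real_derivative normal_tail (- s) * mills1 x) (at x)"
    by (auto intro!: derivative_eq_intros has_real_derivative_mills0)
  then have "(stein_sol s has_real_derivative normal_tail (- s) * mills1 x) (at x)"
    by (rule has_field_derivative_transform_within_open[of _ _ _ "{s<..}"]) (use True in \<open>auto simp: stein_sol_def\<close>)
  then show ?thesis using True by (simp add: stein_deriv_def)
next
  case False
  have "((\<lambda>x. - normal_tail s * mills0 (- x)) has_real_derivative - normal_tail s * mills1 (- x)) (at x)"
    by (auto intro!: derivative_eq_intros DERIV_chain'[OF _ has_real_derivative_mills0])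
  then have "(stein_sol s has_real_derivative - normal_tail s * mills1 (- x)) (at x)"
    by (rule has_field_derivative_transform_within_open[of _ _ _ "{..<s}"]) (use False assms in \<open>auto simp: stein_sol_def\<close>)
  then show ?thesis using False assms by (simp add: stein_deriv_def)
qed

lemma nn_integral_tail_atLeast:
  "(\<integral>\<^sup>+s. ennreal (normal_tail s) * indicator {x..} s \<partial>lborel) = ennreal (std_normal_density x * mills1 x)"
proof -
  have "((\<lambda>x. - (std_normal_density x * mills1 x)) has_real_derivative normal_tail x) (at x)" for x
    using DERIV_minus[OF has_real_derivative_density_mills(1)] by simp
  from nn_integral_FTC_atLeast[OF _ this, of x 0] show ?thesis
    using tendsto_minus[OF density_mills_tendsto_0(1)] by simp
qed

lemma nn_integral_tail_atMost:
  "(\<integral>\<^sup>+s. ennreal (normal_tail (- s)) * indicator {..y} s \<partial>lborel) = ennreal (std_normal_density y * mills1 (- y))"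
proof -
  have "(\<integral>\<^sup>+s. ennreal (normal_tail (- s)) * indicator {..y} s \<partial>lborel)
      = (\<integral>\<^sup>+s. ennreal (normal_tail s) * indicator {- y..} s \<partial>lborel)"
    by (subst nn_integral_real_affine[where c = "-1" and t = 0])
       (auto intro!: nn_integral_cong split: split_indicator)
  then show ?thesis by (simp add: nn_integral_tail_atLeast)
qed

text \<open>The integrand is not integrated exactly but dominated by a derivative: \<open>F\<close>
  vanishes at infinity, its derivative \<open>f\<close> exceeds the integrand by
  \<open>exp_density_mills1_le_tail\<close>, and minus its value at x is the bound.\<close>

lemma nn_integral_exp_tail_le:
  assumes a: "0 \<le> a" "a \<le> 1 / 2"
  shows "(\<integral>\<^sup>+s. ennreal (exp (a * s) * normal_tail s) * indicator {x..} s \<partial>lborel)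
    \<le> ennreal ((1 + 2 * exp (a * x)) * (std_normal_density x * mills1 x))"
proof -
  define F where "F = (\<lambda>s. - ((1 + 2 * exp (a * s)) * (std_normal_density s * mills1 s)))"
  define f where "f = (\<lambda>s. (1 + 2 * exp (a * s)) * normal_tail s - 2 * a * exp (a * s) * (std_normal_density s * mills1 s))"
  have F: "(F has_real_derivative f s) (at s)" for s
    unfolding F_def f_def
    by (rule derivative_eq_intros has_real_derivative_density_mills(1) refl)+ (simp add: algebra_simps)
  have f_ge: "exp (a * s) * normal_tail s \<le> f s" for s
    using exp_density_mills1_le_tail[OF a, of s] unfolding f_def by (simp add: algebra_simps)
  then have f_nonneg: "0 \<le> f s" for s
    by (rule order_trans[rotated]) simp
  have lim: "(F \<longlongrightarrow> 0) at_top"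
  proof (rule tendsto_0_le)
    have "((\<lambda>s. std_normal_density s * (3 * exp (s / 2))) \<longlongrightarrow> 0) at_top"
      unfolding std_normal_density_def by real_asymp
    then show "((\<lambda>s. std_normal_density s * (3 * exp (s / 2))) \<longlongrightarrow> 0) at_top" .
    show "\<forall>\<^sub>F s in at_top. norm (F s) \<le> norm (std_normal_density s * (3 * exp (s / 2))) * 1"
      using eventually_ge_at_top[of 0]
    proof eventually_elim
      case (elim s)
      have 1: "mills1 s \<le> 1" using elim by (simp add: mills1_def mills0_nonneg)
      have "a * s \<le> s / 2" using a(2) elim mult_right_mono[of a "1/2" s] by simp
      then have "1 + 2 * exp (a * s) \<le> 3 * exp (s / 2)"
        using elim exp_le_cancel_iff[of "a * s" "s/2"] one_le_exp_iff[of "s/2"] by linarith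
      with 1 have "(1 + 2 * exp (a * s)) * (std_normal_density s * mills1 s) \<le> 3 * exp (s / 2) * (std_normal_density s * 1)"
        by (intro mult_mono) (auto simp: mills1_nonneg)
      then show ?case
        by (simp add: F_def abs_mult mills1_nonneg mult_ac add_nonneg_nonneg)
    qed
  qed
  have [measurable]: "f \<in> borel_measurable borel" unfolding f_def by measurable
  have "(\<integral>\<^sup>+s. ennreal (exp (a * s) * normal_tail s) * indicator {x..} s \<partial>lborel)
      \<le> (\<integral>\<^sup>+s. ennreal (f s) * indicator {x..} s \<partial>lborel)"
    by (intro nn_integral_mono mult_right_mono ennreal_leI f_ge) auto
  also have "\<dots> = ennreal (0 - F x)"
    by (rule nn_integral_FTC_atLeast[OF _ F f_nonneg lim]) auto
  finally show ?thesis by (simp add: F_def)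
qed

text \<open>The points are fixed and the level s varies. If s lies outside the interval from y to x,
  both points are on the same smooth branch and the increment is at most x - y times a value of
  \<open>mills2\<close>. If s lies between them, the increment contains the jump and is only bounded
  by 1, but the set of such s has length x - y. Either way the integral over s is of order x -
  y.\<close>

lemma stein_deriv_diff_pointwise:
  assumes "0 \<le> a" "y < x"
  shows "exp (a * s) * \<bar>stein_deriv s x - stein_deriv s y\<bar>
    \<le> (x - y) * mills2 y * exp (a * y) * (normal_tail (- s) * indicator {..y} s)
      + exp (a * x) * indicator {y..x} s
      + (x - y) * mills2 (- x) * (exp (a * s) * normal_tail s * indicator {x..} s)"
proof -
  have nn: "0 \<le> (x - y) * mills2 y * exp (a * y) * (normal_tail (- s) * indicator {..y} s)"
    "0 \<le> exp (a * x) * indicator {y..x} s"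
    "0 \<le> (x - y) * mills2 (- x) * (exp (a * s) * normal_tail s * indicator {x..} s)"
    using assms by (auto simp: mills2_nonneg)
  consider "s < y" | "y \<le> s" "s < x" | "x \<le> s" by linarith
  then show ?thesis
  proof cases
    case 1
    then have "\<bar>stein_deriv s x - stein_deriv s y\<bar> = normal_tail (- s) * (mills1 y - mills1 x)"
      using assms mult_left_mono[OF mills1_antimono[of y x], of "normal_tail (- s)"]
      by (simp add: stein_deriv_def algebra_simps)
    also have "\<dots> \<le> normal_tail (- s) * ((x - y) * mills2 y)"
      using assms by (intro mult_left_mono mills1_diff_le) auto
    finally have "exp (a * s) * \<bar>stein_deriv s x - stein_deriv s y\<bar>
      \<le> exp (a * y) * (normal_tail (- s) * ((x - y) * mills2 y))"
      using assms 1 by (intro mult_mono) (auto intro!: mult_left_mono)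
    also have "\<dots> = (x - y) * mills2 y * exp (a * y) * (normal_tail (- s) * indicator {..y} s)"
      using 1 by simp
    finally show ?thesis using nn by linarith
  next
    case 2
    have "\<bar>stein_deriv s x - stein_deriv s y\<bar> = normal_tail (- s) * mills1 x + normal_tail s * mills1 (- y)"
      using 2 by (simp add: stein_deriv_def mills1_nonneg)
    also have "\<dots> \<le> normal_tail (- s) * mills1 s + normal_tail s * mills1 (- s)"
      using 2 by (intro add_mono mult_left_mono mills1_antimono) auto
    also have "\<dots> = 1" by (rule mills_wronskian)
    finally have "exp (a * s) * \<bar>stein_deriv s x - stein_deriv s y\<bar> \<le> exp (a * x) * 1"
      using assms 2 by (intro mult_mono) (auto intro!: mult_left_mono)
    also have "\<dots> = exp (a * x) * indicator {y..x} s" using 2 by simp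
    finally show ?thesis using nn by linarith
  next
    case 3
    then have "\<bar>stein_deriv s x - stein_deriv s y\<bar> = normal_tail s * (mills1 (- x) - mills1 (- y))"
      using assms mult_left_mono[OF mills1_antimono[of "- x" "- y"], of "normal_tail s"]
      by (simp add: stein_deriv_def algebra_simps)
    also have "\<dots> \<le> normal_tail s * ((- y - (- x)) * mills2 (- x))"
      using assms by (intro mult_left_mono mills1_diff_le) auto
    finally have "exp (a * s) * \<bar>stein_deriv s x - stein_deriv s y\<bar>
      \<le> exp (a * s) * (normal_tail s * ((x - y) * mills2 (- x)))"
      by (intro mult_left_mono) auto
    also have "\<dots> = (x - y) * mills2 (- x) * (exp (a * s) * normal_tail s * indicator {x..} s)"
      using 3 by simp
    finally show ?thesis using nn by linarith
  qed
qed

text \<open>For a single s the derivative is discontinuous; this is the gain from integrating over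
  s. The factors \<open>mills2\<close> from the pointwise bound are unbounded, but the integrated
  tails complete them to the two summands of the Wronskian identity.\<close>

lemma nn_integral_stein_deriv_diff_le:
  assumes a: "0 \<le> a" "a \<le> 1 / 2"
  shows "(\<integral>\<^sup>+s. ennreal (exp (a * s) * \<bar>stein_deriv s x - stein_deriv s y\<bar>) \<partial>lborel)
    \<le> ennreal (4 * \<bar>x - y\<bar> * (1 + exp (a * x) + exp (a * y)))"
proof -
  have less: "(\<integral>\<^sup>+s. ennreal (exp (a * s) * \<bar>stein_deriv s x - stein_deriv s y\<bar>) \<partial>lborel)
    \<le> ennreal (4 * (x - y) * (1 + exp (a * x) + exp (a * y)))" if "y < x" for x y
  proof -
    let ?c1 = "(x - y) * mills2 y * exp (a * y)" and ?c3 = "(x - y) * mills2 (- x)"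
    have c: "0 \<le> ?c1" "0 \<le> ?c3" using that by (auto simp: mills2_nonneg)
    \<comment> \<open>Both summands of the Wronskian identity are nonnegative and their sum is 1, so
      each of them is at most 1.\<close>
    have w: "0 \<le> std_normal_density z * (mills2 z * mills1 (- z))"
      "std_normal_density z * (mills2 z * mills1 (- z)) \<le> 1" for z
      using mills_wronskian(1)[of z] mills2_nonneg[of z] mills1_nonneg[of "- z"]
        mills2_nonneg[of "- z"] mills1_nonneg[of z]
      by (auto simp: distrib_left intro!: mult_nonneg_nonneg)
         (metis add.commute le_add_same_cancel1 mult_nonneg_nonneg normal_density_nonneg)
    have "(\<integral>\<^sup>+s. ennreal (exp (a * s) * \<bar>stein_deriv s x - stein_deriv s y\<bar>) \<partial>lborel)
      \<le> (\<integral>\<^sup>+s. ennreal ?c1 * (ennreal (normal_tail (- s)) * indicator {..y} s)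
         + ennreal (exp (a * x)) * indicator {y..x} s
         + ennreal ?c3 * (ennreal (exp (a * s) * normal_tail s) * indicator {x..} s) \<partial>lborel)"
    proof (rule nn_integral_mono)
      fix s :: real
      show "ennreal (exp (a * s) * \<bar>stein_deriv s x - stein_deriv s y\<bar>)
        \<le> ennreal ?c1 * (ennreal (normal_tail (- s)) * indicator {..y} s)
         + ennreal (exp (a * x)) * indicator {y..x} s
         + ennreal ?c3 * (ennreal (exp (a * s) * normal_tail s) * indicator {x..} s)"
        using ennreal_leI[OF stein_deriv_diff_pointwise[OF a(1) that, of s]] c
        by (simp add: ennreal_plus ennreal_mult ennreal_indicator del: ennreal_plus)
           (simp add: ennreal_plus ennreal_mult ennreal_indicator c mills2_nonneg that less_imp_le)
    qed
    also have "\<dots> = ennreal ?c1 * (\<integral>\<^sup>+s. ennreal (normal_tail (- s)) * indicator {..y} s \<partial>lborel)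
        + ennreal (exp (a * x)) * (\<integral>\<^sup>+s. indicator {y..x} s \<partial>lborel)
        + ennreal ?c3 * (\<integral>\<^sup>+s. ennreal (exp (a * s) * normal_tail s) * indicator {x..} s \<partial>lborel)"
      by (simp add: nn_integral_add nn_integral_cmult)
    also have "\<dots> \<le> ennreal ?c1 * ennreal (std_normal_density y * mills1 (- y))
        + ennreal (exp (a * x)) * ennreal (x - y)
        + ennreal ?c3 * ennreal ((1 + 2 * exp (a * x)) * (std_normal_density x * mills1 x))"
      using that a by (intro add_mono mult_left_mono) (auto simp: nn_integral_tail_atMost nn_integral_exp_tail_le)
    also have "\<dots> = ennreal (?c1 * (std_normal_density y * mills1 (- y)) + exp (a * x) * (x - y)
        + ?c3 * ((1 + 2 * exp (a * x)) * (std_normal_density x * mills1 x)))"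
      using c that by (simp add: ennreal_mult ennreal_plus mills1_nonneg add_nonneg_nonneg)
    also have "\<dots> \<le> ennreal (4 * (x - y) * (1 + exp (a * x) + exp (a * y)))"
    proof (rule ennreal_leI)
      have "?c1 * (std_normal_density y * mills1 (- y))
        = ((x - y) * exp (a * y)) * (std_normal_density y * (mills2 y * mills1 (- y)))" by (simp add: mult_ac)
      also have "\<dots> \<le> ((x - y) * exp (a * y)) * 1" using that w[of y] by (intro mult_left_mono) auto
      finally have 1: "?c1 * (std_normal_density y * mills1 (- y)) \<le> (x - y) * exp (a * y)" by simp
      have "?c3 * ((1 + 2 * exp (a * x)) * (std_normal_density x * mills1 x))
        = ((x - y) * (1 + 2 * exp (a * x))) * (std_normal_density (- x) * (mills2 (- x) * mills1 (- (- x))))" by (simp add: mult_ac)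
      also have "\<dots> \<le> ((x - y) * (1 + 2 * exp (a * x))) * 1" using that w[of "- x"] by (intro mult_left_mono) auto
      finally have 2: "?c3 * ((1 + 2 * exp (a * x)) * (std_normal_density x * mills1 x)) \<le> (x - y) * (1 + 2 * exp (a * x))" by simp
      have "?c1 * (std_normal_density y * mills1 (- y)) + exp (a * x) * (x - y)
        + ?c3 * ((1 + 2 * exp (a * x)) * (std_normal_density x * mills1 x))
        \<le> (x - y) * (exp (a * y) + exp (a * x) + (1 + 2 * exp (a * x)))"
        using 1 2 by (simp add: algebra_simps)
      \<comment> \<open>The coefficients 1, 3 and 1 are rounded up to 4, which makes the bound
        symmetric in the two points.\<close>
      also have "\<dots> \<le> (x - y) * (4 * (1 + exp (a * x) + exp (a * y)))"
        using that by (intro mult_left_mono) (auto simp: algebra_simps)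
      also have "\<dots> = 4 * (x - y) * (1 + exp (a * x) + exp (a * y))" by (simp only: mult_ac)
      finally show "?c1 * (std_normal_density y * mills1 (- y)) + exp (a * x) * (x - y)
        + ?c3 * ((1 + 2 * exp (a * x)) * (std_normal_density x * mills1 x))
        \<le> 4 * (x - y) * (1 + exp (a * x) + exp (a * y))" .
    qed
    finally show ?thesis .
  qed
  consider "x = y" | "y < x" | "x < y" by linarith
  then show ?thesis
  proof cases
    case 2 then show ?thesis using less[OF 2] by simp
  next
    case 3
    have "(\<integral>\<^sup>+s. ennreal (exp (a * s) * \<bar>stein_deriv s x - stein_deriv s y\<bar>) \<partial>lborel)
      = (\<integral>\<^sup>+s. ennreal (exp (a * s) * \<bar>stein_deriv s y - stein_deriv s x\<bar>) \<partial>lborel)"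
      by (simp add: abs_minus_commute)
    with less[OF 3] 3 show ?thesis by (simp add: add_ac)
  qed simp
qed

section \<open>An exponentially weighted L1 bound for sums of independent variables\<close>

text \<open>The remainder of first order is the integral of an increment of the derivative. The
  derivative is missing only at the kink s, which the fundamental theorem tolerates as an
  exceptional point because the solution is continuous there.\<close>

lemma stein_sol_taylor_le:
  "ennreal \<bar>stein_sol s (y + x) - stein_sol s y - x * stein_deriv s y\<bar>
    \<le> (\<integral>\<^sup>+u. ennreal \<bar>stein_deriv s u - stein_deriv s y\<bar> * indicator {min y (y + x)..max y (y + x)} u \<partial>lborel)"
proof -
  define p q where "p = min y (y + x)" and "q = max y (y + x)"
  have pq: "p \<le> q" by (simp add: p_def q_def)
  define F where "F = (\<lambda>u. stein_sol s u - u * stein_deriv s y)"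
  define f where "f = (\<lambda>u. stein_deriv s u - stein_deriv s y)"
  have [measurable]: "f \<in> borel_measurable borel" unfolding f_def by measurable
  have hi: "(f has_integral (F q - F p)) {p..q}"
  proof (rule fundamental_theorem_of_calculus_interior_strong[where S = "{s}"])
    fix u assume "u \<in> {p<..<q} - {s}"
    then show "(F has_vector_derivative f u) (at u)"
      unfolding F_def f_def has_real_derivative_iff_has_vector_derivative[symmetric]
      by (auto intro!: derivative_eq_intros has_real_derivative_stein_sol)
  next
    show "continuous_on {p..q} F"
      unfolding F_def by (intro continuous_intros continuous_on_subset[OF continuous_on_stein_sol]) auto
  qed (use pq in auto)
  have fb: "\<bar>f u\<bar> \<le> 2" for u
    using abs_stein_deriv_le_1[of s u] abs_stein_deriv_le_1[of s y] unfolding f_def by linarith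
  have int: "set_integrable lborel {p..q} f"
    unfolding set_integrable_def
    by (rule integrableI_bounded_set_indicator[where B = 2]) (use fb pq in auto)
  have "\<bar>stein_sol s (y + x) - stein_sol s y - x * stein_deriv s y\<bar> = \<bar>F q - F p\<bar>"
    by (auto simp: F_def p_def q_def min_def max_def algebra_simps)
  also have "F q - F p = (LINT u:{p..q}|lborel. f u)"
    using set_borel_integral_eq_integral(2)[OF int] integral_unique[OF hi] by simp
  finally have "ennreal \<bar>stein_sol s (y + x) - stein_sol s y - x * stein_deriv s y\<bar>
    = ennreal (norm (LINT u|lborel. indicator {p..q} u *\<^sub>R f u))"
    by (simp add: set_lebesgue_integral_def)
  also have "\<dots> \<le> (\<integral>\<^sup>+u. ennreal (norm (indicator {p..q} u *\<^sub>R f u)) \<partial>lborel)"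
    by (rule integral_norm_bound_ennreal) (use int in \<open>simp add: set_integrable_def\<close>)
  also have "\<dots> = (\<integral>\<^sup>+u. ennreal \<bar>f u\<bar> * indicator {p..q} u \<partial>lborel)"
    by (intro nn_integral_cong) (auto split: split_indicator)
  finally show ?thesis by (simp add: f_def p_def q_def)
qed

text \<open>Separates the variables: the weight at a point within distance |x| of y is bounded by a
  function of y times a function of x. With y the leave-one-out sum and x the remaining summand,
  independence can then split the expectation.\<close>

lemma exp_shift_le:
  fixes a u x y :: real
  assumes "0 \<le> a" "u \<le> y + \<bar>x\<bar>"
  shows "1 + exp (a * u) + exp (a * y) \<le> (1 + 2 * exp (a * y)) * exp (a * \<bar>x\<bar>)"
proof -
  have "exp (a * u) \<le> exp (a * y) * exp (a * \<bar>x\<bar>)"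
    using assms mult_left_mono[OF assms(2,1)] by (simp add: mult_exp_exp algebra_simps)
  moreover have "exp (a * y) \<le> exp (a * y) * exp (a * \<bar>x\<bar>)" using assms by simp
  moreover have "1 \<le> exp (a * \<bar>x\<bar>)" using assms by simp
  ultimately have "1 + exp (a * u) + exp (a * y)
      \<le> exp (a * \<bar>x\<bar>) + exp (a * y) * exp (a * \<bar>x\<bar>) + exp (a * y) * exp (a * \<bar>x\<bar>)"
    by linarith
  then show ?thesis by (simp add: algebra_simps)
qed

lemma nn_integral_stein_deriv_shift_le:
  assumes a: "0 \<le> a" "a \<le> 1 / 2"
  shows "(\<integral>\<^sup>+s. ennreal (exp (a * s) * \<bar>stein_deriv s (y + x) - stein_deriv s y\<bar>) \<partial>lborel)
    \<le> ennreal (4 * \<bar>x\<bar> * ((1 + 2 * exp (a * y)) * exp (a * \<bar>x\<bar>)))"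
proof -
  have "4 * \<bar>y + x - y\<bar> * (1 + exp (a * (y + x)) + exp (a * y)) \<le> 4 * \<bar>x\<bar> * ((1 + 2 * exp (a * y)) * exp (a * \<bar>x\<bar>))"
    using exp_shift_le[OF a(1), of "y + x" y x] by (intro mult_mono) (auto simp: add_nonneg_nonneg)
  from order_trans[OF nn_integral_stein_deriv_diff_le[OF a, of "y + x" y] ennreal_leI[OF this]]
  show ?thesis .
qed

text \<open>The remainder is an integral of increments over an interval of length |x|. After
  exchanging the two integrations each increment costs a multiple of |x|, and so the total is of
  order x^2.\<close>

lemma nn_integral_stein_taylor_le:
  assumes a: "0 \<le> a" "a \<le> 1 / 2"
  shows "(\<integral>\<^sup>+s. ennreal (exp (a * s) * \<bar>stein_sol s (y + x) - stein_sol s y - x * stein_deriv s y\<bar>) \<partial>lborel)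
    \<le> ennreal (4 * x\<^sup>2 * ((1 + 2 * exp (a * y)) * exp (a * \<bar>x\<bar>)))"
proof -
  define A where "A = {min y (y + x)..max y (y + x)}"
  let ?c = "4 * \<bar>x\<bar> * ((1 + 2 * exp (a * y)) * exp (a * \<bar>x\<bar>))"
  have A_len: "emeasure lborel A = ennreal \<bar>x\<bar>"
    by (auto simp: A_def min_def max_def)
  have "(\<integral>\<^sup>+s. ennreal (exp (a * s) * \<bar>stein_sol s (y + x) - stein_sol s y - x * stein_deriv s y\<bar>) \<partial>lborel)
    \<le> (\<integral>\<^sup>+s. (\<integral>\<^sup>+u. ennreal (exp (a * s) * \<bar>stein_deriv s u - stein_deriv s y\<bar>) * indicator A u \<partial>lborel) \<partial>lborel)"
  proof (rule nn_integral_mono)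
    fix s
    have "ennreal (exp (a * s) * \<bar>stein_sol s (y + x) - stein_sol s y - x * stein_deriv s y\<bar>)
      \<le> ennreal (exp (a * s)) * (\<integral>\<^sup>+u. ennreal \<bar>stein_deriv s u - stein_deriv s y\<bar> * indicator A u \<partial>lborel)"
      unfolding A_def by (subst ennreal_mult) (auto intro!: mult_left_mono stein_sol_taylor_le)
    also have "\<dots> = (\<integral>\<^sup>+u. ennreal (exp (a * s) * \<bar>stein_deriv s u - stein_deriv s y\<bar>) * indicator A u \<partial>lborel)"
      by (subst nn_integral_cmult[symmetric]) (auto simp: A_def ennreal_mult mult.assoc)
    finally show "ennreal (exp (a * s) * \<bar>stein_sol s (y + x) - stein_sol s y - x * stein_deriv s y\<bar>) \<le> \<dots>" .
  qed
  also have "\<dots> = (\<integral>\<^sup>+u. (\<integral>\<^sup>+s. ennreal (exp (a * s) * \<bar>stein_deriv s u - stein_deriv s y\<bar>) * indicator A u \<partial>lborel) \<partial>lborel)"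
    by (rule lborel_pair.Fubini'[symmetric]) (auto simp: A_def)
  also have "\<dots> \<le> (\<integral>\<^sup>+u. ennreal ?c * indicator A u \<partial>lborel)"
  proof (rule nn_integral_mono)
    fix u
    show "(\<integral>\<^sup>+s. ennreal (exp (a * s) * \<bar>stein_deriv s u - stein_deriv s y\<bar>) * indicator A u \<partial>lborel)
      \<le> ennreal ?c * indicator A u"
    proof (cases "u \<in> A")
      case True
      then have u: "\<bar>u - y\<bar> \<le> \<bar>x\<bar>" "u \<le> y + \<bar>x\<bar>" by (auto simp: A_def min_def max_def split: if_splits)
      have "4 * \<bar>u - y\<bar> * (1 + exp (a * u) + exp (a * y)) \<le> ?c"
        using exp_shift_le[OF a(1) u(2)] u(1) by (intro mult_mono) (auto simp: add_nonneg_nonneg)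
      from order_trans[OF nn_integral_stein_deriv_diff_le[OF a, of u y] ennreal_leI[OF this]]
      show ?thesis using True by simp
    qed simp
  qed
  also have "\<dots> = ennreal ?c * ennreal \<bar>x\<bar>"
    by (subst nn_integral_cmult_indicator) (auto simp: A_len[symmetric] A_def)
  also have "\<dots> = ennreal (4 * x\<^sup>2 * ((1 + 2 * exp (a * y)) * exp (a * \<bar>x\<bar>)))"
  proof (subst ennreal_mult[symmetric])
    have "?c * \<bar>x\<bar> = 4 * (\<bar>x\<bar> * \<bar>x\<bar>) * ((1 + 2 * exp (a * y)) * exp (a * \<bar>x\<bar>))" by (simp only: mult_ac)
    then show "ennreal (?c * \<bar>x\<bar>) = ennreal (4 * x\<^sup>2 * ((1 + 2 * exp (a * y)) * exp (a * \<bar>x\<bar>)))"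
      by (simp add: power2_eq_square)
  qed (auto simp: add_nonneg_nonneg)
  finally show ?thesis .
qed

section \<open>Leave-one-out expansion of a sum of independent variables\<close>

context prob_space
begin

text \<open>Stated for integrals of extended nonnegative functions, so that exponential factors can
  be separated without proving them integrable first.\<close>

lemma indep_var_nn_integral_mult:
  assumes ind: "indep_var borel X borel Y"
    and [measurable]: "f \<in> borel_measurable (borel :: real measure)" "g \<in> borel_measurable (borel :: real measure)"
  shows "(\<integral>\<^sup>+\<omega>. f (X \<omega>) * g (Y \<omega>) \<partial>M) = (\<integral>\<^sup>+\<omega>. f (X \<omega>) \<partial>M) * (\<integral>\<^sup>+\<omega>. g (Y \<omega>) \<partial>M)"
proof -
  have [measurable]: "X \<in> borel_measurable M" "Y \<in> borel_measurable M"
    using indep_var_rv1[OF ind] indep_var_rv2[OF ind] by auto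
  interpret Y: prob_space "distr M borel Y" by (rule prob_space_distr) simp
  have eq: "distr M (borel \<Otimes>\<^sub>M borel) (\<lambda>\<omega>. (X \<omega>, Y \<omega>)) = distr M borel X \<Otimes>\<^sub>M distr M borel Y"
    using ind by (simp add: indep_var_distribution_eq)
  have "(\<integral>\<^sup>+\<omega>. f (X \<omega>) * g (Y \<omega>) \<partial>M) = (\<integral>\<^sup>+z. f (fst z) * g (snd z) \<partial>distr M (borel \<Otimes>\<^sub>M borel) (\<lambda>\<omega>. (X \<omega>, Y \<omega>)))"
    by (subst nn_integral_distr) auto
  also have "\<dots> = (\<integral>\<^sup>+x. (\<integral>\<^sup>+y. f x * g y \<partial>distr M borel Y) \<partial>distr M borel X)"
    unfolding eq by (subst Y.nn_integral_fst[symmetric]) auto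
  also have "\<dots> = (\<integral>\<^sup>+x. f x \<partial>distr M borel X) * (\<integral>\<^sup>+y. g y \<partial>distr M borel Y)"
    by (simp add: nn_integral_cmult nn_integral_multc)
  finally show ?thesis by (simp add: nn_integral_distr)
qed

text \<open>Expands E (Y f (Y)) for f = \<open>stein_sol s\<close>. As X_i is centred and
  independent of R_i, subtracting E (X_i f (R_i)) changes nothing, and X_i^2 f' (R_i) has the
  product of expectations as its mean. The variances add up to 1, so E f' (Y) can be distributed
  over i with the variances as weights; what remains is an increment of f' and a Taylor remainder
  for each i.\<close>

lemma stein_tail_diff_eq:
  fixes X :: "'i \<Rightarrow> 'a \<Rightarrow> real"
  assumes I: "finite I" and ind: "indep_vars (\<lambda>_. borel) X I"
    and sq: "\<And>i. i \<in> I \<Longrightarrow> integrable M (\<lambda>\<omega>. (X i \<omega>)\<^sup>2)"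
    and mean: "\<And>i. i \<in> I \<Longrightarrow> expectation (X i) = 0"
    and var: "(\<Sum>i\<in>I. expectation (\<lambda>\<omega>. (X i \<omega>)\<^sup>2)) = 1"
  defines "Y \<equiv> \<lambda>\<omega>. \<Sum>i\<in>I. X i \<omega>" and "R \<equiv> \<lambda>i \<omega>. \<Sum>j\<in>I - {i}. X j \<omega>"
  shows "prob {\<omega>\<in>space M. s < Y \<omega>} - normal_tail s
    = (\<Sum>i\<in>I. expectation (\<lambda>\<omega>. (X i \<omega>)\<^sup>2) * expectation (\<lambda>\<omega>. stein_deriv s (R i \<omega> + X i \<omega>) - stein_deriv s (R i \<omega>))
        - expectation (\<lambda>\<omega>. X i \<omega> * (stein_sol s (R i \<omega> + X i \<omega>) - stein_sol s (R i \<omega>) - X i \<omega> * stein_deriv s (R i \<omega>))))"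
proof -
  have X[measurable]: "X i \<in> borel_measurable M" if "i \<in> I" for i
    using ind that by (auto simp: indep_vars_def)
  have R[measurable]: "R i \<in> borel_measurable M" for i
    unfolding R_def by (rule borel_measurable_sum) auto
  have Y[measurable]: "Y \<in> borel_measurable M"
    unfolding Y_def by (rule borel_measurable_sum) auto
  have YR: "Y \<omega> = R i \<omega> + X i \<omega>" if "i \<in> I" for i \<omega>
    using I that by (simp add: Y_def R_def sum.remove)
  have indR: "indep_var borel (X i) borel (R i)" if "i \<in> I" for i
    unfolding R_def
    by (rule indep_vars_sum) (use I ind that in \<open>auto simp: insert_absorb\<close>)
  have int1: "integrable M (X i)" if "i \<in> I" for i
    using sq[OF that] X[OF that] by (rule square_integrable_imp_integrable[rotated])
  have gint: "integrable M (\<lambda>\<omega>. stein_deriv s (Z \<omega>))" if [measurable]: "Z \<in> borel_measurable M" for Z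
    by (rule integrable_const_bound[where B = 1]) (auto simp: abs_stein_deriv_le_1)
  have fint: "integrable M (\<lambda>\<omega>. stein_sol s (Z \<omega>))" if [measurable]: "Z \<in> borel_measurable M" for Z
    by (rule integrable_const_bound[where B = "mills0 0"]) (auto simp: abs_stein_sol_le)
  have Xf: "integrable M (\<lambda>\<omega>. X i \<omega> * stein_sol s (Z \<omega>))"
    if "i \<in> I" and [measurable]: "Z \<in> borel_measurable M" for i Z
  proof (rule Bochner_Integration.integrable_bound[OF integrable_mult_left[OF int1[OF that(1)], of "mills0 0"]])
    show "AE \<omega> in M. norm (X i \<omega> * stein_sol s (Z \<omega>)) \<le> norm (X i \<omega> * mills0 0)"
      by (auto simp: abs_mult abs_stein_sol_le mills0_nonneg intro!: mult_left_mono)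
  qed (use that in measurable)
  have Xg: "integrable M (\<lambda>\<omega>. (X i \<omega>)\<^sup>2 * stein_deriv s (Z \<omega>))"
    if "i \<in> I" and [measurable]: "Z \<in> borel_measurable M" for i Z
  proof (rule Bochner_Integration.integrable_bound[OF sq[OF that(1)]])
    show "AE \<omega> in M. norm ((X i \<omega>)\<^sup>2 * stein_deriv s (Z \<omega>)) \<le> norm ((X i \<omega>)\<^sup>2)"
      by (auto simp: abs_mult abs_stein_deriv_le_1 mult_left_le)
  qed (use that in measurable)
  have Yf: "integrable M (\<lambda>\<omega>. Y \<omega> * stein_sol s (Y \<omega>))"
    unfolding Y_def sum_distrib_right
    using Xf[OF _ Y] by (intro Bochner_Integration.integrable_sum) (simp add: Y_def)
  have indicator_int: "expectation (\<lambda>\<omega>. indicator {s<..} (Y \<omega>)) = prob {\<omega>\<in>space M. s < Y \<omega>}"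
  proof -
    have "expectation (\<lambda>\<omega>. indicator {s<..} (Y \<omega>)) = expectation (indicat_real {\<omega>\<in>space M. s < Y \<omega>})"
      by (intro Bochner_Integration.integral_cong) (auto simp: indicator_def)
    then show ?thesis by simp
  qed
  have "expectation (\<lambda>\<omega>. stein_deriv s (Y \<omega>)) = expectation (\<lambda>\<omega>. Y \<omega> * stein_sol s (Y \<omega>)) + prob {\<omega>\<in>space M. s < Y \<omega>} - normal_tail s"
  proof -
    have ii: "integrable M (\<lambda>\<omega>. indicat_real {s<..} (Y \<omega>))"
      by (rule integrable_const_bound[where B = 1]) auto
    show ?thesis
      unfolding stein_equation using Yf ii by (simp add: prob_space indicator_int)
  qed
  then have 1: "prob {\<omega>\<in>space M. s < Y \<omega>} - normal_tail s
    = (\<Sum>i\<in>I. expectation (\<lambda>\<omega>. (X i \<omega>)\<^sup>2)) * expectation (\<lambda>\<omega>. stein_deriv s (Y \<omega>)) - expectation (\<lambda>\<omega>. Y \<omega> * stein_sol s (Y \<omega>))"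
    by (simp add: var)
  have 2: "expectation (\<lambda>\<omega>. Y \<omega> * stein_sol s (Y \<omega>)) = (\<Sum>i\<in>I. expectation (\<lambda>\<omega>. X i \<omega> * stein_sol s (Y \<omega>)))"
    using Bochner_Integration.integral_sum[of I M "\<lambda>i \<omega>. X i \<omega> * stein_sol s (Y \<omega>)"] Xf[OF _ Y]
    by (simp add: Y_def sum_distrib_right)
  have 3: "expectation (\<lambda>\<omega>. X i \<omega> * stein_sol s (Y \<omega>))
    = expectation (\<lambda>\<omega>. X i \<omega> * (stein_sol s (R i \<omega> + X i \<omega>) - stein_sol s (R i \<omega>) - X i \<omega> * stein_deriv s (R i \<omega>)))
      + expectation (\<lambda>\<omega>. (X i \<omega>)\<^sup>2) * expectation (\<lambda>\<omega>. stein_deriv s (R i \<omega>))" if i: "i \<in> I" for i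
  proof -
    have c1: "indep_var borel (X i) borel (\<lambda>\<omega>. stein_sol s (R i \<omega>))"
      using indep_var_compose[OF indR[OF i], of "\<lambda>x. x" borel "stein_sol s" borel] by (simp add: comp_def)
    have c2: "indep_var borel (\<lambda>\<omega>. (X i \<omega>)\<^sup>2) borel (\<lambda>\<omega>. stein_deriv s (R i \<omega>))"
      using indep_var_compose[OF indR[OF i], of "\<lambda>x. x\<^sup>2" borel "stein_deriv s" borel] by (simp add: comp_def)
    have e1: "expectation (\<lambda>\<omega>. X i \<omega> * stein_sol s (R i \<omega>)) = 0"
      using indep_var_lebesgue_integral[OF c1 int1[OF i] fint[OF R]] mean[OF i] by simp
    have e2: "expectation (\<lambda>\<omega>. (X i \<omega>)\<^sup>2 * stein_deriv s (R i \<omega>))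
      = expectation (\<lambda>\<omega>. (X i \<omega>)\<^sup>2) * expectation (\<lambda>\<omega>. stein_deriv s (R i \<omega>))"
      by (rule indep_var_lebesgue_integral[OF c2 sq[OF i] gint[OF R]])
    have "expectation (\<lambda>\<omega>. X i \<omega> * (stein_sol s (R i \<omega> + X i \<omega>) - stein_sol s (R i \<omega>) - X i \<omega> * stein_deriv s (R i \<omega>)))
      = expectation (\<lambda>\<omega>. X i \<omega> * stein_sol s (Y \<omega>) - X i \<omega> * stein_sol s (R i \<omega>) - (X i \<omega>)\<^sup>2 * stein_deriv s (R i \<omega>))"
      by (simp add: YR[OF i] algebra_simps power2_eq_square)
    also have "\<dots> = expectation (\<lambda>\<omega>. X i \<omega> * stein_sol s (Y \<omega>)) - 0 - expectation (\<lambda>\<omega>. (X i \<omega>)\<^sup>2) * expectation (\<lambda>\<omega>. stein_deriv s (R i \<omega>))"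
      using Xf[OF i Y] Xf[OF i R] Xg[OF i R]
      by (simp add: Bochner_Integration.integral_diff Bochner_Integration.integrable_diff e1 e2)
    finally show ?thesis by simp
  qed
  have 4: "expectation (\<lambda>\<omega>. stein_deriv s (R i \<omega> + X i \<omega>) - stein_deriv s (R i \<omega>))
    = expectation (\<lambda>\<omega>. stein_deriv s (Y \<omega>)) - expectation (\<lambda>\<omega>. stein_deriv s (R i \<omega>))" if "i \<in> I" for i
    using gint[OF Y] gint[OF R] by (simp add: YR[OF that, symmetric])
  show ?thesis
    unfolding 1 2 sum_distrib_right sum_subtractf[symmetric]
    by (intro sum.cong refl) (simp add: 3 4 algebra_simps)
qed

text \<open>Each i contributes its variance times an increment of order |X_i|, and |X_i| times a
  remainder of order X_i^2. The variances add up to 1, so the increments give \<open>b1\<close> only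
  once, while the remainders give \<open>b3\<close> for every i. For n summands of size 1 / sqrt n
  both parts are of order 1 / sqrt n.\<close>

theorem stein_tail_L1_bound:
  fixes X :: "'i \<Rightarrow> 'a \<Rightarrow> real" and a B b1 b3 :: real
  assumes I: "finite I" and ind: "indep_vars (\<lambda>_. borel) X I"
    and sq: "\<And>i. i \<in> I \<Longrightarrow> integrable M (\<lambda>\<omega>. (X i \<omega>)\<^sup>2)"
    and mean: "\<And>i. i \<in> I \<Longrightarrow> expectation (X i) = 0"
    and var: "(\<Sum>i\<in>I. expectation (\<lambda>\<omega>. (X i \<omega>)\<^sup>2)) = 1"
    and a: "0 \<le> a" "a \<le> 1 / 2" and nn: "0 \<le> B" "0 \<le> b1" "0 \<le> b3"
    and B: "\<And>i. i \<in> I \<Longrightarrow> (\<integral>\<^sup>+\<omega>. ennreal (exp (a * (\<Sum>j\<in>I - {i}. X j \<omega>))) \<partial>M) \<le> ennreal B"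
    and b1: "\<And>i. i \<in> I \<Longrightarrow> (\<integral>\<^sup>+\<omega>. ennreal (\<bar>X i \<omega>\<bar> * exp (a * \<bar>X i \<omega>\<bar>)) \<partial>M) \<le> ennreal b1"
    and b3: "\<And>i. i \<in> I \<Longrightarrow> (\<integral>\<^sup>+\<omega>. ennreal (\<bar>X i \<omega>\<bar> ^ 3 * exp (a * \<bar>X i \<omega>\<bar>)) \<partial>M) \<le> ennreal b3"
  shows "(\<integral>\<^sup>+s. ennreal (exp (a * s) * \<bar>prob {\<omega>\<in>space M. s < (\<Sum>i\<in>I. X i \<omega>)} - normal_tail s\<bar>) \<partial>lborel)
    \<le> ennreal (4 * (1 + 2 * B) * (b1 + card I * b3))"
proof -
  define R where "R = (\<lambda>i \<omega>. \<Sum>j\<in>I - {i}. X j \<omega>)"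
  define V where "V = (\<lambda>i. expectation (\<lambda>\<omega>. (X i \<omega>)\<^sup>2))"
  define G where "G = (\<lambda>i s \<omega>. stein_deriv s (R i \<omega> + X i \<omega>) - stein_deriv s (R i \<omega>))"
  define T where "T = (\<lambda>i s \<omega>. stein_sol s (R i \<omega> + X i \<omega>) - stein_sol s (R i \<omega>) - X i \<omega> * stein_deriv s (R i \<omega>))"
  let ?EG = "\<lambda>i s. \<integral>\<^sup>+\<omega>. ennreal (exp (a * s) * \<bar>G i s \<omega>\<bar>) \<partial>M"
  let ?ET = "\<lambda>i s. \<integral>\<^sup>+\<omega>. ennreal (exp (a * s) * (\<bar>X i \<omega>\<bar> * \<bar>T i s \<omega>\<bar>)) \<partial>M"
  let ?W = "\<lambda>i \<omega>. (1 + 2 * exp (a * R i \<omega>)) * exp (a * \<bar>X i \<omega>\<bar>)"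
  let ?ER = "\<lambda>i. \<integral>\<^sup>+\<omega>. ennreal (1 + 2 * exp (a * R i \<omega>)) \<partial>M"
  have V_nonneg: "0 \<le> V i" for i by (simp add: V_def)
  have X[measurable]: "X i \<in> borel_measurable M" if "i \<in> I" for i
    using ind that by (auto simp: indep_vars_def)
  have R[measurable]: "R i \<in> borel_measurable M" for i
    unfolding R_def by (rule borel_measurable_sum) auto
  have indR: "indep_var borel (X i) borel (R i)" if "i \<in> I" for i
    unfolding R_def
    by (rule indep_vars_sum) (use I ind that in \<open>auto simp: insert_absorb\<close>)
  have expR: "?ER i \<le> ennreal (1 + 2 * B)" if i: "i \<in> I" for i
  proof -
    have "?ER i = 1 + 2 * (\<integral>\<^sup>+\<omega>. ennreal (exp (a * R i \<omega>)) \<partial>M)"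
      by (simp add: ennreal_plus ennreal_mult nn_integral_add nn_integral_cmult emeasure_space_1)
    also have "\<dots> \<le> 1 + 2 * ennreal B"
      using B[OF i] by (intro add_mono mult_left_mono) (auto simp: R_def)
    finally show ?thesis using nn by (simp add: ennreal_plus ennreal_mult)
  qed
  \<comment> \<open>The weight is a product of a factor in \<open>X i\<close> and a factor in
    \<open>R i\<close>; independence separates them, and \<open>expR\<close> bounds the second
    one.\<close>
  have prod_bound: "(\<integral>\<^sup>+\<omega>. ennreal (4 * h (X i \<omega>) * ?W i \<omega>) \<partial>M)
      \<le> ennreal (4 * (1 + 2 * B) * b)"
    if i: "i \<in> I" and h: "h \<in> borel_measurable borel" "\<And>x. 0 \<le> h x" "0 \<le> b"
      and bd: "(\<integral>\<^sup>+\<omega>. ennreal (h (X i \<omega>) * exp (a * \<bar>X i \<omega>\<bar>)) \<partial>M) \<le> ennreal b" for i h b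
  proof -
    note [measurable] = X[OF i] h(1)
    have "(\<integral>\<^sup>+\<omega>. ennreal (4 * h (X i \<omega>) * ?W i \<omega>) \<partial>M)
      = (\<integral>\<^sup>+\<omega>. 4 * (ennreal (h (X i \<omega>) * exp (a * \<bar>X i \<omega>\<bar>)) * ennreal (1 + 2 * exp (a * R i \<omega>))) \<partial>M)"
      by (intro nn_integral_cong)
         (simp add: h ennreal_mult'[symmetric] ennreal_mult''[symmetric] add_nonneg_nonneg mult_ac ennreal_numeral[symmetric] del: ennreal_numeral ennreal_plus)
    also have "\<dots> = 4 * ((\<integral>\<^sup>+\<omega>. ennreal (h (X i \<omega>) * exp (a * \<bar>X i \<omega>\<bar>)) \<partial>M) * ?ER i)"
      by (subst indep_var_nn_integral_mult[OF indR[OF i], symmetric]) (auto simp: nn_integral_cmult)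
    also have "\<dots> \<le> 4 * (ennreal b * ennreal (1 + 2 * B))"
      by (intro mult_left_mono mult_mono bd expR i) auto
    also have "\<dots> = ennreal (4 * (1 + 2 * B) * b)"
      using nn h by (simp add: ennreal_mult'[symmetric] ennreal_mult''[symmetric] add_nonneg_nonneg mult_ac ennreal_numeral[symmetric] del: ennreal_numeral ennreal_plus)
    finally show ?thesis .
  qed
  have [measurable]: "(\<lambda>(s, \<omega>). G i s \<omega>) \<in> borel_measurable (borel \<Otimes>\<^sub>M M)"
      "(\<lambda>(s, \<omega>). T i s \<omega>) \<in> borel_measurable (borel \<Otimes>\<^sub>M M)"
      "(\<lambda>(\<omega>, s). G i s \<omega>) \<in> borel_measurable (M \<Otimes>\<^sub>M borel)"
      "(\<lambda>(\<omega>, s). T i s \<omega>) \<in> borel_measurable (M \<Otimes>\<^sub>M borel)"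
      "G i s \<in> borel_measurable M" "T i s \<in> borel_measurable M" if i: "i \<in> I" for i s
    using X[OF i] unfolding G_def T_def case_prod_beta by measurable
  have Fub: "(\<integral>\<^sup>+s. (\<integral>\<^sup>+\<omega>. f s \<omega> \<partial>M) \<partial>lborel) = (\<integral>\<^sup>+\<omega>. (\<integral>\<^sup>+s. f s \<omega> \<partial>lborel) \<partial>M)"
    if "(\<lambda>(s, \<omega>). f s \<omega>) \<in> borel_measurable (lborel \<Otimes>\<^sub>M M)" for f :: "real \<Rightarrow> 'a \<Rightarrow> ennreal"
  proof -
    interpret pair_sigma_finite lborel M by standard
    show ?thesis using Fubini[OF that] by simp
  qed
  have bG: "(\<integral>\<^sup>+s. ?EG i s \<partial>lborel) \<le> ennreal (4 * (1 + 2 * B) * b1)" if i: "i \<in> I" for i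
  proof -
    note [measurable] = X[OF i]
    have "(\<integral>\<^sup>+s. ?EG i s \<partial>lborel)
      = (\<integral>\<^sup>+\<omega>. (\<integral>\<^sup>+s. ennreal (exp (a * s) * \<bar>G i s \<omega>\<bar>) \<partial>lborel) \<partial>M)"
      by (rule Fub) (use i in measurable)
    also have "\<dots> \<le> (\<integral>\<^sup>+\<omega>. ennreal (4 * \<bar>X i \<omega>\<bar> * ?W i \<omega>) \<partial>M)"
      unfolding G_def by (intro nn_integral_mono nn_integral_stein_deriv_shift_le a)
    also have "\<dots> \<le> ennreal (4 * (1 + 2 * B) * b1)"
      by (rule prod_bound) (use i nn b1 in auto)
    finally show ?thesis .
  qed
  have bT: "(\<integral>\<^sup>+s. ?ET i s \<partial>lborel) \<le> ennreal (4 * (1 + 2 * B) * b3)" if i: "i \<in> I" for i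
  proof -
    note [measurable] = X[OF i]
    have "(\<integral>\<^sup>+s. ?ET i s \<partial>lborel)
      = (\<integral>\<^sup>+\<omega>. (\<integral>\<^sup>+s. ennreal (exp (a * s) * (\<bar>X i \<omega>\<bar> * \<bar>T i s \<omega>\<bar>)) \<partial>lborel) \<partial>M)"
      by (rule Fub) (use i in measurable)
    also have "\<dots> = (\<integral>\<^sup>+\<omega>. ennreal \<bar>X i \<omega>\<bar> * (\<integral>\<^sup>+s. ennreal (exp (a * s) * \<bar>T i s \<omega>\<bar>) \<partial>lborel) \<partial>M)"
      unfolding T_def
      by (intro nn_integral_cong, subst nn_integral_cmult[symmetric])
         (auto simp: ennreal_mult'[symmetric] ennreal_mult''[symmetric] mult_ac)
    also have "\<dots> \<le> (\<integral>\<^sup>+\<omega>. ennreal \<bar>X i \<omega>\<bar> * ennreal (4 * (X i \<omega>)\<^sup>2 * ?W i \<omega>) \<partial>M)"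
      unfolding T_def by (intro nn_integral_mono mult_left_mono nn_integral_stein_taylor_le a) auto
    also have "\<dots> = (\<integral>\<^sup>+\<omega>. ennreal (4 * \<bar>X i \<omega>\<bar> ^ 3 * ?W i \<omega>) \<partial>M)"
    proof (intro nn_integral_cong)
      fix \<omega>
      have "\<bar>X i \<omega>\<bar> * (4 * (X i \<omega>)\<^sup>2 * ?W i \<omega>)
        = 4 * \<bar>X i \<omega>\<bar> ^ 3 * ?W i \<omega>"
        unfolding power2_abs[of "X i \<omega>", symmetric] by (simp add: power2_eq_square power3_eq_cube del: power2_abs abs_mult_self_eq)
      then show "ennreal \<bar>X i \<omega>\<bar> * ennreal (4 * (X i \<omega>)\<^sup>2 * ?W i \<omega>)
        = ennreal (4 * \<bar>X i \<omega>\<bar> ^ 3 * ?W i \<omega>)"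
        by (simp add: ennreal_mult'[symmetric])
    qed
    also have "\<dots> \<le> ennreal (4 * (1 + 2 * B) * b3)"
      by (rule prod_bound[of i "\<lambda>x. \<bar>x\<bar> ^ 3" b3]) (use i nn b3 in auto)
    finally show ?thesis .
  qed
  have pointwise: "ennreal (exp (a * s) * \<bar>prob {\<omega>\<in>space M. s < (\<Sum>i\<in>I. X i \<omega>)} - normal_tail s\<bar>)
    \<le> (\<Sum>i\<in>I. ennreal (V i) * ?EG i s
        + ?ET i s)" for s
  proof -
    \<comment> \<open>The expectation of a non-integrable function is 0 by convention, so this bound
      holds for every \<open>f\<close> and no integrability has to be checked when it is
      applied.\<close>
    have norm_le: "ennreal \<bar>expectation f\<bar> \<le> (\<integral>\<^sup>+\<omega>. ennreal \<bar>f \<omega>\<bar> \<partial>M)" for f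
    proof (cases "integrable M f")
      case True from integral_norm_bound_ennreal[OF this] show ?thesis by simp
    qed (simp add: not_integrable_integral_eq)
    have "ennreal (exp (a * s) * \<bar>prob {\<omega>\<in>space M. s < (\<Sum>i\<in>I. X i \<omega>)} - normal_tail s\<bar>)
      = ennreal (exp (a * s)) * ennreal \<bar>\<Sum>i\<in>I. V i * expectation (G i s) - expectation (\<lambda>\<omega>. X i \<omega> * T i s \<omega>)\<bar>"
    proof -
      have "prob {\<omega>\<in>space M. s < (\<Sum>i\<in>I. X i \<omega>)} - normal_tail s
        = (\<Sum>i\<in>I. V i * expectation (G i s) - expectation (\<lambda>\<omega>. X i \<omega> * T i s \<omega>))"
        unfolding V_def G_def T_def R_def by (rule stein_tail_diff_eq[OF I ind sq mean var])
      then show ?thesis by (simp add: ennreal_mult)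
    qed
    also have "\<dots> \<le> ennreal (exp (a * s)) * (\<Sum>i\<in>I. ennreal (V i) * ennreal \<bar>expectation (G i s)\<bar> + ennreal \<bar>expectation (\<lambda>\<omega>. X i \<omega> * T i s \<omega>)\<bar>)"
    proof (rule mult_left_mono)
      have "\<bar>\<Sum>i\<in>I. V i * expectation (G i s) - expectation (\<lambda>\<omega>. X i \<omega> * T i s \<omega>)\<bar>
        \<le> (\<Sum>i\<in>I. V i * \<bar>expectation (G i s)\<bar> + \<bar>expectation (\<lambda>\<omega>. X i \<omega> * T i s \<omega>)\<bar>)"
        by (rule order_trans[OF sum_abs sum_mono], rule order_trans[OF abs_triangle_ineq4])
           (simp add: abs_mult V_nonneg)
      from ennreal_leI[OF this] show "ennreal \<bar>\<Sum>i\<in>I. V i * expectation (G i s) - expectation (\<lambda>\<omega>. X i \<omega> * T i s \<omega>)\<bar>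
        \<le> (\<Sum>i\<in>I. ennreal (V i) * ennreal \<bar>expectation (G i s)\<bar> + ennreal \<bar>expectation (\<lambda>\<omega>. X i \<omega> * T i s \<omega>)\<bar>)"
        by (simp add: V_nonneg sum_ennreal[symmetric] ennreal_plus ennreal_mult)
    qed simp
    also have "\<dots> \<le> ennreal (exp (a * s)) * (\<Sum>i\<in>I. ennreal (V i) * (\<integral>\<^sup>+\<omega>. ennreal \<bar>G i s \<omega>\<bar> \<partial>M) + (\<integral>\<^sup>+\<omega>. ennreal \<bar>X i \<omega> * T i s \<omega>\<bar> \<partial>M))"
      by (intro mult_left_mono sum_mono add_mono norm_le) auto
    also have "\<dots> = (\<Sum>i\<in>I. ennreal (V i) * ?EG i s
        + ?ET i s)"
      unfolding sum_distrib_left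
    proof (intro sum.cong refl)
      fix i assume i: "i \<in> I"
      note [measurable] = X[OF i]
      have "?EG i s = ennreal (exp (a * s)) * (\<integral>\<^sup>+\<omega>. ennreal \<bar>G i s \<omega>\<bar> \<partial>M)"
        using i by (simp add: ennreal_mult nn_integral_cmult)
      moreover have "?ET i s
        = ennreal (exp (a * s)) * (\<integral>\<^sup>+\<omega>. ennreal \<bar>X i \<omega> * T i s \<omega>\<bar> \<partial>M)"
        using i by (subst nn_integral_cmult[symmetric]) (auto simp: ennreal_mult abs_mult)
      ultimately show "ennreal (exp (a * s)) * (ennreal (V i) * (\<integral>\<^sup>+\<omega>. ennreal \<bar>G i s \<omega>\<bar> \<partial>M) + (\<integral>\<^sup>+\<omega>. ennreal \<bar>X i \<omega> * T i s \<omega>\<bar> \<partial>M))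
        = ennreal (V i) * ?EG i s
          + ?ET i s"
        by (simp add: distrib_left mult.left_commute)
    qed
    finally show ?thesis .
  qed
  have mG: "(\<lambda>s. \<integral>\<^sup>+\<omega>. ennreal (exp (a * s) * \<bar>G i s \<omega>\<bar>) \<partial>M) \<in> borel_measurable lborel" if "i \<in> I" for i
    by (rule borel_measurable_nn_integral) (use that in measurable)
  have mT: "(\<lambda>s. \<integral>\<^sup>+\<omega>. ennreal (exp (a * s) * (\<bar>X i \<omega>\<bar> * \<bar>T i s \<omega>\<bar>)) \<partial>M) \<in> borel_measurable lborel" if "i \<in> I" for i
    by (rule borel_measurable_nn_integral) (use that X[OF that] in measurable)
  have "(\<integral>\<^sup>+s. ennreal (exp (a * s) * \<bar>prob {\<omega>\<in>space M. s < (\<Sum>i\<in>I. X i \<omega>)} - normal_tail s\<bar>) \<partial>lborel)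
    \<le> (\<integral>\<^sup>+s. (\<Sum>i\<in>I. ennreal (V i) * ?EG i s
        + ?ET i s) \<partial>lborel)"
    by (intro nn_integral_mono pointwise)
  also have "\<dots> = (\<Sum>i\<in>I. ennreal (V i) * (\<integral>\<^sup>+s. ?EG i s \<partial>lborel)
        + (\<integral>\<^sup>+s. ?ET i s \<partial>lborel))"
    using mG mT by (subst nn_integral_sum) (auto intro!: sum.cong simp: nn_integral_add nn_integral_cmult)
  also have "\<dots> \<le> (\<Sum>i\<in>I. ennreal (V i) * ennreal (4 * (1 + 2 * B) * b1) + ennreal (4 * (1 + 2 * B) * b3))"
    by (intro sum_mono add_mono mult_left_mono bG bT) auto
  also have "\<dots> = ennreal (\<Sum>i\<in>I. V i * (4 * (1 + 2 * B) * b1) + 4 * (1 + 2 * B) * b3)"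
    using nn by (subst sum_ennreal[symmetric]) (auto simp: V_nonneg ennreal_mult ennreal_plus intro!: add_nonneg_nonneg mult_nonneg_nonneg)
  also have "(\<Sum>i\<in>I. V i * (4 * (1 + 2 * B) * b1) + 4 * (1 + 2 * B) * b3) = 4 * (1 + 2 * B) * (b1 + card I * b3)"
    using var by (simp add: sum.distrib sum_distrib_right[symmetric] V_def) (simp add: algebra_simps)
  finally show ?thesis .
qed

end

section \<open>Stationary laws of the Lindley recursion\<close>

text \<open>One increment law \<open>A\<close> replaces the pair of service and interarrival laws,
  so that the queue and the Gaussian walk become instances of the same notion.\<close>

definition lindley_stationary :: "real measure \<Rightarrow> real measure \<Rightarrow> bool" where
  "lindley_stationary A L \<longleftrightarrow> real_distribution A \<and> real_distribution L \<and>
    L = distr (L \<Otimes>\<^sub>M A) borel (\<lambda>(w, x). max 0 (w + x))"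

text \<open>For \<theta> = 0 this is the Wasserstein distance of order 1. The value may be infinite,
  so finiteness has to be shown before the contraction inequality can be solved.\<close>

definition tail_dist :: "real \<Rightarrow> real measure \<Rightarrow> real measure \<Rightarrow> ennreal" where
  "tail_dist \<theta> A B = (\<integral>\<^sup>+t. ennreal (exp (\<theta> * t) * \<bar>measure A {t<..} - measure B {t<..}\<bar>) \<partial>lborel)"

lemma (in real_distribution) borel_measurable_tail [measurable]:
  "(\<lambda>t. measure M {t<..}) \<in> borel_measurable borel"
proof -
  have "mono (\<lambda>t. - measure M {t<..})"
    by (intro monoI) (auto intro!: finite_measure_mono)
  from borel_measurable_uminus[OF borel_measurable_mono[OF this]] show ?thesis by simp
qed

lemma lindley_stationaryD:
  assumes "lindley_stationary A L"
  shows "real_distribution A" "real_distribution L"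
  using assms by (auto simp: lindley_stationary_def)

lemma nn_integral_lborel_shift:
  fixes f :: "real \<Rightarrow> ennreal"
  assumes "f \<in> borel_measurable borel"
  shows "(\<integral>\<^sup>+t. f (t - w) \<partial>lborel) = (\<integral>\<^sup>+t. f t \<partial>lborel)"
  using nn_integral_real_affine[OF assms, of 1 "- w"] by simp

text \<open>Two stationary laws have the same tail at negative levels, so only nonnegative levels
  enter their \<open>tail_dist\<close>.\<close>

lemma lindley_stationary_measure_neg:
  assumes L: "lindley_stationary A L" and t: "t < 0"
  shows "measure L {t<..} = 1"
proof -
  interpret A: real_distribution A by (rule lindley_stationaryD[OF L])
  interpret L: real_distribution L by (rule lindley_stationaryD[OF L])
  have eq: "L = distr (L \<Otimes>\<^sub>M A) borel (\<lambda>(w, x). max 0 (w + x))"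
    using L by (simp add: lindley_stationary_def)
  have "AE w in distr (L \<Otimes>\<^sub>M A) borel (\<lambda>(w, x). max 0 (w + x)). t < w"
    using t by (subst AE_distr_iff) auto
  then have "AE w in L. w \<in> {t<..}" unfolding eq[symmetric] by simp
  then show ?thesis by (subst L.prob_eq_1) auto
qed

lemma lindley_stationary_AE_nonneg:
  assumes "lindley_stationary A L"
  shows "AE w in L. 0 \<le> w"
proof -
  interpret real_distribution L by (rule lindley_stationaryD[OF assms])
  have "AE w in L. - 1 / real (Suc n) < w" for n
  proof -
    have "prob {- 1 / real (Suc n)<..} = 1"
      by (rule lindley_stationary_measure_neg[OF assms]) simp
    then show ?thesis by (subst (asm) prob_eq_1) auto
  qed
  then have "AE w in L. \<forall>n. - 1 / real (Suc n) < w" by (simp add: AE_all_countable)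
  then show ?thesis
  proof eventually_elim
    case (elim w)
    show ?case
    proof (rule ccontr)
      assume "\<not> 0 \<le> w"
      then obtain n where "inverse (real (Suc n)) < - w" using reals_Archimedean[of "- w"] by auto
      with elim[rule_format, of n] show False by (simp add: inverse_eq_divide)
    qed
  qed
qed

lemma nn_integral_lindley:
  assumes L: "lindley_stationary A L"
    and [measurable]: "f \<in> borel_measurable borel"
  shows "(\<integral>\<^sup>+w. f w \<partial>L) = (\<integral>\<^sup>+w. (\<integral>\<^sup>+x. f (max 0 (w + x)) \<partial>A) \<partial>L)"
proof -
  interpret A: real_distribution A by (rule lindley_stationaryD[OF L])
  interpret L: real_distribution L by (rule lindley_stationaryD[OF L])
  have eq: "L = distr (L \<Otimes>\<^sub>M A) borel (\<lambda>(w, x). max 0 (w + x))"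
    using L by (auto simp: lindley_stationary_def)
  have "(\<integral>\<^sup>+w. f w \<partial>L) = (\<integral>\<^sup>+w. f w \<partial>distr (L \<Otimes>\<^sub>M A) borel (\<lambda>(w, x). max 0 (w + x)))"
    using eq by simp
  also have "\<dots> = (\<integral>\<^sup>+z. f (max 0 (fst z + snd z)) \<partial>(L \<Otimes>\<^sub>M A))"
    by (subst nn_integral_distr) (auto simp: case_prod_beta)
  also have "\<dots> = (\<integral>\<^sup>+w. (\<integral>\<^sup>+x. f (max 0 (w + x)) \<partial>A) \<partial>L)"
    by (subst A.nn_integral_fst[symmetric]) auto
  finally show ?thesis .
qed

text \<open>The truncation at 0 does not affect the event of exceeding a nonnegative level, so the
  tail is that of the plain convolution of \<open>L\<close> and \<open>A\<close>.\<close>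

lemma lindley_stationary_tail:
  assumes L: "lindley_stationary A L" and t: "0 \<le> t"
  shows "measure L {t<..} = (LINT w|L. measure A {t - w<..})"
proof -
  interpret A: real_distribution A by (rule lindley_stationaryD[OF L])
  interpret L: real_distribution L by (rule lindley_stationaryD[OF L])
  have "ennreal (measure L {t<..}) = (\<integral>\<^sup>+w. indicator {t<..} w \<partial>L)"
    by (simp add: L.emeasure_eq_measure)
  also have "\<dots> = (\<integral>\<^sup>+w. (\<integral>\<^sup>+x. indicator {t - w<..} x \<partial>A) \<partial>L)"
  proof -
    have "indicator {t<..} (max 0 (w + x)) = (indicator {t - w<..} x :: ennreal)" for w x
      using t by (auto simp: indicator_def max_def)
    then show ?thesis by (subst nn_integral_lindley[OF L]) auto
  qed
  also have "\<dots> = (\<integral>\<^sup>+w. ennreal (measure A {t - w<..}) \<partial>L)"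
    by (simp add: A.emeasure_eq_measure)
  also have "\<dots> = ennreal (LINT w|L. measure A {t - w<..})"
    by (intro nn_integral_eq_integral L.integrable_const_bound[where B = 1]) auto
  finally show ?thesis
    by (simp add: ennreal_inj integral_nonneg_AE)
qed

text \<open>Both sides are the probability that the sum of independent variables with laws
  \<open>L\<close> and \<open>B\<close> exceeds t. The exchange allows the difference of two
  stationary laws to be integrated against the increment law.\<close>

lemma integral_tail_swap:
  assumes "real_distribution L" "real_distribution B"
  shows "(LINT w|L. measure B {t - w<..}) = (LINT x|B. measure L {t - x<..})"
proof -
  interpret B: real_distribution B by fact
  interpret L: real_distribution L by fact
  interpret pair_sigma_finite L B by standard
  have "ennreal (LINT w|L. measure B {t - w<..}) = (\<integral>\<^sup>+w. ennreal (measure B {t - w<..}) \<partial>L)"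
    by (intro nn_integral_eq_integral[symmetric] L.integrable_const_bound[where B = 1]) auto
  also have "\<dots> = (\<integral>\<^sup>+w. (\<integral>\<^sup>+x. indicator {t<..} (w + x) \<partial>B) \<partial>L)"
    by (auto intro!: nn_integral_cong simp: B.emeasure_eq_measure[symmetric] nn_integral_indicator[symmetric]
         indicator_def simp del: nn_integral_indicator)
  also have "\<dots> = (\<integral>\<^sup>+x. (\<integral>\<^sup>+w. indicator {t<..} (w + x) \<partial>L) \<partial>B)"
    by (rule Fubini'[symmetric]) measurable
  also have "\<dots> = (\<integral>\<^sup>+x. ennreal (measure L {t - x<..}) \<partial>B)"
    by (auto intro!: nn_integral_cong simp: L.emeasure_eq_measure[symmetric] nn_integral_indicator[symmetric]
         indicator_def simp del: nn_integral_indicator)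
  also have "\<dots> = ennreal (LINT x|B. measure L {t - x<..})"
    by (intro nn_integral_eq_integral B.integrable_const_bound[where B = 1]) auto
  finally show ?thesis
    by (simp add: ennreal_inj integral_nonneg_AE)
qed

text \<open>The weight is multiplicative, exp (\<theta> t) = exp (\<theta> w) exp (\<theta> (t -
  w)), and Lebesgue measure is invariant under the shift by w. Hence the weighted norm of a
  convolution factorises.\<close>

lemma nn_integral_weighted_convolution:
  fixes f :: "real \<Rightarrow> real"
  assumes "real_distribution L" and [measurable]: "f \<in> borel_measurable borel"
  shows "(\<integral>\<^sup>+t. ennreal (exp (\<theta> * t)) * (\<integral>\<^sup>+w. ennreal (f (t - w)) \<partial>L) \<partial>lborel)
    = (\<integral>\<^sup>+w. ennreal (exp (\<theta> * w)) \<partial>L) * (\<integral>\<^sup>+t. ennreal (exp (\<theta> * t) * f t) \<partial>lborel)"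
proof -
  interpret L: real_distribution L by fact
  interpret pair_sigma_finite L lborel by standard
  have "(\<integral>\<^sup>+t. ennreal (exp (\<theta> * t)) * (\<integral>\<^sup>+w. ennreal (f (t - w)) \<partial>L) \<partial>lborel)
    = (\<integral>\<^sup>+t. (\<integral>\<^sup>+w. ennreal (exp (\<theta> * t)) * ennreal (f (t - w)) \<partial>L) \<partial>lborel)"
    by (simp add: nn_integral_cmult)
  also have "\<dots> = (\<integral>\<^sup>+w. (\<integral>\<^sup>+t. ennreal (exp (\<theta> * t)) * ennreal (f (t - w)) \<partial>lborel) \<partial>L)"
    by (rule Fubini') measurable
  also have "\<dots> = (\<integral>\<^sup>+w. ennreal (exp (\<theta> * w)) * (\<integral>\<^sup>+t. ennreal (exp (\<theta> * t) * f t) \<partial>lborel) \<partial>L)"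
  proof (intro nn_integral_cong)
    fix w
    have "(\<integral>\<^sup>+t. ennreal (exp (\<theta> * t)) * ennreal (f (t - w)) \<partial>lborel)
      = (\<integral>\<^sup>+t. ennreal (exp (\<theta> * w)) * ennreal (exp (\<theta> * (t - w)) * f (t - w)) \<partial>lborel)"
      by (intro nn_integral_cong) (simp add: ennreal_mult'[symmetric] mult.assoc[symmetric] mult_exp_exp algebra_simps)
    also have "\<dots> = ennreal (exp (\<theta> * w)) * (\<integral>\<^sup>+t. ennreal (exp (\<theta> * t) * f t) \<partial>lborel)"
      using nn_integral_lborel_shift[of "\<lambda>t. ennreal (exp (\<theta> * t) * f t)" w]
      by (subst nn_integral_cmult) auto
    finally show "(\<integral>\<^sup>+t. ennreal (exp (\<theta> * t)) * ennreal (f (t - w)) \<partial>lborel) = \<dots>" .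
  qed
  also have "\<dots> = (\<integral>\<^sup>+w. ennreal (exp (\<theta> * w)) \<partial>L) * (\<integral>\<^sup>+t. ennreal (exp (\<theta> * t) * f t) \<partial>lborel)"
    by (subst nn_integral_multc) auto
  finally show ?thesis .
qed

text \<open>Splitting one Lindley step of both chains: the increments are exchanged under the first stationary
  law, and the two stationary laws under the second increment. The latter is a convolution with an
  increment whose exponential moment is less than 1.\<close>

lemma tail_dist_stationary_le:
  assumes L: "lindley_stationary A L"
    and K: "lindley_stationary B K"
  shows "tail_dist \<theta> L K \<le> (\<integral>\<^sup>+w. ennreal (exp (\<theta> * w)) \<partial>L) * tail_dist \<theta> A B
      + (\<integral>\<^sup>+x. ennreal (exp (\<theta> * x)) \<partial>B) * tail_dist \<theta> L K"
proof -
  interpret A: real_distribution A by (rule lindley_stationaryD[OF L])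
  interpret B: real_distribution B by (rule lindley_stationaryD[OF K])
  interpret L: real_distribution L by (rule lindley_stationaryD[OF L])
  interpret K: real_distribution K by (rule lindley_stationaryD[OF K])
  define f where "f = (\<lambda>t. \<bar>measure A {t<..} - measure B {t<..}\<bar>)"
  define g where "g = (\<lambda>t. \<bar>measure L {t<..} - measure K {t<..}\<bar>)"
  have [measurable]: "f \<in> borel_measurable borel" "g \<in> borel_measurable borel"
    unfolding f_def g_def by measurable
  have pw: "ennreal (g t) \<le> (\<integral>\<^sup>+w. ennreal (f (t - w)) \<partial>L) + (\<integral>\<^sup>+x. ennreal (g (t - x)) \<partial>B)" for t
  proof (cases "0 \<le> t")
    case False
    then have "g t = 0"
      by (simp add: g_def lindley_stationary_measure_neg[OF L] lindley_stationary_measure_neg[OF K])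
    then show ?thesis by simp
  next
    case True
    have iA: "integrable L (\<lambda>w. measure A {t - w<..})" and iB: "integrable L (\<lambda>w. measure B {t - w<..})"
      by (auto intro!: L.integrable_const_bound[where B = 1])
    have iL: "integrable B (\<lambda>x. measure L {t - x<..})" and iK: "integrable B (\<lambda>x. measure K {t - x<..})"
      by (auto intro!: B.integrable_const_bound[where B = 1])
    \<comment> \<open>The intermediate term is the tail of the sum of a variable with law
      \<open>L\<close> and an increment with law \<open>B\<close>.\<close>
    have "measure L {t<..} - measure K {t<..}
      = ((LINT w|L. measure A {t - w<..}) - (LINT w|L. measure B {t - w<..}))
        + ((LINT w|L. measure B {t - w<..}) - (LINT w|K. measure B {t - w<..}))"
      by (simp add: lindley_stationary_tail[OF L True] lindley_stationary_tail[OF K True])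
    also have "\<dots> = (LINT w|L. measure A {t - w<..} - measure B {t - w<..})
        + (LINT x|B. measure L {t - x<..} - measure K {t - x<..})"
      using iA iB iL iK
      by (simp add: integral_tail_swap[OF L.real_distribution_axioms B.real_distribution_axioms] integral_tail_swap[OF K.real_distribution_axioms B.real_distribution_axioms])
    finally have "g t = \<bar>\<dots>\<bar>" by (simp add: g_def)
    then have "ennreal (g t) \<le> ennreal (norm (LINT w|L. measure A {t - w<..} - measure B {t - w<..}))
        + ennreal (norm (LINT x|B. measure L {t - x<..} - measure K {t - x<..}))"
      by (simp add: ennreal_plus[symmetric] abs_triangle_ineq del: ennreal_plus)
    also have "\<dots> \<le> (\<integral>\<^sup>+w. ennreal (norm (measure A {t - w<..} - measure B {t - w<..})) \<partial>L)
        + (\<integral>\<^sup>+x. ennreal (norm (measure L {t - x<..} - measure K {t - x<..})) \<partial>B)"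
      by (intro add_mono integral_norm_bound_ennreal Bochner_Integration.integrable_diff iA iB iL iK)
    finally show ?thesis by (simp add: f_def g_def)
  qed
  have "tail_dist \<theta> L K = (\<integral>\<^sup>+t. ennreal (exp (\<theta> * t)) * ennreal (g t) \<partial>lborel)"
    by (simp add: tail_dist_def g_def ennreal_mult)
  also have "\<dots> \<le> (\<integral>\<^sup>+t. ennreal (exp (\<theta> * t)) * (\<integral>\<^sup>+w. ennreal (f (t - w)) \<partial>L)
      + ennreal (exp (\<theta> * t)) * (\<integral>\<^sup>+x. ennreal (g (t - x)) \<partial>B) \<partial>lborel)"
    unfolding distrib_left[symmetric] by (intro nn_integral_mono mult_left_mono pw) auto
  also have "\<dots> = (\<integral>\<^sup>+t. ennreal (exp (\<theta> * t)) * (\<integral>\<^sup>+w. ennreal (f (t - w)) \<partial>L) \<partial>lborel)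
      + (\<integral>\<^sup>+t. ennreal (exp (\<theta> * t)) * (\<integral>\<^sup>+x. ennreal (g (t - x)) \<partial>B) \<partial>lborel)"
    by (intro nn_integral_add borel_measurable_times_ennreal L.borel_measurable_nn_integral B.borel_measurable_nn_integral) measurable
  also have "\<dots> = (\<integral>\<^sup>+w. ennreal (exp (\<theta> * w)) \<partial>L) * tail_dist \<theta> A B
      + (\<integral>\<^sup>+x. ennreal (exp (\<theta> * x)) \<partial>B) * tail_dist \<theta> L K"
    by (simp add: nn_integral_weighted_convolution L.real_distribution_axioms B.real_distribution_axioms)
       (simp add: tail_dist_def f_def g_def)
  finally show ?thesis .
qed

text \<open>The layer-cake formula: write the tail as the integral of an indicator under
  \<open>L\<close>, exchange the integrations, and integrate \<open>f\<close> from 0 to w.\<close>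

lemma nn_integral_tail_weight:
  assumes L: "real_distribution L" "AE w in L. 0 \<le> w"
    and F: "\<And>t. (F has_real_derivative f t) (at t)" and f: "\<And>t. 0 \<le> t \<Longrightarrow> 0 \<le> f t"
    and [measurable]: "f \<in> borel_measurable borel"
  shows "(\<integral>\<^sup>+t. ennreal (f t * measure L {t<..}) * indicator {0..} t \<partial>lborel) = (\<integral>\<^sup>+w. ennreal (F w - F 0) \<partial>L)"
proof -
  interpret L: real_distribution L by fact
  interpret pair_sigma_finite L lborel by standard
  have F_m[measurable]: "F \<in> borel_measurable borel"
    by (intro borel_measurable_continuous_onI continuous_at_imp_continuous_on ballI DERIV_isCont[OF F])
  have "(\<integral>\<^sup>+t. ennreal (f t * measure L {t<..}) * indicator {0..} t \<partial>lborel)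
    = (\<integral>\<^sup>+t. (\<integral>\<^sup>+w. ennreal (f t) * indicator {0..} t * indicator {t<..} w \<partial>L) \<partial>lborel)"
    by (intro nn_integral_cong)
       (auto simp: nn_integral_cmult L.emeasure_eq_measure ennreal_mult f split: split_indicator)
  also have "\<dots> = (\<integral>\<^sup>+w. (\<integral>\<^sup>+t. ennreal (f t) * indicator {0..} t * indicator {t<..} w \<partial>lborel) \<partial>L)"
    by (rule Fubini') (simp add: indicator_def)
  also have "\<dots> = (\<integral>\<^sup>+w. ennreal (F w - F 0) \<partial>L)"
  proof (rule nn_integral_cong_AE, rule AE_mp[OF L(2)], rule AE_I2, rule impI)
    fix w :: real assume elim: "0 \<le> w"
    have "(\<integral>\<^sup>+t. ennreal (f t) * indicator {0..} t * indicator {t<..} w \<partial>lborel)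
      = (\<integral>\<^sup>+t. ennreal (f t) * indicator {0..w} t \<partial>lborel)"
      by (rule nn_integral_cong_AE, rule AE_mp[OF AE_lborel_singleton[of w]]) (auto split: split_indicator)
    also have "\<dots> = ennreal (F w - F 0)"
      by (rule nn_integral_FTC_Icc) (use elim F f in auto)
    finally show "(\<integral>\<^sup>+t. ennreal (f t) * indicator {0..} t * indicator {t<..} w \<partial>lborel) = ennreal (F w - F 0)" .
  qed
  finally show ?thesis .
qed

text \<open>The inequality D \<le> E + \<gamma> D says nothing if D is infinite. This lemma supplies
  the finiteness that \<open>ennreal_contraction_bound\<close> requires.\<close>

lemma tail_dist_finite:
  assumes L: "lindley_stationary A L" and K: "lindley_stationary B K" and "0 < \<theta>"
    and fin: "(\<integral>\<^sup>+w. ennreal (exp (\<theta> * w)) \<partial>L) < \<infinity>" "(\<integral>\<^sup>+w. ennreal (exp (\<theta> * w)) \<partial>K) < \<infinity>"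
  shows "tail_dist \<theta> L K < \<infinity>"
proof -
  interpret L: real_distribution L by (rule lindley_stationaryD[OF L])
  interpret K: real_distribution K by (rule lindley_stationaryD[OF K])
  have tail: "(\<integral>\<^sup>+t. ennreal (exp (\<theta> * t) * measure N {t<..}) * indicator {0..} t \<partial>lborel) < \<infinity>"
    if N: "real_distribution N" "AE w in N. 0 \<le> w" and f: "(\<integral>\<^sup>+w. ennreal (exp (\<theta> * w)) \<partial>N) < \<infinity>" for N
  proof -
    interpret N: real_distribution N by fact
    have d: "((\<lambda>t. exp (\<theta> * t) / \<theta>) has_real_derivative exp (\<theta> * t)) (at t)" for t
      using \<open>0 < \<theta>\<close> by (auto intro!: derivative_eq_intros)
    have "(\<integral>\<^sup>+t. ennreal (exp (\<theta> * t) * measure N {t<..}) * indicator {0..} t \<partial>lborel)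
      = (\<integral>\<^sup>+w. ennreal (exp (\<theta> * w) / \<theta> - exp (\<theta> * 0) / \<theta>) \<partial>N)"
      by (rule nn_integral_tail_weight[OF N d]) auto
    also have "\<dots> \<le> (\<integral>\<^sup>+w. ennreal (1 / \<theta>) * ennreal (exp (\<theta> * w)) \<partial>N)"
      using \<open>0 < \<theta>\<close> by (intro nn_integral_mono) (auto simp: ennreal_mult'[symmetric] intro!: ennreal_leI)
    also have "\<dots> < \<infinity>" using f by (simp add: nn_integral_cmult ennreal_mult_less_top)
    finally show ?thesis .
  qed
  have "tail_dist \<theta> L K \<le> (\<integral>\<^sup>+t. ennreal (exp (\<theta> * t) * measure L {t<..}) * indicator {0..} t
      + ennreal (exp (\<theta> * t) * measure K {t<..}) * indicator {0..} t \<partial>lborel)"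
    unfolding tail_dist_def
  proof (rule nn_integral_mono)
    fix t :: real
    have "\<bar>L.prob {t<..} - K.prob {t<..}\<bar> \<le> L.prob {t<..} + K.prob {t<..}"
      using measure_nonneg[of L "{t<..}"] measure_nonneg[of K "{t<..}"] by linarith
    then show "ennreal (exp (\<theta> * t) * \<bar>L.prob {t<..} - K.prob {t<..}\<bar>)
      \<le> ennreal (exp (\<theta> * t) * L.prob {t<..}) * indicator {0..} t + ennreal (exp (\<theta> * t) * K.prob {t<..}) * indicator {0..} t"
      by (cases "0 \<le> t")
         (auto simp: ennreal_plus[symmetric] lindley_stationary_measure_neg[OF L] lindley_stationary_measure_neg[OF K]
            distrib_left[symmetric] simp del: ennreal_plus intro!: ennreal_leI)
  qed
  also have "\<dots> = (\<integral>\<^sup>+t. ennreal (exp (\<theta> * t) * measure L {t<..}) * indicator {0..} t \<partial>lborel)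
      + (\<integral>\<^sup>+t. ennreal (exp (\<theta> * t) * measure K {t<..}) * indicator {0..} t \<partial>lborel)"
    by (rule nn_integral_add) auto
  also have "\<dots> < \<infinity>"
    using tail[OF L.real_distribution_axioms lindley_stationary_AE_nonneg[OF L] fin(1)]
      tail[OF K.real_distribution_axioms lindley_stationary_AE_nonneg[OF K] fin(2)] by simp
  finally show ?thesis .
qed

lemma ennreal_contraction_bound:
  fixes D E :: ennreal
  assumes "D \<le> E + ennreal \<gamma> * D" "D < \<infinity>" "E \<le> ennreal e" "0 \<le> e" "0 \<le> \<gamma>" "\<gamma> < 1"
  shows "D \<le> ennreal (e / (1 - \<gamma>))"
proof -
  obtain d where d: "D = ennreal d" "0 \<le> d" using assms(2) by (cases D) auto
  have "ennreal d \<le> ennreal e + ennreal \<gamma> * ennreal d"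
    using assms(1,3) d by (metis add_right_mono order_trans)
  also have "\<dots> = ennreal (e + \<gamma> * d)"
    using assms d by (simp add: ennreal_plus ennreal_mult)
  finally have "d \<le> e + \<gamma> * d"
    using assms d by (subst (asm) ennreal_le_iff) auto
  then have "d \<le> e / (1 - \<gamma>)" using assms by (simp add: field_simps)
  then show ?thesis using d by (simp add: ennreal_leI)
qed

text \<open>Stationarity yields E exp (\<theta> W) \<le> 1 + \<gamma> E exp (\<theta> W), which is
  worthless as long as the moment may be infinite. The inequality is therefore iterated for
  truncated quantities: n steps cost 1 + \<gamma> + ... + \<gamma>^(n - 1), the remaining term
  carries \<gamma>^n inside the truncation and vanishes as n grows, and the truncation is lifted
  last.\<close>

lemma stationary_exp_moment_le:
  assumes L: "lindley_stationary A L" and \<theta>: "0 \<le> \<theta>"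
    and g: "(\<integral>\<^sup>+x. ennreal (exp (\<theta> * x)) \<partial>A) \<le> ennreal \<gamma>" "0 \<le> \<gamma>" "\<gamma> < 1"
  shows "(\<integral>\<^sup>+w. ennreal (exp (\<theta> * w)) \<partial>L) \<le> ennreal (1 / (1 - \<gamma>))"
proof -
  interpret A: real_distribution A by (rule lindley_stationaryD[OF L])
  interpret L: real_distribution L by (rule lindley_stationaryD[OF L])
  let ?m = "\<lambda>w n K. min (ennreal (\<gamma> ^ n * exp (\<theta> * w))) (ennreal K)"
  let ?m2 = "\<lambda>n w x K. min (ennreal (\<gamma> ^ n * exp (\<theta> * w)) * ennreal (exp (\<theta> * x))) (ennreal K)"
  \<comment> \<open>The power of \<gamma> stands inside the minimum, so the truncation level
    \<open>K\<close> is the same at every step and dominates the passage to the limit in n.\<close>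
  define a where "a = (\<lambda>K n. \<integral>\<^sup>+w. ?m w n K \<partial>L)"
  have step: "a K n \<le> ennreal (\<gamma> ^ n) + a K (Suc n)" for K n
  proof -
    have "a K n = (\<integral>\<^sup>+w. (\<integral>\<^sup>+x. ?m (max 0 (w + x)) n K \<partial>A) \<partial>L)"
      unfolding a_def by (rule nn_integral_lindley[OF L]) measurable
    also have "\<dots> \<le> (\<integral>\<^sup>+w. ennreal (\<gamma> ^ n) + ?m w (Suc n) K \<partial>L)"
    proof (rule nn_integral_mono)
      fix w
      have "(\<integral>\<^sup>+x. ?m (max 0 (w + x)) n K \<partial>A)
        \<le> (\<integral>\<^sup>+x. ennreal (\<gamma> ^ n) + ?m2 n w x K \<partial>A)"
      proof (rule nn_integral_mono)
        fix x
        show "?m (max 0 (w + x)) n K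
          \<le> ennreal (\<gamma> ^ n) + ?m2 n w x K"
        proof (cases "0 \<le> w + x")
          case True
          then have "\<gamma> ^ n * exp (\<theta> * max 0 (w + x)) = \<gamma> ^ n * exp (\<theta> * w) * exp (\<theta> * x)"
            by (simp add: max_def mult_exp_exp distrib_left mult.assoc)
          then have "ennreal (\<gamma> ^ n * exp (\<theta> * max 0 (w + x))) = ennreal (\<gamma> ^ n * exp (\<theta> * w)) * ennreal (exp (\<theta> * x))"
            by (simp only: ennreal_mult'' exp_ge_zero)
          then show ?thesis by (simp only:) (rule add_increasing, simp_all)
        next
          case False
          then have "?m (max 0 (w + x)) n K \<le> ennreal (\<gamma> ^ n)"
            by (simp add: max_def min.coboundedI1)
          then show ?thesis by (simp add: add_increasing2)
        qed
      qed
      also have "\<dots> = ennreal (\<gamma> ^ n) + (\<integral>\<^sup>+x. ?m2 n w x K \<partial>A)"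
        by (subst nn_integral_add) (auto simp: A.emeasure_space_1[simplified])
      \<comment> \<open>Jensen's inequality for the minimum with a constant, in elementary form: the
        integral of a minimum is at most each of the two integrals. The exponential moment of the
        increment turns \<gamma>^n into the next power.\<close>
      also have "\<dots> \<le> ennreal (\<gamma> ^ n) + ?m w (Suc n) K"
      proof (rule add_left_mono, rule min.boundedI)
        have "(\<integral>\<^sup>+x. ?m2 n w x K \<partial>A)
          \<le> (\<integral>\<^sup>+x. ennreal (\<gamma> ^ n * exp (\<theta> * w)) * ennreal (exp (\<theta> * x)) \<partial>A)"
          by (intro nn_integral_mono) simp
        also have "\<dots> = ennreal (\<gamma> ^ n * exp (\<theta> * w)) * (\<integral>\<^sup>+x. ennreal (exp (\<theta> * x)) \<partial>A)"
          by (rule nn_integral_cmult) measurable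
        also have "\<dots> \<le> ennreal (\<gamma> ^ n * exp (\<theta> * w)) * ennreal \<gamma>"
          by (intro mult_left_mono g) simp
        also have "\<dots> = ennreal (\<gamma> ^ Suc n * exp (\<theta> * w))"
          using g(2) by (simp add: ennreal_mult'[symmetric] ennreal_mult''[symmetric] mult_ac)
        finally show "(\<integral>\<^sup>+x. ?m2 n w x K \<partial>A) \<le> \<dots>" .
        have "(\<integral>\<^sup>+x. ?m2 n w x K \<partial>A) \<le> (\<integral>\<^sup>+x. ennreal K \<partial>A)"
          by (intro nn_integral_mono) simp
        then show "(\<integral>\<^sup>+x. ?m2 n w x K \<partial>A) \<le> ennreal K"
          by (simp add: A.emeasure_space_1[simplified])
      qed
      finally show "(\<integral>\<^sup>+x. ?m (max 0 (w + x)) n K \<partial>A)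
        \<le> ennreal (\<gamma> ^ n) + ?m w (Suc n) K" .
    qed
    also have "\<dots> = ennreal (\<gamma> ^ n) + a K (Suc n)"
      unfolding a_def by (subst nn_integral_add) (auto simp: L.emeasure_space_1[simplified])
    finally show ?thesis .
  qed
  have iter: "a K 0 \<le> ennreal (1 / (1 - \<gamma>)) + a K n" for K n
  proof -
    have "a K 0 \<le> ennreal (\<Sum>i<n. \<gamma> ^ i) + a K n"
    proof (induction n)
      case (Suc n)
      have "a K 0 \<le> ennreal (\<Sum>i<n. \<gamma> ^ i) + (ennreal (\<gamma> ^ n) + a K (Suc n))"
        using Suc step[of K n] by (metis add_left_mono order_trans)
      then show ?case using g(2) by (simp add: add.assoc[symmetric] ennreal_plus[symmetric] sum_nonneg del: ennreal_plus)
    qed simp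
    also have "(\<Sum>i<n. \<gamma> ^ i) \<le> 1 / (1 - \<gamma>)"
      using g by (simp add: sum_gp_strict divide_right_mono)
    finally show ?thesis using add_right_mono ennreal_leI by (metis order_trans)
  qed
  have lim: "(\<lambda>n. a K n) \<longlonglongrightarrow> 0" for K
  proof -
    have "(\<lambda>n. a K n) \<longlonglongrightarrow> (\<integral>\<^sup>+w. 0 \<partial>L)"
      unfolding a_def
    proof (rule nn_integral_dominated_convergence[where w = "\<lambda>_. ennreal K"])
      show "AE w in L. (\<lambda>n. min (ennreal (\<gamma> ^ n * exp (\<theta> * w))) (ennreal K)) \<longlonglongrightarrow> 0"
      proof (rule AE_I2)
        fix w
        have "(\<lambda>n. \<gamma> ^ n * exp (\<theta> * w)) \<longlonglongrightarrow> 0"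
          using g by (intro tendsto_mult_left_zero LIMSEQ_power_zero) simp
        then have "(\<lambda>n. ennreal (\<gamma> ^ n * exp (\<theta> * w))) \<longlonglongrightarrow> 0"
          by (metis ennreal_0 tendsto_ennrealI)
        then show "(\<lambda>n. min (ennreal (\<gamma> ^ n * exp (\<theta> * w))) (ennreal K)) \<longlonglongrightarrow> 0"
          by (rule tendsto_sandwich[OF _ _ tendsto_const, rotated 2]) auto
      qed
    qed (auto simp: ennreal_mult_less_top L.emeasure_space_1[simplified])
    then show ?thesis by simp
  qed
  have bound: "a K 0 \<le> ennreal (1 / (1 - \<gamma>))" for K
  proof (rule tendsto_lowerbound)
    show "(\<lambda>n. ennreal (1 / (1 - \<gamma>)) + a K n) \<longlonglongrightarrow> ennreal (1 / (1 - \<gamma>))"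
      using tendsto_add[OF tendsto_const lim] by simp
    show "\<forall>\<^sub>F n in sequentially. a K 0 \<le> ennreal (1 / (1 - \<gamma>)) + a K n"
      by (intro always_eventually allI iter)
  qed simp
  \<comment> \<open>The bound on \<open>a K 0\<close> does not depend on \<open>K\<close>, so
    monotone convergence along integer levels removes the truncation.\<close>
  have "(\<integral>\<^sup>+w. ennreal (exp (\<theta> * w)) \<partial>L) = (\<integral>\<^sup>+w. (SUP k. min (ennreal (exp (\<theta> * w))) (ennreal (real k))) \<partial>L)"
  proof (intro nn_integral_cong antisym)
    fix w
    obtain k where "exp (\<theta> * w) \<le> real k" using real_arch_simple by blast
    then have "ennreal (exp (\<theta> * w)) \<le> min (ennreal (exp (\<theta> * w))) (ennreal (real k))" by (simp add: ennreal_leI)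
    then show "ennreal (exp (\<theta> * w)) \<le> (SUP k. min (ennreal (exp (\<theta> * w))) (ennreal (real k)))"
      by (rule SUP_upper2[rotated]) simp
    show "(SUP k. min (ennreal (exp (\<theta> * w))) (ennreal (real k))) \<le> ennreal (exp (\<theta> * w))"
      by (rule SUP_least) simp
  qed
  also have "\<dots> = (SUP k. \<integral>\<^sup>+w. min (ennreal (exp (\<theta> * w))) (ennreal (real k)) \<partial>L)"
    by (rule nn_integral_monotone_convergence_SUP)
       (auto simp: incseq_def le_fun_def intro!: min.coboundedI2 ennreal_leI)
  also have "\<dots> = (SUP k. a (real k) 0)" by (simp add: a_def)
  also have "\<dots> \<le> ennreal (1 / (1 - \<gamma>))" by (rule SUP_least) (rule bound)
  finally show ?thesis .
qed

section \<open>From the tail distance to moments\<close>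

lemma power_le_fact_exp:
  fixes t :: real
  assumes "0 \<le> t" "0 < \<theta>" shows "t ^ k \<le> fact k / \<theta> ^ k * exp (\<theta> * t)"
proof -
  have "(\<theta> * t) ^ k / fact k \<le> exp (\<theta> * t)"
  proof -
    have "(\<theta> * t) ^ k /\<^sub>R fact k \<le> (\<Sum>n. (\<theta> * t) ^ n /\<^sub>R fact n)"
      using summable_exp_generic[of "\<theta> * t"] assms
      by (intro order_trans[OF _ sum_le_suminf[of _ "{k}"]]) auto
    then show ?thesis by (simp add: exp_def divide_inverse mult.commute)
  qed
  then show ?thesis using assms by (simp add: power_mult_distrib field_simps)
qed

lemma moment_tail_formula:
  assumes L: "lindley_stationary A L" and \<theta>: "0 < \<theta>"
    and fin: "(\<integral>\<^sup>+w. ennreal (exp (\<theta> * w)) \<partial>L) < \<infinity>"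
  shows "integrable L (\<lambda>w. w ^ Suc k)"
    and "has_bochner_integral lborel (\<lambda>t. real (Suc k) * t ^ k * measure L {t<..} * indicator {0..} t) (LINT w|L. w ^ Suc k)"
proof -
  interpret L: real_distribution L by (rule lindley_stationaryD[OF L])
  have nonneg: "AE w in L. 0 \<le> w" by (rule lindley_stationary_AE_nonneg[OF L])
  have "(\<integral>\<^sup>+w. ennreal (w ^ Suc k) \<partial>L) \<le> (\<integral>\<^sup>+w. ennreal (fact (Suc k) / \<theta> ^ Suc k) * ennreal (exp (\<theta> * w)) \<partial>L)"
  proof (rule nn_integral_mono_AE, rule AE_mp[OF nonneg], rule AE_I2, rule impI)
    fix w :: real assume elim: "0 \<le> w"
    from ennreal_leI[OF power_le_fact_exp[OF elim \<theta>, of "Suc k"]]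
    show "ennreal (w ^ Suc k) \<le> ennreal (fact (Suc k) / \<theta> ^ Suc k) * ennreal (exp (\<theta> * w))"
      using \<theta> by (subst ennreal_mult[symmetric]) auto
  qed
  also have "\<dots> < \<infinity>" using fin by (simp add: nn_integral_cmult ennreal_mult_less_top)
  finally have f: "(\<integral>\<^sup>+w. ennreal (w ^ Suc k) \<partial>L) < \<infinity>" .
  have nn: "AE w in L. 0 \<le> w ^ Suc k" using nonneg by eventually_elim simp
  show i: "integrable L (\<lambda>w. w ^ Suc k)"
    using f nn by (intro integrableI_nonneg) auto
  have "(\<integral>\<^sup>+t. ennreal (real (Suc k) * t ^ k * measure L {t<..} * indicator {0..} t) \<partial>lborel)
    = (\<integral>\<^sup>+t. ennreal (real (Suc k) * t ^ k * measure L {t<..}) * indicator {0..} t \<partial>lborel)"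
    by (intro nn_integral_cong) (auto split: split_indicator)
  also have "\<dots> = (\<integral>\<^sup>+w. ennreal (w ^ Suc k - 0 ^ Suc k) \<partial>L)"
    by (rule nn_integral_tail_weight[OF L.real_distribution_axioms nonneg])
       (auto intro!: derivative_eq_intros simp del: power_Suc)
  also have "\<dots> = ennreal (LINT w|L. w ^ Suc k)"
    using nn_integral_eq_integral[OF i nn] by simp
  finally show "has_bochner_integral lborel (\<lambda>t. real (Suc k) * t ^ k * measure L {t<..} * indicator {0..} t) (LINT w|L. w ^ Suc k)"
    by (intro has_bochner_integral_nn_integral integral_nonneg_AE nn) (auto split: split_indicator)
qed

text \<open>One factor 1 / (1 - \<gamma>) is the bound on the exponential moment of
  \<open>L\<close>, which stands in front of the distance of the increment laws; the other comes
  from solving the contraction inequality. The remaining constant compares the weight (k + 1) t^k,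
  which produces the moment of order k + 1, with exp (\<theta> t).\<close>

theorem stationary_moment_diff_le:
  assumes L: "lindley_stationary A L"
    and K: "lindley_stationary B K" and \<theta>: "0 < \<theta>"
    and gA: "(\<integral>\<^sup>+x. ennreal (exp (\<theta> * x)) \<partial>A) \<le> ennreal \<gamma>"
    and gB: "(\<integral>\<^sup>+x. ennreal (exp (\<theta> * x)) \<partial>B) \<le> ennreal \<gamma>" and \<gamma>: "0 \<le> \<gamma>" "\<gamma> < 1"
    and d: "tail_dist \<theta> A B \<le> ennreal d" "0 \<le> d"
  shows "integrable L (\<lambda>w. w ^ Suc k)" "integrable K (\<lambda>w. w ^ Suc k)"
    and "\<bar>(LINT w|L. w ^ Suc k) - (LINT w|K. w ^ Suc k)\<bar> \<le> fact (Suc k) / \<theta> ^ k / (1 - \<gamma>)\<^sup>2 * d"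
proof -
  interpret L: real_distribution L by (rule lindley_stationaryD[OF L])
  interpret K: real_distribution K by (rule lindley_stationaryD[OF K])
  have eL: "(\<integral>\<^sup>+w. ennreal (exp (\<theta> * w)) \<partial>L) \<le> ennreal (1 / (1 - \<gamma>))"
    by (rule stationary_exp_moment_le[OF L]) (use \<theta> gA \<gamma> in auto)
  have eK: "(\<integral>\<^sup>+w. ennreal (exp (\<theta> * w)) \<partial>K) \<le> ennreal (1 / (1 - \<gamma>))"
    by (rule stationary_exp_moment_le[OF K]) (use \<theta> gB \<gamma> in auto)
  have fL: "(\<integral>\<^sup>+w. ennreal (exp (\<theta> * w)) \<partial>L) < \<infinity>" and fK: "(\<integral>\<^sup>+w. ennreal (exp (\<theta> * w)) \<partial>K) < \<infinity>"
    using eL eK by (auto simp: less_top[symmetric] top_unique)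
  show "integrable L (\<lambda>w. w ^ Suc k)" "integrable K (\<lambda>w. w ^ Suc k)"
    by (rule moment_tail_formula[OF L \<theta> fL] moment_tail_formula[OF K \<theta> fK])+
  have D: "tail_dist \<theta> L K \<le> ennreal (1 / (1 - \<gamma>) * d / (1 - \<gamma>))"
  proof (rule ennreal_contraction_bound)
    show "tail_dist \<theta> L K \<le> (\<integral>\<^sup>+w. ennreal (exp (\<theta> * w)) \<partial>L) * tail_dist \<theta> A B + ennreal \<gamma> * tail_dist \<theta> L K"
      using tail_dist_stationary_le[OF L K, of \<theta>] gB
      by (meson add_left_mono mult_right_mono order_trans zero_le)
    show "(\<integral>\<^sup>+w. ennreal (exp (\<theta> * w)) \<partial>L) * tail_dist \<theta> A B \<le> ennreal (1 / (1 - \<gamma>) * d)"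
      using \<gamma> d by (subst ennreal_mult) (auto intro!: mult_mono eL)
    show "tail_dist \<theta> L K < \<infinity>" by (rule tail_dist_finite[OF L K \<theta> fL fK])
  qed (use \<gamma> d in auto)
  note mL = moment_tail_formula(2)[OF L \<theta> fL, of k] and mK = moment_tail_formula(2)[OF K \<theta> fK, of k]
  define c where "c = fact (Suc k) / \<theta> ^ k"
  have c: "0 \<le> c" using \<theta> by (simp add: c_def)
  have "ennreal \<bar>(LINT w|L. w ^ Suc k) - (LINT w|K. w ^ Suc k)\<bar>
    = ennreal (norm (LINT t|lborel. real (Suc k) * t ^ k * measure L {t<..} * indicator {0..} t
        - real (Suc k) * t ^ k * measure K {t<..} * indicator {0..} t))"
    using has_bochner_integral_integral_eq[OF has_bochner_integral_diff[OF mL mK]] by simp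
  also have "\<dots> \<le> (\<integral>\<^sup>+t. ennreal (norm (real (Suc k) * t ^ k * measure L {t<..} * indicator {0..} t
        - real (Suc k) * t ^ k * measure K {t<..} * indicator {0..} t)) \<partial>lborel)"
    using has_bochner_integral_diff[OF mL mK] by (intro integral_norm_bound_ennreal) (auto simp: has_bochner_integral_iff)
  also have "\<dots> \<le> (\<integral>\<^sup>+t. ennreal c * ennreal (exp (\<theta> * t) * \<bar>measure L {t<..} - measure K {t<..}\<bar>) \<partial>lborel)"
  proof (rule nn_integral_mono)
    fix t :: real
    show "ennreal (norm (real (Suc k) * t ^ k * measure L {t<..} * indicator {0..} t
        - real (Suc k) * t ^ k * measure K {t<..} * indicator {0..} t))
      \<le> ennreal c * ennreal (exp (\<theta> * t) * \<bar>measure L {t<..} - measure K {t<..}\<bar>)"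
    proof (cases "0 \<le> t")
      case True
      have "norm (real (Suc k) * t ^ k * measure L {t<..} - real (Suc k) * t ^ k * measure K {t<..})
        = real (Suc k) * t ^ k * \<bar>measure L {t<..} - measure K {t<..}\<bar>"
        using True by (simp add: abs_mult right_diff_distrib[symmetric] del: of_nat_Suc)
      also have "\<dots> \<le> real (Suc k) * (fact k / \<theta> ^ k * exp (\<theta> * t)) * \<bar>measure L {t<..} - measure K {t<..}\<bar>"
        by (intro mult_right_mono mult_left_mono power_le_fact_exp True \<theta>) auto
      also have "\<dots> = c * (exp (\<theta> * t) * \<bar>measure L {t<..} - measure K {t<..}\<bar>)"
        by (simp add: c_def)
      finally show ?thesis using True c by (simp add: ennreal_mult'[symmetric] ennreal_leI)
    qed simp
  qed
  also have "\<dots> = ennreal c * tail_dist \<theta> L K"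
    unfolding tail_dist_def by (rule nn_integral_cmult) measurable
  also have "\<dots> \<le> ennreal c * ennreal (1 / (1 - \<gamma>) * d / (1 - \<gamma>))"
    by (intro mult_left_mono D) simp
  also have "\<dots> = ennreal (c * (1 / (1 - \<gamma>) * d / (1 - \<gamma>)))"
    using c by (simp add: ennreal_mult'[symmetric])
  finally have "\<bar>(LINT w|L. w ^ Suc k) - (LINT w|K. w ^ Suc k)\<bar> \<le> c * (1 / (1 - \<gamma>) * d / (1 - \<gamma>))"
    using c \<gamma> d by (subst (asm) ennreal_le_iff) auto
  then show "\<bar>(LINT w|L. w ^ Suc k) - (LINT w|K. w ^ Suc k)\<bar> \<le> fact (Suc k) / \<theta> ^ k / (1 - \<gamma>)\<^sup>2 * d"
    by (simp add: c_def power2_eq_square)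
qed

section \<open>The maximum of the Gaussian random walk\<close>

definition normal_law :: "real \<Rightarrow> real measure" where
  "normal_law \<beta> = density lborel (\<lambda>x. ennreal (normal_density (- \<beta>) 1 x))"

lemma real_distribution_normal_law: "real_distribution (normal_law \<beta>)"
  unfolding normal_law_def real_distribution_def real_distribution_axioms_def
  by (auto intro: prob_space_normal_density)

lemma sets_normal_law [simp, measurable_cong]: "sets (normal_law \<beta>) = sets borel"
  by (simp add: normal_law_def)

lemma normal_law_exp_moment:
  "(\<integral>\<^sup>+x. ennreal (exp (\<theta> * x)) \<partial>normal_law \<beta>) = ennreal (exp (\<theta>\<^sup>2 / 2 - \<theta> * \<beta>))"
proof -
  have eq: "normal_density (- \<beta>) 1 x * exp (\<theta> * x) = exp (\<theta>\<^sup>2 / 2 - \<theta> * \<beta>) * normal_density (\<theta> - \<beta>) 1 x" for x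
  proof -
    have "- (x - - \<beta>)\<^sup>2 / 2 + \<theta> * x = (\<theta>\<^sup>2 / 2 - \<theta> * \<beta>) + - (x - (\<theta> - \<beta>))\<^sup>2 / 2"
      by (simp add: field_simps power2_eq_square)
    then have "exp (- (x - - \<beta>)\<^sup>2 / 2) * exp (\<theta> * x) = exp (\<theta>\<^sup>2 / 2 - \<theta> * \<beta>) * exp (- (x - (\<theta> - \<beta>))\<^sup>2 / 2)"
      by (simp only: mult_exp_exp)
    then show ?thesis by (simp add: normal_density_def)
  qed
  have "(\<integral>\<^sup>+x. ennreal (exp (\<theta> * x)) \<partial>normal_law \<beta>)
    = (\<integral>\<^sup>+x. ennreal (normal_density (- \<beta>) 1 x * exp (\<theta> * x)) \<partial>lborel)"
    unfolding normal_law_def by (subst nn_integral_density) (auto simp: ennreal_mult)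
  also have "\<dots> = ennreal (exp (\<theta>\<^sup>2 / 2 - \<theta> * \<beta>))"
    unfolding eq by (subst nn_integral_eq_integral) (auto intro!: integrable_mult_right)
  finally show ?thesis .
qed

lemma gaussian_increments_eq: "gaussian_increments \<beta> = PiM UNIV (\<lambda>_. normal_law \<beta>)"
  by (simp add: gaussian_increments_def normal_law_def)

lemma sequence_space_normal_law: "sequence_space (normal_law \<beta>)"
proof -
  interpret real_distribution "normal_law \<beta>" by (rule real_distribution_normal_law)
  show ?thesis
    unfolding sequence_space_def product_prob_space_def product_prob_space_axioms_def product_sigma_finite_def
    using prob_space_axioms sigma_finite_measure_axioms by auto
qed

lemma measurable_partial_sum [measurable]:
  "(\<lambda>x. \<Sum>i<k::nat. x i) \<in> borel_measurable (PiM UNIV (\<lambda>_. normal_law \<beta>))"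
proof (rule borel_measurable_sum)
  fix i
  have "(\<lambda>x. x i) \<in> measurable (PiM UNIV (\<lambda>_. normal_law \<beta>)) (normal_law \<beta>)"
    by (rule measurable_component_singleton) simp
  then show "(\<lambda>x. x i) \<in> borel_measurable (PiM UNIV (\<lambda>_. normal_law \<beta>))"
    by (simp only: measurable_cong_sets[OF refl sets_normal_law])
qed

text \<open>The supremum of an unbounded set of reals is some unspecified but fixed number.\<close>

lemma borel_measurable_walk_max [measurable]:
  "walk_max \<in> borel_measurable (PiM UNIV (\<lambda>_. normal_law \<beta>))"
proof -
  \<comment> \<open>Boundedness is expressed by quantifiers over naturals only, which makes it a
    measurable predicate.\<close>
  define P where "P = (\<lambda>x :: nat \<Rightarrow> real. \<exists>n :: nat. \<forall>k. (\<Sum>i<k. x i) \<le> real n)"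
  have P_iff: "P x \<longleftrightarrow> bdd_above (range (\<lambda>k. \<Sum>i<k. x i))" for x
  proof
    assume "bdd_above (range (\<lambda>k. \<Sum>i<k. x i))"
    then obtain c where c: "\<And>k. (\<Sum>i<k. x i) \<le> c" by (auto simp: bdd_above_def)
    obtain n where "c \<le> real n" using real_arch_simple by blast
    with c show "P x" unfolding P_def by (meson order_trans)
  qed (auto simp: P_def bdd_above_def)
  \<comment> \<open>The sums inside the supremum are replaced by 0 where \<open>P\<close> fails,
    because measurability of a supremum is available for families that are bounded at every
    point.\<close>
  have eq: "walk_max = (\<lambda>x. if P x then (SUP k. if P x then (\<Sum>i<k. x i) else 0) else (LEAST z::real. False))"
  proof
    fix x
    have "walk_max x = (LEAST z::real. False)" if "\<not> P x"
    proof -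
      have "(\<forall>y\<in>range (\<lambda>k. \<Sum>i<k. x i). y \<le> z) = False" for z
        using that by (auto simp: P_iff bdd_above_def)
      then show ?thesis unfolding walk_max_def Sup_real_def by (simp only:)
    qed
    then show "walk_max x = (if P x then (SUP k. if P x then (\<Sum>i<k. x i) else 0) else (LEAST z::real. False))"
      by (simp add: walk_max_def)
  qed
  have [measurable]: "Measurable.pred (PiM UNIV (\<lambda>_. normal_law \<beta>)) P"
    unfolding P_def by measurable
  have "(\<lambda>x. SUP k. if P x then (\<Sum>i<k. x i) else 0) \<in> borel_measurable (PiM UNIV (\<lambda>_. normal_law \<beta>))"
  proof (rule borel_measurable_cSUP)
    fix x :: "nat \<Rightarrow> real"
    show "bdd_above (range (\<lambda>k. if P x then (\<Sum>i<k. x i) else 0))"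
      by (cases "P x") (auto simp: P_iff)
  qed auto
  then show ?thesis unfolding eq by measurable
qed

lemma nn_integral_PiM_iter:
  assumes "f \<in> borel_measurable (PiM UNIV (\<lambda>_. normal_law \<beta>))"
  shows "(\<integral>\<^sup>+x. f x \<partial>PiM UNIV (\<lambda>_. normal_law \<beta>))
    = (\<integral>\<^sup>+s. (\<integral>\<^sup>+x. f (case_nat s x) \<partial>PiM UNIV (\<lambda>_. normal_law \<beta>)) \<partial>normal_law \<beta>)"
proof -
  interpret sequence_space "normal_law \<beta>" by (rule sequence_space_normal_law)
  have [measurable]: "f \<in> borel_measurable S" by fact
  have "(\<integral>\<^sup>+x. f x \<partial>S) = (\<integral>\<^sup>+x. f x \<partial>distr (normal_law \<beta> \<Otimes>\<^sub>M S) S (\<lambda>(s, \<omega>). case_nat s \<omega>))"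
    by (simp only: PiM_iter)
  also have "\<dots> = (\<integral>\<^sup>+z. f (case_nat (fst z) (snd z)) \<partial>(normal_law \<beta> \<Otimes>\<^sub>M S))"
    by (subst nn_integral_distr) (auto simp: case_prod_beta)
  also have "\<dots> = (\<integral>\<^sup>+s. (\<integral>\<^sup>+x. f (case_nat s x) \<partial>S) \<partial>normal_law \<beta>)"
    by (subst P.nn_integral_fst[symmetric]) (auto simp: case_prod_beta)
  finally show ?thesis .
qed

lemma partial_sum_case_nat: "(\<Sum>i<Suc k. case_nat s x i) = s + (\<Sum>i<k. x i)" for s :: real
  by (subst sum.lessThan_Suc_shift) simp

lemma nn_integral_exp_partial_sum:
  "(\<integral>\<^sup>+x. ennreal (exp (\<theta> * (\<Sum>i<k. x i))) \<partial>PiM UNIV (\<lambda>_. normal_law \<beta>)) = ennreal (exp (\<theta>\<^sup>2 / 2 - \<theta> * \<beta>) ^ k)"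
proof (induction k)
  interpret sequence_space "normal_law \<beta>" by (rule sequence_space_normal_law)
  case 0
  then show ?case using P.emeasure_space_1 by simp
next
  interpret sequence_space "normal_law \<beta>" by (rule sequence_space_normal_law)
  case (Suc k)
  have "(\<integral>\<^sup>+x. ennreal (exp (\<theta> * (\<Sum>i<Suc k. x i))) \<partial>S)
    = (\<integral>\<^sup>+s. (\<integral>\<^sup>+x. ennreal (exp (\<theta> * s)) * ennreal (exp (\<theta> * (\<Sum>i<k. x i))) \<partial>S) \<partial>normal_law \<beta>)"
    by (subst nn_integral_PiM_iter)
       (simp_all only: partial_sum_case_nat distrib_left mult_exp_exp[symmetric] ennreal_mult exp_ge_zero, measurable)
  also have "\<dots> = ennreal (exp (\<theta>\<^sup>2 / 2 - \<theta> * \<beta>)) * ennreal (exp (\<theta>\<^sup>2 / 2 - \<theta> * \<beta>) ^ k)"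
    by (simp add: nn_integral_cmult nn_integral_multc Suc normal_law_exp_moment)
  finally show ?case by (simp add: ennreal_mult)
qed

text \<open>The exponent \<beta> minimises \<theta>^2 / 2 - \<theta> \<beta>. With it the
  expectations of exp (\<beta> S_k) form a convergent geometric series, so the sum of these
  exponentials over k is almost surely finite, and it bounds each of them.\<close>

lemma AE_walk_bdd:
  assumes "0 < \<beta>"
  shows "AE x in PiM UNIV (\<lambda>_. normal_law \<beta>). bdd_above (range (\<lambda>k::nat. \<Sum>i<k. x i))"
proof -
  define g where "g = exp (\<beta>\<^sup>2 / 2 - \<beta> * \<beta>)"
  have g: "0 \<le> g" "g < 1" using assms by (auto simp: g_def power2_eq_square)
  have "(\<integral>\<^sup>+x. (\<Sum>k. ennreal (exp (\<beta> * (\<Sum>i<k. x i)))) \<partial>PiM UNIV (\<lambda>_. normal_law \<beta>)) = (\<Sum>k. ennreal (g ^ k))"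
    by (subst nn_integral_suminf) (auto simp: nn_integral_exp_partial_sum g_def)
  also have "\<dots> = ennreal (\<Sum>k. g ^ k)"
    using g by (intro suminf_ennreal2) (auto intro: summable_geometric)
  finally have "(\<integral>\<^sup>+x. (\<Sum>k. ennreal (exp (\<beta> * (\<Sum>i<k. x i)))) \<partial>PiM UNIV (\<lambda>_. normal_law \<beta>)) \<noteq> \<infinity>" by simp
  then have "AE x in PiM UNIV (\<lambda>_. normal_law \<beta>). (\<Sum>k. ennreal (exp (\<beta> * (\<Sum>i<k. x i)))) \<noteq> \<infinity>"
    by (intro nn_integral_noteq_infinite) auto
  then show ?thesis
  proof eventually_elim
    case (elim x)
    obtain c where c: "(\<Sum>k. ennreal (exp (\<beta> * (\<Sum>i<k. x i)))) = ennreal c" "0 \<le> c"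
    proof (cases "\<Sum>k. ennreal (exp (\<beta> * (\<Sum>i<k. x i)))" rule: ennreal_cases)
      case top
      with elim show ?thesis by (simp only: infinity_ennreal_def)
    qed (rule that)
    have "(\<Sum>i<k. x i) \<le> ln c / \<beta>" for k
    proof -
      have "sum (\<lambda>k. ennreal (exp (\<beta> * (\<Sum>i<k. x i)))) {k} \<le> (\<Sum>k. ennreal (exp (\<beta> * (\<Sum>i<k. x i))))"
        by (rule sum_le_suminf) auto
      then have "ennreal (exp (\<beta> * (\<Sum>i<k. x i))) \<le> ennreal c"
        unfolding c(1) by simp
      then have 1: "exp (\<beta> * (\<Sum>i<k. x i)) \<le> c"
        using c(2) by (simp only: ennreal_le_iff)
      then have "\<beta> * (\<Sum>i<k. x i) \<le> ln c"
        by (subst ln_ge_iff) (use less_le_trans[OF exp_gt_zero 1] in simp_all)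
      then show ?thesis using assms by (simp add: pos_le_divide_eq mult.commute)
    qed
    then show ?case by (auto simp: bdd_above_def)
  qed
qed

text \<open>First-step decomposition: the empty sum contributes the 0, and every other partial sum
  starts with \<open>s\<close>.\<close>

lemma walk_max_case_nat:
  assumes "bdd_above (range (\<lambda>k. \<Sum>i<k. x i))"
  shows "walk_max (case_nat s x) = max 0 (walk_max x + s)"
proof (rule antisym)
  have upper: "(\<Sum>i<k. x i) \<le> walk_max x" for k
    unfolding walk_max_def by (rule cSUP_upper[OF _ assms]) simp
  have le: "(\<Sum>i<k. case_nat s x i) \<le> max 0 (walk_max x + s)" for k
  proof (cases k)
    case (Suc j)
    have "(\<Sum>i<k. case_nat s x i) = s + (\<Sum>i<j. x i)"
      unfolding Suc by (rule partial_sum_case_nat)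
    then show ?thesis using upper[of j] by simp
  qed simp
  then show "walk_max (case_nat s x) \<le> max 0 (walk_max x + s)"
    unfolding walk_max_def[of "case_nat s x"] by (intro cSUP_least) auto
  have bdd: "bdd_above (range (\<lambda>k. \<Sum>i<k. case_nat s x i))"
    using le by (auto simp: bdd_above_def)
  have upper': "(\<Sum>i<k. case_nat s x i) \<le> walk_max (case_nat s x)" for k
    unfolding walk_max_def by (rule cSUP_upper[OF _ bdd]) simp
  have "walk_max x \<le> walk_max (case_nat s x) - s"
    unfolding walk_max_def[of x]
  proof (rule cSUP_least)
    fix k show "(\<Sum>i<k. x i) \<le> walk_max (case_nat s x) - s"
      using upper'[of "Suc k"] partial_sum_case_nat[of s x k] by simp
  qed simp
  moreover have "0 \<le> walk_max (case_nat s x)" using upper'[of 0] by simp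
  ultimately show "max 0 (walk_max x + s) \<le> walk_max (case_nat s x)" by simp
qed

text \<open>Splitting off the first increment leaves an independent sequence with the same law, so
  that \<open>walk_max_case_nat\<close>, which holds on almost every path, becomes the Lindley
  equation in distribution.\<close>

lemma lindley_stationary_walk_max:
  assumes "0 < \<beta>"
  shows "lindley_stationary (normal_law \<beta>) (distr (gaussian_increments \<beta>) borel walk_max)"
    (is "lindley_stationary ?A ?L")
proof -
  interpret A: real_distribution "normal_law \<beta>" by (rule real_distribution_normal_law)
  interpret sequence_space "normal_law \<beta>" by (rule sequence_space_normal_law)
  interpret L: real_distribution ?L
    unfolding gaussian_increments_eq
    by (rule P.real_distribution_distr[OF borel_measurable_walk_max])
  have "?L = distr (?L \<Otimes>\<^sub>M normal_law \<beta>) borel (\<lambda>(w, x). max 0 (w + x))"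
  proof (rule measure_eqI)
    fix E assume "E \<in> sets ?L"
    then have E[measurable]: "E \<in> sets borel" by simp
    interpret SA: pair_sigma_finite S "normal_law \<beta>" by standard
    have "emeasure ?L E = (\<integral>\<^sup>+x. indicator E (walk_max x) \<partial>S)"
      unfolding gaussian_increments_eq
      by (subst nn_integral_indicator[symmetric], simp, subst nn_integral_distr) auto
    also have "\<dots> = (\<integral>\<^sup>+s. (\<integral>\<^sup>+x. indicator E (walk_max (case_nat s x)) \<partial>S) \<partial>normal_law \<beta>)"
      by (rule nn_integral_PiM_iter) measurable
    also have "\<dots> = (\<integral>\<^sup>+s. (\<integral>\<^sup>+x. indicator E (max 0 (walk_max x + s)) \<partial>S) \<partial>normal_law \<beta>)"
      by (rule nn_integral_cong, rule nn_integral_cong_AE, rule AE_mp[OF AE_walk_bdd[OF assms]])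
         (simp add: walk_max_case_nat)
    also have "\<dots> = (\<integral>\<^sup>+x. (\<integral>\<^sup>+s. indicator E (max 0 (walk_max x + s)) \<partial>normal_law \<beta>) \<partial>S)"
      by (rule SA.Fubini') measurable
    also have "\<dots> = (\<integral>\<^sup>+w. (\<integral>\<^sup>+s. indicator E (max 0 (w + s)) \<partial>normal_law \<beta>) \<partial>?L)"
      unfolding gaussian_increments_eq
      by (rule nn_integral_distr[symmetric]) measurable
    also have "\<dots> = (\<integral>\<^sup>+z. indicator E (max 0 (fst z + snd z)) \<partial>(?L \<Otimes>\<^sub>M normal_law \<beta>))"
      by (subst A.nn_integral_fst[symmetric]) auto
    also have "\<dots> = emeasure (distr (?L \<Otimes>\<^sub>M normal_law \<beta>) borel (\<lambda>(w, x). max 0 (w + x))) E"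
      by (subst nn_integral_indicator[symmetric], simp, subst nn_integral_distr) (auto simp: case_prod_beta)
    finally show "emeasure ?L E = emeasure (distr (?L \<Otimes>\<^sub>M normal_law \<beta>) borel (\<lambda>(w, x). max 0 (w + x))) E" .
  qed simp
  then show ?thesis
    by (simp add: lindley_stationary_def A.real_distribution_axioms L.real_distribution_axioms)
qed

lemma walk_max_moment_eq:
  "walk_max_moment k \<beta> = (LINT w|distr (gaussian_increments \<beta>) borel walk_max. w ^ k)"
  unfolding walk_max_moment_def gaussian_increments_eq by (subst integral_distr) auto

lemma integrable_walk_max_power:
  "integrable (distr (gaussian_increments \<beta>) borel walk_max) (\<lambda>w. w ^ k)
    \<longleftrightarrow> integrable (gaussian_increments \<beta>) (\<lambda>x. walk_max x ^ k)"
  unfolding gaussian_increments_eq by (subst integrable_distr_eq) auto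

section \<open>Laws of the increments\<close>

lemma nn_integral_exp_indicator_diff_le:
  fixes x y :: real
  assumes "0 \<le> \<theta>"
  shows "(\<integral>\<^sup>+t. ennreal (exp (\<theta> * t) * \<bar>indicator {t<..} x - indicator {t<..} y\<bar>) \<partial>lborel)
    \<le> ennreal (\<bar>x - y\<bar> * exp (\<theta> * max x y))"
proof -
  have "(\<integral>\<^sup>+t. ennreal (exp (\<theta> * t) * \<bar>indicator {t<..} x - indicator {t<..} y\<bar>) \<partial>lborel)
    \<le> (\<integral>\<^sup>+t. ennreal (exp (\<theta> * max x y)) * indicator {min x y..max x y} t \<partial>lborel)"
    using assms by (intro nn_integral_mono) (auto split: split_indicator intro!: ennreal_leI mult_left_mono)
  also have "\<dots> = ennreal (exp (\<theta> * max x y)) * ennreal (max x y - min x y)"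
    by (subst nn_integral_cmult_indicator) auto
  also have "\<dots> = ennreal (\<bar>x - y\<bar> * exp (\<theta> * max x y))"
    by (subst ennreal_mult[symmetric]) (auto simp: max_def min_def mult.commute abs_if)
  finally show ?thesis .
qed

text \<open>Every coupling bounds the distance: for given outcomes the two indicators differ only at
  levels t between the two values, where the weight is at most its value at the larger one.\<close>

lemma (in prob_space) tail_dist_coupling_le:
  assumes [measurable]: "X \<in> borel_measurable M" "Y \<in> borel_measurable M" and \<theta>: "0 \<le> \<theta>"
  shows "tail_dist \<theta> (distr M borel X) (distr M borel Y)
    \<le> (\<integral>\<^sup>+\<omega>. ennreal (\<bar>X \<omega> - Y \<omega>\<bar> * exp (\<theta> * max (X \<omega>) (Y \<omega>))) \<partial>M)"
proof -
  interpret pair_sigma_finite M lborel by standard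
  have tail: "measure (distr M borel Z) {t<..} = (LINT \<omega>|M. indicator {t<..} (Z \<omega>))"
    if [measurable]: "Z \<in> borel_measurable M" for Z and t :: real
  proof -
    have "(LINT \<omega>|M. indicator {t<..} (Z \<omega>)) = (LINT \<omega>|M. indicat_real (Z -` {t<..} \<inter> space M) \<omega>)"
      by (intro Bochner_Integration.integral_cong) (auto simp: indicator_def)
    then show ?thesis by (simp add: measure_distr)
  qed
  have "tail_dist \<theta> (distr M borel X) (distr M borel Y)
    \<le> (\<integral>\<^sup>+t. (\<integral>\<^sup>+\<omega>. ennreal (exp (\<theta> * t) * \<bar>indicator {t<..} (X \<omega>) - indicator {t<..} (Y \<omega>)\<bar>) \<partial>M) \<partial>lborel)"
    unfolding tail_dist_def
  proof (rule nn_integral_mono)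
    fix t :: real
    have i: "integrable M (\<lambda>\<omega>. indicator {t<..} (Z \<omega>) :: real)" if [measurable]: "Z \<in> borel_measurable M" for Z
      by (rule integrable_const_bound[where B = 1]) auto
    have "ennreal \<bar>measure (distr M borel X) {t<..} - measure (distr M borel Y) {t<..}\<bar>
      = ennreal (norm (LINT \<omega>|M. indicator {t<..} (X \<omega>) - (indicator {t<..} (Y \<omega>) :: real)))"
      by (simp add: tail i)
    also have "\<dots> \<le> (\<integral>\<^sup>+\<omega>. ennreal (norm (indicator {t<..} (X \<omega>) - indicator {t<..} (Y \<omega>) :: real)) \<partial>M)"
      by (intro integral_norm_bound_ennreal Bochner_Integration.integrable_diff i) auto
    finally have "ennreal (exp (\<theta> * t)) * ennreal \<bar>measure (distr M borel X) {t<..} - measure (distr M borel Y) {t<..}\<bar>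
      \<le> ennreal (exp (\<theta> * t)) * (\<integral>\<^sup>+\<omega>. ennreal (norm (indicator {t<..} (X \<omega>) - indicator {t<..} (Y \<omega>) :: real)) \<partial>M)"
      by (rule mult_left_mono) simp
    then show "ennreal (exp (\<theta> * t) * \<bar>measure (distr M borel X) {t<..} - measure (distr M borel Y) {t<..}\<bar>)
      \<le> (\<integral>\<^sup>+\<omega>. ennreal (exp (\<theta> * t) * \<bar>indicator {t<..} (X \<omega>) - indicator {t<..} (Y \<omega>)\<bar>) \<partial>M)"
      by (simp add: ennreal_mult nn_integral_cmult)
  qed
  also have "\<dots> = (\<integral>\<^sup>+\<omega>. (\<integral>\<^sup>+t. ennreal (exp (\<theta> * t) * \<bar>indicator {t<..} (X \<omega>) - indicator {t<..} (Y \<omega>)\<bar>) \<partial>lborel) \<partial>M)"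
    by (rule Fubini') (simp add: indicator_def)
  also have "\<dots> \<le> (\<integral>\<^sup>+\<omega>. ennreal (\<bar>X \<omega> - Y \<omega>\<bar> * exp (\<theta> * max (X \<omega>) (Y \<omega>))) \<partial>M)"
    by (intro nn_integral_mono nn_integral_exp_indicator_diff_le \<theta>)
  finally show ?thesis .
qed

lemma tail_dist_triangle:
  assumes "real_distribution A" "real_distribution B" "real_distribution C"
  shows "tail_dist \<theta> A C \<le> tail_dist \<theta> A B + tail_dist \<theta> B C"
proof -
  interpret A: real_distribution A by fact
  interpret B: real_distribution B by fact
  interpret C: real_distribution C by fact
  have "tail_dist \<theta> A C \<le> (\<integral>\<^sup>+t. ennreal (exp (\<theta> * t) * \<bar>measure A {t<..} - measure B {t<..}\<bar>)
      + ennreal (exp (\<theta> * t) * \<bar>measure B {t<..} - measure C {t<..}\<bar>) \<partial>lborel)"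
    unfolding tail_dist_def
  proof (rule nn_integral_mono)
    fix t
    have "exp (\<theta> * t) * \<bar>measure A {t<..} - measure C {t<..}\<bar>
      \<le> exp (\<theta> * t) * (\<bar>measure A {t<..} - measure B {t<..}\<bar> + \<bar>measure B {t<..} - measure C {t<..}\<bar>)"
      by (intro mult_left_mono) auto
    from ennreal_leI[OF this]
    show "ennreal (exp (\<theta> * t) * \<bar>measure A {t<..} - measure C {t<..}\<bar>)
      \<le> ennreal (exp (\<theta> * t) * \<bar>measure A {t<..} - measure B {t<..}\<bar>)
        + ennreal (exp (\<theta> * t) * \<bar>measure B {t<..} - measure C {t<..}\<bar>)"
      by (simp add: distrib_left)
  qed
  also have "\<dots> = tail_dist \<theta> A B + tail_dist \<theta> B C"
    unfolding tail_dist_def by (rule nn_integral_add) auto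
  finally show ?thesis .
qed

text \<open>The substitution of levels also rescales the weight, whose exponent becomes \<theta> *
  \<tau>; the Stein bound has to be applied with this exponent.\<close>

lemma tail_dist_affine:
  assumes "real_distribution A" "real_distribution B" and \<tau>: "0 < \<tau>"
  shows "tail_dist \<theta> (distr A borel (\<lambda>u. \<tau> * u - b)) (distr B borel (\<lambda>u. \<tau> * u - b))
    = ennreal (\<tau> * exp (- \<theta> * b)) * tail_dist (\<theta> * \<tau>) A B"
proof -
  interpret A: real_distribution A by fact
  interpret B: real_distribution B by fact
  have tail: "measure (distr C borel (\<lambda>u. \<tau> * u - b)) {\<tau> * t - b<..} = measure C {t<..}"
    if "real_distribution C" for C t
  proof -
    interpret C: real_distribution C by fact
    have "(\<lambda>u. \<tau> * u - b) -` {\<tau> * t - b<..} = {t<..}" using \<tau> by auto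
    then show ?thesis by (subst measure_distr) auto
  qed
  interpret A': real_distribution "distr A borel (\<lambda>u. \<tau> * u - b)" by (rule A.real_distribution_distr) simp
  interpret B': real_distribution "distr B borel (\<lambda>u. \<tau> * u - b)" by (rule B.real_distribution_distr) simp
  have "tail_dist \<theta> (distr A borel (\<lambda>u. \<tau> * u - b)) (distr B borel (\<lambda>u. \<tau> * u - b))
    = ennreal \<tau> * (\<integral>\<^sup>+t. ennreal (exp (\<theta> * (- b + \<tau> * t)) * \<bar>measure A {t<..} - measure B {t<..}\<bar>) \<partial>lborel)"
    unfolding tail_dist_def using \<tau>
    by (subst nn_integral_real_affine[where c = \<tau> and t = "- b"])
       (auto simp: tail A.real_distribution_axioms B.real_distribution_axioms)
  also have "(\<integral>\<^sup>+t. ennreal (exp (\<theta> * (- b + \<tau> * t)) * \<bar>measure A {t<..} - measure B {t<..}\<bar>) \<partial>lborel)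
    = (\<integral>\<^sup>+t. ennreal (exp (- \<theta> * b)) * ennreal (exp (\<theta> * \<tau> * t) * \<bar>measure A {t<..} - measure B {t<..}\<bar>) \<partial>lborel)"
  proof (intro nn_integral_cong)
    fix t
    have "exp (\<theta> * (- b + \<tau> * t)) = exp (- \<theta> * b) * exp (\<theta> * \<tau> * t)"
      by (simp add: mult_exp_exp algebra_simps)
    then show "ennreal (exp (\<theta> * (- b + \<tau> * t)) * \<bar>measure A {t<..} - measure B {t<..}\<bar>)
      = ennreal (exp (- \<theta> * b)) * ennreal (exp (\<theta> * \<tau> * t) * \<bar>measure A {t<..} - measure B {t<..}\<bar>)"
      by (simp only: ennreal_mult'[symmetric] exp_ge_zero mult.assoc)
  qed
  also have "\<dots> = ennreal (exp (- \<theta> * b)) * tail_dist (\<theta> * \<tau>) A B"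
    unfolding tail_dist_def by (rule nn_integral_cmult) measurable
  finally show ?thesis using \<tau> by (simp add: ennreal_mult mult.assoc)
qed

lemma normal_law_eq_distr: "normal_law \<beta> = distr std_normal_distribution borel (\<lambda>z. z - \<beta>)"
proof (rule measure_eqI)
  fix E assume "E \<in> sets (normal_law \<beta>)"
  then have [measurable]: "E \<in> sets borel" by simp
  have "emeasure (normal_law \<beta>) E = (\<integral>\<^sup>+x. ennreal (normal_density (- \<beta>) 1 x) * indicator E x \<partial>lborel)"
    unfolding normal_law_def by (subst emeasure_density) auto
  also have "\<dots> = (\<integral>\<^sup>+x. ennreal (normal_density (- \<beta>) 1 (x - \<beta>)) * indicator E (x - \<beta>) \<partial>lborel)"
    by (rule nn_integral_lborel_shift[symmetric]) measurable
  also have "\<dots> = (\<integral>\<^sup>+x. ennreal (std_normal_density x) * indicator E (x - \<beta>) \<partial>lborel)"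
    by (simp add: normal_density_def)
  also have "\<dots> = (\<integral>\<^sup>+x. indicator E (x - \<beta>) \<partial>std_normal_distribution)"
    by (subst nn_integral_density) auto
  also have "\<dots> = emeasure (distr std_normal_distribution borel (\<lambda>z. z - \<beta>)) E"
    by (subst nn_integral_indicator[symmetric], simp, subst nn_integral_distr) auto
  finally show "emeasure (normal_law \<beta>) E = emeasure (distr std_normal_distribution borel (\<lambda>z. z - \<beta>)) E" .
qed simp

lemma std_normal_exp_moment:
  "(\<integral>\<^sup>+x. ennreal (exp (\<theta> * x)) \<partial>std_normal_distribution) = ennreal (exp (\<theta>\<^sup>2 / 2))"
  using normal_law_exp_moment[where \<theta> = \<theta> and \<beta> = 0] by (simp add: normal_law_def)

text \<open>One normal variable z serves as coupling of the two laws. The restrictions on \<theta>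
  and \<tau> keep the exponent of the weight below |z|, and 1 + |z| \<le> exp |z| bounds the linear
  factor. It remains to integrate exp (2 * |z|), which is at most exp (2 * z) + exp (- 2 * z); each
  of these has expectation exp 2.\<close>

lemma tail_dist_normal_le:
  assumes "0 \<le> \<theta>" "\<theta> \<le> 1 / 2" "0 \<le> \<tau>" "\<tau> \<le> 2" "0 \<le> b" "0 \<le> \<beta>"
  shows "tail_dist \<theta> (distr std_normal_distribution borel (\<lambda>z. \<tau> * z - b)) (normal_law \<beta>)
    \<le> ennreal (2 * exp 2 * (\<bar>b - \<beta>\<bar> + \<bar>\<tau> - 1\<bar>))"
proof -
  have pw: "\<bar>(\<tau> * z - b) - (z - \<beta>)\<bar> * exp (\<theta> * max (\<tau> * z - b) (z - \<beta>))
    \<le> (\<bar>b - \<beta>\<bar> + \<bar>\<tau> - 1\<bar>) * (exp (2 * z) + exp (- 2 * z))" for z :: real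
  proof -
    have "\<bar>(\<tau> * z - b) - (z - \<beta>)\<bar> = \<bar>(\<tau> - 1) * z - (b - \<beta>)\<bar>" by (simp add: algebra_simps)
    also have "\<dots> \<le> \<bar>\<tau> - 1\<bar> * \<bar>z\<bar> + \<bar>b - \<beta>\<bar>"
      by (rule order_trans[OF abs_triangle_ineq4]) (simp add: abs_mult)
    also have "\<dots> \<le> (\<bar>b - \<beta>\<bar> + \<bar>\<tau> - 1\<bar>) * (1 + \<bar>z\<bar>)" by (simp add: algebra_simps)
    also have "\<dots> \<le> (\<bar>b - \<beta>\<bar> + \<bar>\<tau> - 1\<bar>) * exp \<bar>z\<bar>" by (intro mult_left_mono) auto
    finally have 1: "\<bar>(\<tau> * z - b) - (z - \<beta>)\<bar> \<le> (\<bar>b - \<beta>\<bar> + \<bar>\<tau> - 1\<bar>) * exp \<bar>z\<bar>" .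
    have "\<tau> * z \<le> \<tau> * \<bar>z\<bar>" by (rule mult_left_mono[OF abs_ge_self assms(3)])
    moreover have "\<tau> * \<bar>z\<bar> \<le> 2 * \<bar>z\<bar>" by (rule mult_right_mono[OF assms(4) abs_ge_zero])
    ultimately have "max (\<tau> * z - b) (z - \<beta>) \<le> 2 * \<bar>z\<bar>"
      using assms(5,6) abs_ge_self[of z] by (intro max.boundedI) linarith+
    then have "\<theta> * max (\<tau> * z - b) (z - \<beta>) \<le> \<theta> * (2 * \<bar>z\<bar>)" by (rule mult_left_mono[OF _ assms(1)])
    also have "\<dots> \<le> (1 / 2) * (2 * \<bar>z\<bar>)" by (rule mult_right_mono[OF assms(2)]) simp
    finally have 2: "exp (\<theta> * max (\<tau> * z - b) (z - \<beta>)) \<le> exp \<bar>z\<bar>"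
      by simp
    have "\<bar>(\<tau> * z - b) - (z - \<beta>)\<bar> * exp (\<theta> * max (\<tau> * z - b) (z - \<beta>))
      \<le> ((\<bar>b - \<beta>\<bar> + \<bar>\<tau> - 1\<bar>) * exp \<bar>z\<bar>) * exp \<bar>z\<bar>"
      by (rule mult_mono[OF 1 2]) simp_all
    also have "\<dots> = (\<bar>b - \<beta>\<bar> + \<bar>\<tau> - 1\<bar>) * exp (2 * \<bar>z\<bar>)" by (simp add: mult.assoc mult_exp_exp)
    also have "\<dots> \<le> (\<bar>b - \<beta>\<bar> + \<bar>\<tau> - 1\<bar>) * (exp (2 * z) + exp (- 2 * z))"
      by (rule mult_left_mono) (simp_all add: abs_if)
    finally show ?thesis .
  qed
  have "tail_dist \<theta> (distr std_normal_distribution borel (\<lambda>z. \<tau> * z - b)) (normal_law \<beta>)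
    \<le> (\<integral>\<^sup>+z. ennreal (\<bar>(\<tau> * z - b) - (z - \<beta>)\<bar> * exp (\<theta> * max (\<tau> * z - b) (z - \<beta>))) \<partial>std_normal_distribution)"
    unfolding normal_law_eq_distr by (rule std_normal.tail_dist_coupling_le) (use assms in auto)
  also have "\<dots> \<le> (\<integral>\<^sup>+z. ennreal (\<bar>b - \<beta>\<bar> + \<bar>\<tau> - 1\<bar>) * (ennreal (exp (2 * z)) + ennreal (exp ((- 2) * z))) \<partial>std_normal_distribution)"
    using ennreal_leI[OF pw] by (intro nn_integral_mono) (simp add: ennreal_mult'[symmetric] ennreal_plus[symmetric] del: ennreal_plus)
  also have "\<dots> = ennreal (\<bar>b - \<beta>\<bar> + \<bar>\<tau> - 1\<bar>) * (ennreal (exp 2) + ennreal (exp 2))"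
  proof -
    have e: "(\<integral>\<^sup>+z. ennreal (exp (2 * z)) \<partial>std_normal_distribution) = ennreal (exp 2)"
      "(\<integral>\<^sup>+z. ennreal (exp ((- 2) * z)) \<partial>std_normal_distribution) = ennreal (exp 2)"
      unfolding std_normal_exp_moment by simp_all
    have "(\<integral>\<^sup>+z. ennreal (exp (2 * z)) + ennreal (exp ((- 2) * z)) \<partial>std_normal_distribution)
      = (\<integral>\<^sup>+z. ennreal (exp (2 * z)) \<partial>std_normal_distribution)
        + (\<integral>\<^sup>+z. ennreal (exp ((- 2) * z)) \<partial>std_normal_distribution)"
      by (rule nn_integral_add) measurable
    also have "\<dots> = ennreal (exp 2) + ennreal (exp 2)" by (simp only: e)
    finally have int: "(\<integral>\<^sup>+z. ennreal (exp (2 * z)) + ennreal (exp ((- 2) * z)) \<partial>std_normal_distribution)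
      = ennreal (exp 2) + ennreal (exp 2)" .
    show ?thesis unfolding int[symmetric] by (rule nn_integral_cmult) measurable
  qed
  also have "\<dots> = ennreal (2 * exp 2 * (\<bar>b - \<beta>\<bar> + \<bar>\<tau> - 1\<bar>))"
  proof -
    have "ennreal (exp 2) + ennreal (exp 2) = ennreal (exp 2 + exp 2)"
      by (rule ennreal_plus[symmetric]) simp_all
    then show ?thesis
      by (simp only: ennreal_mult''[symmetric] add_nonneg_nonneg exp_ge_zero) (simp add: algebra_simps)
  qed
  finally show ?thesis .
qed

section \<open>Reduction of the queue to a single increment law\<close>

lemma lindley_stationary_scale:
  assumes L: "lindley_stationary A L" and c: "0 \<le> c"
  shows "lindley_stationary (distr A borel (\<lambda>x. c * x)) (distr L borel (\<lambda>x. c * x))"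
proof -
  interpret A: real_distribution A by (rule lindley_stationaryD[OF L])
  interpret L: real_distribution L by (rule lindley_stationaryD[OF L])
  have eq: "L = distr (L \<Otimes>\<^sub>M A) borel (\<lambda>(w, x). max 0 (w + x))"
    using L by (simp add: lindley_stationary_def)
  interpret A': real_distribution "distr A borel (\<lambda>x. c * x)" by (rule A.real_distribution_distr) simp
  interpret L': real_distribution "distr L borel (\<lambda>x. c * x)" by (rule L.real_distribution_distr) simp
  have "distr (distr L borel (\<lambda>x. c * x) \<Otimes>\<^sub>M distr A borel (\<lambda>x. c * x)) borel (\<lambda>(w, x). max 0 (w + x))
    = distr (distr (L \<Otimes>\<^sub>M A) (borel \<Otimes>\<^sub>M borel) (\<lambda>(w, x). (c * w, c * x))) borel (\<lambda>(w, x). max 0 (w + x))"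
    by (subst pair_measure_distr) (auto intro: A'.sigma_finite_measure_axioms)
  also have "\<dots> = distr (L \<Otimes>\<^sub>M A) borel (\<lambda>(w, x). c * max 0 (w + x))"
    using c by (subst distr_distr) (auto intro!: distr_cong simp: max_mult_distrib_left distrib_left)
  also have "\<dots> = distr (distr (L \<Otimes>\<^sub>M A) borel (\<lambda>(w, x). max 0 (w + x))) borel (\<lambda>x. c * x)"
    by (subst distr_distr) (auto intro!: distr_cong)
  also have "\<dots> = distr L borel (\<lambda>x. c * x)" by (simp only: eq[symmetric])
  finally show ?thesis
    by (simp add: lindley_stationary_def A'.real_distribution_axioms L'.real_distribution_axioms)
qed

lemma indep_vars_PiM_coordinates:
  assumes D: "real_distribution D" and "I \<noteq> {}"
  shows "prob_space.indep_vars (PiM I (\<lambda>_. D)) (\<lambda>_. borel) (\<lambda>i x. x i) I"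
proof -
  interpret D: real_distribution D by fact
  interpret prob_space "PiM I (\<lambda>_. D)" by (intro prob_space_PiM D.prob_space_axioms)
  have m: "(\<lambda>x. x i) \<in> borel_measurable (PiM I (\<lambda>_. D))" if "i \<in> I" for i
    using measurable_component_singleton[OF that, of "\<lambda>_. D"] by (simp add: measurable_cong_sets[OF refl D.events_eq_borel])
  have c: "distr (PiM I (\<lambda>_. D)) borel (\<lambda>x. x i) = D" if "i \<in> I" for i
  proof -
    have "distr (PiM I (\<lambda>_. D)) borel (\<lambda>x. x i) = distr (PiM I (\<lambda>_. D)) D (\<lambda>x. x i)"
      by (rule distr_cong) auto
    also have "\<dots> = D" by (rule distr_PiM_component) (use that D.prob_space_axioms in auto)
    finally show ?thesis .
  qed
  have s: "sets (PiM I (\<lambda>_. borel)) = sets (PiM I (\<lambda>_. D))" by (intro sets_PiM_cong) auto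
  show ?thesis
  proof (rule iffD2[OF indep_vars_iff_distr_eq_PiM'])
    show "I \<noteq> {}" by fact
    show "(\<lambda>x. x i) \<in> borel_measurable (PiM I (\<lambda>_. D))" if "i \<in> I" for i by (rule m[OF that])
    have "distr (PiM I (\<lambda>_. D)) (PiM I (\<lambda>_. borel)) (\<lambda>x. \<lambda>i\<in>I. x i) = distr (PiM I (\<lambda>_. D)) (PiM I (\<lambda>_. D)) (\<lambda>x. x)"
      by (rule distr_cong) (auto simp: s space_PiM)
    also have "\<dots> = PiM I (\<lambda>_. D)" by (rule distr_id)
    also have "\<dots> = PiM I (\<lambda>i. distr (PiM I (\<lambda>_. D)) borel (\<lambda>x. x i))"
      by (rule PiM_cong) (simp_all add: c)
    finally show "distr (PiM I (\<lambda>_. D)) (PiM I (\<lambda>_. borel)) (\<lambda>x. \<lambda>i\<in>I. x i) = \<dots>" .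
  qed
qed


lemma real_distribution_sample_mean_law:
  assumes "real_distribution D"
  shows "real_distribution (sample_mean_law D n)"
proof -
  interpret D: real_distribution D by fact
  interpret P: prob_space "PiM {1..n} (\<lambda>_. D)" by (intro prob_space_PiM D.prob_space_axioms)
  have m: "(\<lambda>x. x i) \<in> borel_measurable (PiM {1..n} (\<lambda>_. D))" if "i \<in> {1..n}" for i
    using measurable_component_singleton[OF that, of "\<lambda>_. D"] by (simp add: measurable_cong_sets[OF refl D.events_eq_borel])
  show ?thesis
    unfolding sample_mean_law_def
    by (intro P.real_distribution_distr borel_measurable_divide borel_measurable_sum m) simp_all
qed

lemma char_sample_mean_law:
  assumes D: "real_distribution D" and n: "1 \<le> n"
  shows "char (sample_mean_law D n) t = char D (t / n) ^ n"
proof -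
  interpret D: real_distribution D by fact
  interpret P: prob_space "PiM {1..n} (\<lambda>_. D)" by (intro prob_space_PiM D.prob_space_axioms)
  have ne: "{1..n} \<noteq> {}" using n by simp
  have m: "(\<lambda>x. x i) \<in> borel_measurable (PiM {1..n} (\<lambda>_. D))" if "i \<in> {1..n}" for i
    using measurable_component_singleton[OF that, of "\<lambda>_. D"] by (simp add: measurable_cong_sets[OF refl D.events_eq_borel])
  have ind: "P.indep_vars (\<lambda>_. borel) (\<lambda>i x. x i / n) {1..n}"
    by (rule P.indep_vars_compose2[OF indep_vars_PiM_coordinates[OF D ne]]) simp
  have comp: "char (distr (PiM {1..n} (\<lambda>_. D)) borel (\<lambda>x. x i / n)) t = char D (t / n)" if i: "i \<in> {1..n}" for i
  proof -
    have "distr (PiM {1..n} (\<lambda>_. D)) D (\<lambda>x. x i) = D"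
      by (rule distr_PiM_component) (use i D.prob_space_axioms in auto)
    then have "distr (distr (PiM {1..n} (\<lambda>_. D)) D (\<lambda>x. x i)) borel (\<lambda>u. u / n) = distr D borel (\<lambda>u. u / n)"
      by simp
    then have "distr (PiM {1..n} (\<lambda>_. D)) borel (\<lambda>x. x i / n) = distr D borel (\<lambda>u. u / n)"
      by (subst (asm) distr_distr) (use i in \<open>auto simp: comp_def\<close>)
    then show ?thesis by (simp add: char_def integral_distr)
  qed
  have "char (sample_mean_law D n) t = char (distr (PiM {1..n} (\<lambda>_. D)) borel (\<lambda>x. \<Sum>i\<in>{1..n}. x i / n)) t"
    by (simp add: sample_mean_law_def sum_divide_distrib)
  also have "\<dots> = (\<Prod>i\<in>{1..n}. char D (t / n))"
    unfolding P.char_distr_sum[OF ind] by (rule prod.cong[OF refl comp])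
  finally show ?thesis by simp
qed

text \<open>The difference of the two independent means is the mean of n independent differences.
  Characteristic functions show this without rearranging product spaces: both sides have the n-th
  power of the same function.\<close>

lemma (in prob_space) distr_sample_mean_diff:
  assumes ind: "indep_var borel V borel U" and n: "1 \<le> n"
  shows "distr (sample_mean_law (distr M borel V) n \<Otimes>\<^sub>M sample_mean_law (distr M borel U) n) borel (\<lambda>(v, u). v - u / \<rho>)
    = sample_mean_law (distr M borel (\<lambda>\<omega>. V \<omega> - U \<omega> / \<rho>)) n"
proof -
  let ?D = "distr M borel (\<lambda>\<omega>. V \<omega> - U \<omega> / \<rho>)"
  have [measurable]: "V \<in> borel_measurable M" "U \<in> borel_measurable M"
    using indep_var_rv1[OF ind] indep_var_rv2[OF ind] by auto
  have dV: "real_distribution (distr M borel V)" and dU: "real_distribution (distr M borel U)"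
    and dD: "real_distribution ?D"
    by (intro real_distribution_distr; simp)+
  define SV SU where "SV = sample_mean_law (distr M borel V) n" and "SU = sample_mean_law (distr M borel U) n"
  interpret SV: real_distribution SV unfolding SV_def by (rule real_distribution_sample_mean_law[OF dV])
  interpret SU: real_distribution SU unfolding SU_def by (rule real_distribution_sample_mean_law[OF dU])
  interpret SP: pair_prob_space SV SU by standard
  have charU: "char (distr M borel (\<lambda>\<omega>. - (U \<omega> / \<rho>))) t = char (distr M borel U) (- t / \<rho>)" for t
    by (simp add: char_def integral_distr)
  have ind': "indep_var borel V borel (\<lambda>\<omega>. - (U \<omega> / \<rho>))"
    using indep_var_compose[OF ind, of "\<lambda>x. x" borel "\<lambda>x. - (x / \<rho>)" borel] by (simp add: comp_def)
  have charD: "char ?D t = char (distr M borel V) t * char (distr M borel U) (- t / \<rho>)" for t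
    using char_distr_add[OF ind', of t] by (simp add: charU)
  have "distr (SV \<Otimes>\<^sub>M SU) borel (\<lambda>(v, u). v - u / \<rho>) = sample_mean_law ?D n"
  proof (rule Levy_uniqueness)
    show "real_distribution (distr (SV \<Otimes>\<^sub>M SU) borel (\<lambda>(v, u). v - u / \<rho>))"
      by (rule SP.P.real_distribution_distr) measurable
    show "real_distribution (sample_mean_law ?D n)"
      by (rule real_distribution_sample_mean_law[OF dD])
    show "char (distr (SV \<Otimes>\<^sub>M SU) borel (\<lambda>(v, u). v - u / \<rho>)) = char (sample_mean_law ?D n)"
    proof
      fix t
      have int: "integrable (SV \<Otimes>\<^sub>M SU) (\<lambda>z. iexp (t * fst z) * iexp ((- t / \<rho>) * snd z))"
        by (rule SP.P.integrable_const_bound[where B = 1]) (auto simp: norm_mult)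
      have "char (distr (SV \<Otimes>\<^sub>M SU) borel (\<lambda>(v, u). v - u / \<rho>)) t = (CLINT z|SV \<Otimes>\<^sub>M SU. iexp (t * (fst z - snd z / \<rho>)))"
        unfolding char_def by (subst integral_distr) (auto simp: case_prod_beta)
      also have "\<dots> = (CLINT z|SV \<Otimes>\<^sub>M SU. iexp (t * fst z) * iexp ((- t / \<rho>) * snd z))"
      proof (intro Bochner_Integration.integral_cong refl)
        fix z :: "real \<times> real"
        have "\<i> * complex_of_real (t * (fst z - snd z / \<rho>))
          = \<i> * complex_of_real (t * fst z) + \<i> * complex_of_real ((- t / \<rho>) * snd z)"
          by (simp add: algebra_simps)
        then show "iexp (t * (fst z - snd z / \<rho>)) = iexp (t * fst z) * iexp ((- t / \<rho>) * snd z)"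
          by (simp only: exp_add)
      qed
      also have "\<dots> = (CLINT v|SV. CLINT u|SU. iexp (t * v) * iexp ((- t / \<rho>) * u))"
        using SP.integral_fst'[OF int] by simp
      also have "\<dots> = char SV t * char SU (- t / \<rho>)"
        by (simp add: char_def)
      also have "\<dots> = char (sample_mean_law ?D n) t"
        unfolding SV_def SU_def char_sample_mean_law[OF dV n] char_sample_mean_law[OF dU n] char_sample_mean_law[OF dD n] charD
        by (simp add: power_mult_distrib mult.commute)
      finally show "char (distr (SV \<Otimes>\<^sub>M SU) borel (\<lambda>(v, u). v - u / \<rho>)) t
        = char (sample_mean_law ?D n) t" .
    qed
  qed
  then show ?thesis by (simp add: SV_def SU_def)
qed

lemma (in prob_space) lindley_stationary_waiting_law:
  assumes ind: "indep_var borel V borel U" and n: "1 \<le> n"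
    and L: "stationary_waiting_law (distr M borel V) (distr M borel U) \<rho> n L"
  shows "lindley_stationary (sample_mean_law (distr M borel (\<lambda>\<omega>. V \<omega> - U \<omega> / \<rho>)) n) L"
proof -
  let ?D = "distr M borel (\<lambda>\<omega>. V \<omega> - U \<omega> / \<rho>)"
  have [measurable]: "V \<in> borel_measurable M" "U \<in> borel_measurable M"
    using indep_var_rv1[OF ind] indep_var_rv2[OF ind] by auto
  have dV: "real_distribution (distr M borel V)" and dU: "real_distribution (distr M borel U)"
    and dD: "real_distribution ?D"
    by (intro real_distribution_distr; simp)+
  define SV SU where "SV = sample_mean_law (distr M borel V) n" and "SU = sample_mean_law (distr M borel U) n"
  interpret SV: real_distribution SV unfolding SV_def by (rule real_distribution_sample_mean_law[OF dV])
  interpret SU: real_distribution SU unfolding SU_def by (rule real_distribution_sample_mean_law[OF dU])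
  interpret A: real_distribution "sample_mean_law ?D n"
    by (rule real_distribution_sample_mean_law[OF dD])
  interpret L: real_distribution L
    using L sets_eq_imp_space_eq[of L borel]
    by (simp add: stationary_waiting_law_def real_distribution_def real_distribution_axioms_def)
  have diff: "distr (SV \<Otimes>\<^sub>M SU) borel (\<lambda>(v, u). v - u / \<rho>)
      = sample_mean_law ?D n"
    unfolding SV_def SU_def by (rule distr_sample_mean_diff[OF ind n])
  have "L = distr (L \<Otimes>\<^sub>M (SV \<Otimes>\<^sub>M SU)) borel (\<lambda>(w, v, u). max 0 (w + v - u / \<rho>))"
    using L by (simp add: stationary_waiting_law_def SV_def SU_def)
  also have "\<dots> = distr (distr (L \<Otimes>\<^sub>M (SV \<Otimes>\<^sub>M SU)) (borel \<Otimes>\<^sub>M borel) (\<lambda>(w, z). (w, (\<lambda>(v, u). v - u / \<rho>) z))) borel (\<lambda>(w, x). max 0 (w + x))"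
    by (subst distr_distr) (auto intro!: distr_cong simp: case_prod_beta add_diff_eq)
  also have "distr (L \<Otimes>\<^sub>M (SV \<Otimes>\<^sub>M SU)) (borel \<Otimes>\<^sub>M borel) (\<lambda>(w, z). (w, (\<lambda>(v, u). v - u / \<rho>) z))
    = distr L borel (\<lambda>w. w) \<Otimes>\<^sub>M distr (SV \<Otimes>\<^sub>M SU) borel (\<lambda>(v, u). v - u / \<rho>)"
    by (subst pair_measure_distr)
       (auto simp: diff intro: A.sigma_finite_measure_axioms)
  also have "distr L borel (\<lambda>w. w) = L"
    by (rule distr_id2) simp
  finally show ?thesis
    unfolding diff
    by (simp add: lindley_stationary_def A.real_distribution_axioms L.real_distribution_axioms)
qed

section \<open>Cumulants and the saddle point\<close>

lemma abs_exp_taylor2_le: "\<bar>exp x - 1 - x\<bar> \<le> x\<^sup>2 * exp \<bar>x\<bar>" for x :: real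
proof -
  obtain t where t: "\<bar>t\<bar> \<le> \<bar>x\<bar>" "exp x = (\<Sum>m<2. x ^ m / fact m) + exp t / fact 2 * x ^ 2"
    using Maclaurin_exp_le[of x 2] by blast
  then have eq: "exp x - 1 - x = exp t / 2 * x\<^sup>2" by (simp add: numeral_2_eq_2)
  have "\<bar>exp x - 1 - x\<bar> = exp t / 2 * x\<^sup>2" unfolding eq by (simp add: abs_mult)
  also have "\<dots> \<le> exp \<bar>x\<bar> * x\<^sup>2"
  proof (rule mult_right_mono)
    have "exp t / 2 \<le> exp t" by simp
    also have "exp t \<le> exp \<bar>x\<bar>" using t(1) by simp
    finally show "exp t / 2 \<le> exp \<bar>x\<bar>" .
  qed simp
  finally show ?thesis by (simp add: mult.commute)
qed

text \<open>Reduces differentiation under an expectation to a Taylor bound of second order, which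
  can be integrated pointwise.\<close>

lemma DERIV_if_quadratic_error:
  fixes f :: "real \<Rightarrow> real"
  assumes "0 < e" and *: "\<And>h. \<bar>h\<bar> < e \<Longrightarrow> \<bar>f (s + h) - f s - h * d\<bar> \<le> C * h\<^sup>2"
  shows "(f has_real_derivative d) (at s)"
  unfolding DERIV_def
proof (rule Lim_transform)
  show "(\<lambda>h. d) \<midarrow>0\<rightarrow> d" by simp
  show "((\<lambda>h. (f (s + h) - f s) / h - d) \<longlongrightarrow> 0) (at 0)"
  proof (rule Lim_null_comparison)
    have "norm ((f (s + h) - f s) / h - d) \<le> C * \<bar>h\<bar>" if h: "h \<noteq> 0" "\<bar>h\<bar> < e" for h
    proof -
      have "(f (s + h) - f s) / h - d = (f (s + h) - f s - h * d) / h"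
        using h by (simp add: diff_divide_distrib)
      then have "norm ((f (s + h) - f s) / h - d) = \<bar>f (s + h) - f s - h * d\<bar> / \<bar>h\<bar>"
        by (simp only: real_norm_def abs_divide)
      also have "\<dots> \<le> C * h\<^sup>2 / \<bar>h\<bar>"
        by (rule divide_right_mono[OF *[OF h(2)]]) simp
      also have "C * h\<^sup>2 / \<bar>h\<bar> = C * \<bar>h\<bar>"
        unfolding power2_abs[of h, symmetric] using h(1) by (simp add: power2_eq_square del: abs_mult_self_eq)
      finally show ?thesis .
    qed
    then show "\<forall>\<^sub>F h in at 0. norm ((f (s + h) - f s) / h - d) \<le> C * \<bar>h\<bar>"
      unfolding eventually_at using assms(1) by (intro exI[of _ e]) (simp add: dist_real_def)
    show "((\<lambda>h. C * \<bar>h\<bar>) \<longlongrightarrow> 0) (at 0)"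
      by (intro tendsto_mult_right_zero tendsto_rabs_zero tendsto_ident_at)
  qed
qed

lemma power_mult_exp_le:
  fixes x c d :: real
  assumes "c < d" shows "\<bar>x\<bar> ^ j * exp (c * \<bar>x\<bar>) \<le> fact j / (d - c) ^ j * exp (d * \<bar>x\<bar>)"
proof -
  have "\<bar>x\<bar> ^ j * exp (c * \<bar>x\<bar>) \<le> fact j / (d - c) ^ j * exp ((d - c) * \<bar>x\<bar>) * exp (c * \<bar>x\<bar>)"
    using assms by (intro mult_right_mono power_le_fact_exp) auto
  also have "\<dots> = fact j / (d - c) ^ j * exp (d * \<bar>x\<bar>)"
    by (simp add: mult.assoc mult_exp_exp left_diff_distrib)
  finally show ?thesis .
qed

section \<open>Exponential moments and cumulants under a common dominating variable\<close>

context prob_space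
begin

definition exp_moment :: "('a \<Rightarrow> real) \<Rightarrow> nat \<Rightarrow> real \<Rightarrow> real" where
  "exp_moment X j s = expectation (\<lambda>\<omega>. X \<omega> ^ j * exp (s * X \<omega>))"

lemma integrable_power_exp_abs:
  fixes Q :: "'a \<Rightarrow> real"
  assumes [measurable]: "Q \<in> borel_measurable M" and int: "integrable M (\<lambda>\<omega>. exp (c * \<bar>Q \<omega>\<bar>))" and "d < c"
  shows "integrable M (\<lambda>\<omega>. \<bar>Q \<omega>\<bar> ^ j * exp (d * \<bar>Q \<omega>\<bar>))"
proof (rule Bochner_Integration.integrable_bound[OF integrable_mult_right[OF int, of "fact j / (c - d) ^ j"]])
  show "AE \<omega> in M. norm (\<bar>Q \<omega>\<bar> ^ j * exp (d * \<bar>Q \<omega>\<bar>)) \<le> norm (fact j / (c - d) ^ j * exp (c * \<bar>Q \<omega>\<bar>))"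
    using power_mult_exp_le[OF \<open>d < c\<close>] \<open>d < c\<close> by (simp add: abs_mult)
qed simp

lemma abs_power_exp_le:
  fixes x q s d :: real
  assumes "\<bar>x\<bar> \<le> \<bar>q\<bar>" "\<bar>s\<bar> \<le> d"
  shows "\<bar>x ^ j * exp (s * x)\<bar> \<le> \<bar>q\<bar> ^ j * exp (d * \<bar>q\<bar>)"
proof -
  have "s * x \<le> \<bar>s\<bar> * \<bar>x\<bar>" by (metis abs_ge_self abs_mult)
  also have "\<dots> \<le> d * \<bar>q\<bar>" using assms by (intro mult_mono) auto
  finally show ?thesis
    using assms by (simp add: abs_mult power_abs) (intro mult_mono power_mono; simp)
qed

text \<open>The variable \<open>Q\<close> is meant to dominate the centred increments for all
  traffic intensities at once; bounds in terms of \<open>Q\<close> are therefore uniform in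
  n.\<close>

lemma integrable_exp_moment:
  fixes Q :: "'a \<Rightarrow> real"
  assumes [measurable]: "X \<in> borel_measurable M" "Q \<in> borel_measurable M"
    and int: "integrable M (\<lambda>\<omega>. exp (c * \<bar>Q \<omega>\<bar>))" and le: "\<And>\<omega>. \<bar>X \<omega>\<bar> \<le> \<bar>Q \<omega>\<bar>" and s: "\<bar>s\<bar> < c"
  shows "integrable M (\<lambda>\<omega>. X \<omega> ^ j * exp (s * X \<omega>))"
proof (rule Bochner_Integration.integrable_bound[OF integrable_power_exp_abs[OF assms(2) int s, of j]])
  show "AE \<omega> in M. norm (X \<omega> ^ j * exp (s * X \<omega>)) \<le> norm (\<bar>Q \<omega>\<bar> ^ j * exp (\<bar>s\<bar> * \<bar>Q \<omega>\<bar>))"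
    using abs_power_exp_le[OF le order_refl] by (intro AE_I2) simp
qed simp

lemma abs_exp_moment_le:
  fixes Q :: "'a \<Rightarrow> real"
  assumes [measurable]: "X \<in> borel_measurable M" "Q \<in> borel_measurable M"
    and int: "integrable M (\<lambda>\<omega>. exp (c * \<bar>Q \<omega>\<bar>))" and le: "\<And>\<omega>. \<bar>X \<omega>\<bar> \<le> \<bar>Q \<omega>\<bar>" and s: "\<bar>s\<bar> \<le> d" "d < c"
  shows "\<bar>exp_moment X j s\<bar> \<le> expectation (\<lambda>\<omega>. \<bar>Q \<omega>\<bar> ^ j * exp (d * \<bar>Q \<omega>\<bar>))"
proof -
  have "\<bar>exp_moment X j s\<bar> \<le> expectation (\<lambda>\<omega>. \<bar>X \<omega> ^ j * exp (s * X \<omega>)\<bar>)"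
    unfolding exp_moment_def by (rule integral_abs_bound)
  also have "\<dots> \<le> expectation (\<lambda>\<omega>. \<bar>Q \<omega>\<bar> ^ j * exp (d * \<bar>Q \<omega>\<bar>))"
    using s by (intro integral_mono integrable_abs integrable_exp_moment[OF assms(1,2) int le]
        integrable_power_exp_abs[OF assms(2) int] abs_power_exp_le le) auto
  finally show ?thesis .
qed

text \<open>The Taylor remainder of exp (h * x) is at most h^2 x^2 exp |h * x|. The square only
  raises the power of \<open>X\<close> by 2, and the last factor is absorbed by a slightly larger
  exponent, for which the moment is still finite.\<close>

lemma has_real_derivative_exp_moment:
  assumes [measurable]: "X \<in> borel_measurable M" and int: "integrable M (\<lambda>\<omega>. exp (c * \<bar>X \<omega>\<bar>))" and s: "\<bar>s\<bar> < c"
  shows "(exp_moment X j has_real_derivative exp_moment X (Suc j) s) (at s)"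
proof -
  \<comment> \<open>Half of the room between |s| and c, so that the enlarged exponent remains
    strictly below c and leaves space for the polynomial factor.\<close>
  define e where "e = (c - \<bar>s\<bar>) / 2"
  have e: "0 < e" "\<bar>s\<bar> + e < c" using s by (auto simp: e_def field_simps)
  define C where "C = expectation (\<lambda>\<omega>. \<bar>X \<omega>\<bar> ^ (j + 2) * exp ((\<bar>s\<bar> + e) * \<bar>X \<omega>\<bar>))"
  have ii: "integrable M (\<lambda>\<omega>. X \<omega> ^ i * exp (r * X \<omega>))" if "\<bar>r\<bar> < c" for i r
    using integrable_exp_moment[OF assms(1,1) int order_refl that] .
  show ?thesis
  proof (rule DERIV_if_quadratic_error[OF e(1)])
    fix h :: real assume h: "\<bar>h\<bar> < e"
    then have sh: "\<bar>s + h\<bar> < c" using e by linarith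
    have pw: "\<bar>X \<omega> ^ j * exp ((s + h) * X \<omega>) - X \<omega> ^ j * exp (s * X \<omega>) - h * (X \<omega> ^ Suc j * exp (s * X \<omega>))\<bar>
      \<le> h\<^sup>2 * (\<bar>X \<omega>\<bar> ^ (j + 2) * exp ((\<bar>s\<bar> + e) * \<bar>X \<omega>\<bar>))" for \<omega>
    proof -
      let ?x = "X \<omega>"
      have "?x ^ j * exp ((s + h) * ?x) - ?x ^ j * exp (s * ?x) - h * (?x ^ Suc j * exp (s * ?x))
        = ?x ^ j * exp (s * ?x) * (exp (h * ?x) - 1 - h * ?x)"
        by (simp add: distrib_right exp_add algebra_simps)
      then have "\<bar>?x ^ j * exp ((s + h) * ?x) - ?x ^ j * exp (s * ?x) - h * (?x ^ Suc j * exp (s * ?x))\<bar>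
        = \<bar>?x\<bar> ^ j * exp (s * ?x) * \<bar>exp (h * ?x) - 1 - h * ?x\<bar>"
        by (simp add: abs_mult power_abs)
      also have "\<dots> \<le> \<bar>?x\<bar> ^ j * exp (\<bar>s\<bar> * \<bar>?x\<bar>) * ((h * ?x)\<^sup>2 * exp (e * \<bar>?x\<bar>))"
      proof (intro mult_mono)
        show "exp (s * ?x) \<le> exp (\<bar>s\<bar> * \<bar>?x\<bar>)" by (simp add: abs_mult[symmetric])
        have "exp \<bar>h * ?x\<bar> \<le> exp (e * \<bar>?x\<bar>)" using h by (simp add: abs_mult mult_right_mono)
        then show "\<bar>exp (h * ?x) - 1 - h * ?x\<bar> \<le> (h * ?x)\<^sup>2 * exp (e * \<bar>?x\<bar>)"
          by (intro order_trans[OF abs_exp_taylor2_le] mult_left_mono) auto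
      qed auto
      also have "\<dots> = h\<^sup>2 * (\<bar>?x\<bar> ^ (j + 2) * (exp (\<bar>s\<bar> * \<bar>?x\<bar>) * exp (e * \<bar>?x\<bar>)))"
        by (simp add: power_mult_distrib power_add power2_eq_square mult_ac)
      finally show ?thesis by (simp add: mult_exp_exp distrib_right)
    qed
    have eq: "exp_moment X j (s + h) - exp_moment X j s - h * exp_moment X (Suc j) s
      = expectation (\<lambda>\<omega>. X \<omega> ^ j * exp ((s + h) * X \<omega>) - X \<omega> ^ j * exp (s * X \<omega>) - h * (X \<omega> ^ Suc j * exp (s * X \<omega>)))"
      unfolding exp_moment_def using ii[OF sh, of j] ii[OF s, of j] ii[OF s, of "Suc j"]
      by (simp del: power_Suc)
    have "\<bar>exp_moment X j (s + h) - exp_moment X j s - h * exp_moment X (Suc j) s\<bar>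
        \<le> expectation (\<lambda>\<omega>. \<bar>X \<omega> ^ j * exp ((s + h) * X \<omega>) - X \<omega> ^ j * exp (s * X \<omega>) - h * (X \<omega> ^ Suc j * exp (s * X \<omega>))\<bar>)"
      unfolding eq by (rule integral_abs_bound)
    also have "expectation (\<lambda>\<omega>. \<bar>X \<omega> ^ j * exp ((s + h) * X \<omega>) - X \<omega> ^ j * exp (s * X \<omega>) - h * (X \<omega> ^ Suc j * exp (s * X \<omega>))\<bar>)
        \<le> expectation (\<lambda>\<omega>. h\<^sup>2 * (\<bar>X \<omega>\<bar> ^ (j + 2) * exp ((\<bar>s\<bar> + e) * \<bar>X \<omega>\<bar>)))"
    proof (rule integral_mono[OF _ _ pw])
      show "integrable M (\<lambda>\<omega>. \<bar>X \<omega> ^ j * exp ((s + h) * X \<omega>) - X \<omega> ^ j * exp (s * X \<omega>) - h * (X \<omega> ^ Suc j * exp (s * X \<omega>))\<bar>)"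
        by (rule integrable_abs[OF Bochner_Integration.integrable_diff[OF Bochner_Integration.integrable_diff[OF
              ii[OF sh, of j] ii[OF s, of j]] integrable_mult_right[OF ii[OF s, of "Suc j"], of h]]])
      show "integrable M (\<lambda>\<omega>. h\<^sup>2 * (\<bar>X \<omega>\<bar> ^ (j + 2) * exp ((\<bar>s\<bar> + e) * \<bar>X \<omega>\<bar>)))"
        by (rule integrable_mult_right[OF integrable_power_exp_abs[OF assms(1) int e(2), of "j + 2"]])
    qed
    finally show "\<bar>exp_moment X j (s + h) - exp_moment X j s - h * exp_moment X (Suc j) s\<bar> \<le> C * h\<^sup>2"
      by (simp add: C_def mult.commute)
  qed
qed

text \<open>The first three derivatives of the cumulant generating function at s: the mean, the
  variance and the third central moment of \<open>X\<close> under the exponentially tilted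
  law.\<close>

definition cumulant1 :: "('a \<Rightarrow> real) \<Rightarrow> real \<Rightarrow> real" where
  "cumulant1 X s = exp_moment X 1 s / exp_moment X 0 s"

definition cumulant2 :: "('a \<Rightarrow> real) \<Rightarrow> real \<Rightarrow> real" where
  "cumulant2 X s = exp_moment X 2 s / exp_moment X 0 s - (exp_moment X 1 s / exp_moment X 0 s)\<^sup>2"

definition cumulant3 :: "('a \<Rightarrow> real) \<Rightarrow> real \<Rightarrow> real" where
  "cumulant3 X s = exp_moment X 3 s / exp_moment X 0 s
    - 3 * (exp_moment X 1 s / exp_moment X 0 s) * (exp_moment X 2 s / exp_moment X 0 s)
    + 2 * (exp_moment X 1 s / exp_moment X 0 s) ^ 3"

text \<open>Integrating 1 + x \<le> exp x for a centred variable. It keeps the denominators of the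
  cumulants away from 0 by a constant that is the same for all variables.\<close>

lemma exp_moment_0_ge_1:
  assumes [measurable]: "X \<in> borel_measurable M" and int: "integrable M (\<lambda>\<omega>. exp (c * \<bar>X \<omega>\<bar>))"
    and s: "\<bar>s\<bar> < c" and mean: "expectation X = 0"
  shows "1 \<le> exp_moment X 0 s"
proof -
  have i: "integrable M X"
    using integrable_exp_moment[OF assms(1,1) int order_refl, of 0 1] s by simp
  have "1 = expectation (\<lambda>\<omega>. 1 + s * X \<omega>)"
    using i by (simp add: mean prob_space)
  also have "\<dots> \<le> exp_moment X 0 s"
    unfolding exp_moment_def using i integrable_exp_moment[OF assms(1,1) int order_refl s, of 0]
    by (intro integral_mono) auto
  finally show ?thesis .
qed

lemma has_real_derivative_cumulants:
  assumes X[measurable]: "X \<in> borel_measurable M" and int: "integrable M (\<lambda>\<omega>. exp (c * \<bar>X \<omega>\<bar>))"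
    and s: "\<bar>s\<bar> < c" and mean: "expectation X = 0"
  shows "((\<lambda>s. ln (exp_moment X 0 s)) has_real_derivative cumulant1 X s) (at s)"
    and "(cumulant1 X has_real_derivative cumulant2 X s) (at s)"
    and "(cumulant2 X has_real_derivative cumulant3 X s) (at s)"
proof -
  have p: "0 < exp_moment X 0 s" using exp_moment_0_ge_1[OF assms] by simp
  note d = has_real_derivative_exp_moment[OF X int s]
  have d0: "(exp_moment X 0 has_real_derivative exp_moment X 1 s) (at s)" using d[of 0] by simp
  have d1: "(exp_moment X 1 has_real_derivative exp_moment X 2 s) (at s)" using d[of 1] by (simp add: numeral_2_eq_2)
  have d2: "(exp_moment X 2 has_real_derivative exp_moment X 3 s) (at s)" using d[of 2] by (simp add: numeral_3_eq_3 numeral_2_eq_2)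
  show "((\<lambda>s. ln (exp_moment X 0 s)) has_real_derivative cumulant1 X s) (at s)"
    unfolding cumulant1_def by (rule derivative_eq_intros d0 p refl)+ simp
  have r1: "((\<lambda>s. exp_moment X 1 s / exp_moment X 0 s) has_real_derivative
      exp_moment X 2 s / exp_moment X 0 s - (exp_moment X 1 s / exp_moment X 0 s)\<^sup>2) (at s)"
    using p by (intro DERIV_cong[OF DERIV_divide[OF d1 d0]]) (simp_all add: field_simps power2_eq_square)
  then show "(cumulant1 X has_real_derivative cumulant2 X s) (at s)"
    unfolding cumulant1_def[abs_def] cumulant2_def .
  have r2: "((\<lambda>s. exp_moment X 2 s / exp_moment X 0 s) has_real_derivative
      exp_moment X 3 s / exp_moment X 0 s - exp_moment X 2 s / exp_moment X 0 s * (exp_moment X 1 s / exp_moment X 0 s)) (at s)"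
    using p by (intro DERIV_cong[OF DERIV_divide[OF d2 d0]]) (simp_all add: field_simps power2_eq_square)
  show "(cumulant2 X has_real_derivative cumulant3 X s) (at s)"
    unfolding cumulant2_def[abs_def] cumulant3_def
    by (rule DERIV_cong[OF DERIV_diff[OF r2 DERIV_power[OF r1, of 2]]])
       (simp add: power2_eq_square power3_eq_cube algebra_simps)
qed

lemma cumulants_0:
  assumes "expectation X = 0"
  shows "ln (exp_moment X 0 0) = 0" "cumulant1 X 0 = 0" "cumulant2 X 0 = expectation (\<lambda>\<omega>. (X \<omega>)\<^sup>2)"
  using assms by (simp_all add: cumulant1_def cumulant2_def exp_moment_def prob_space)

lemma cumulant_bounds:
  assumes X: "X \<in> borel_measurable M" and Q: "Q \<in> borel_measurable M"
    and int: "integrable M (\<lambda>\<omega>. exp (c * \<bar>Q \<omega>\<bar>))" and le: "\<And>\<omega>. \<bar>X \<omega>\<bar> \<le> \<bar>Q \<omega>\<bar>"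
    and mean: "expectation X = 0" and s: "\<bar>s\<bar> \<le> d" "d < c"
  defines "C \<equiv> \<lambda>j. expectation (\<lambda>\<omega>. \<bar>Q \<omega>\<bar> ^ j * exp (d * \<bar>Q \<omega>\<bar>))"
  shows "cumulant2 X s \<le> C 2" "\<bar>cumulant3 X s\<bar> \<le> C 3 + 3 * C 1 * C 2 + 2 * C 1 ^ 3"
proof -
  have intX: "integrable M (\<lambda>\<omega>. exp (c * \<bar>X \<omega>\<bar>))"
  proof (rule Bochner_Integration.integrable_bound[OF int])
    show "AE \<omega> in M. norm (exp (c * \<bar>X \<omega>\<bar>)) \<le> norm (exp (c * \<bar>Q \<omega>\<bar>))"
      using s le by (auto intro!: mult_left_mono)
  qed (use X in measurable)
  have p: "1 \<le> exp_moment X 0 s" by (rule exp_moment_0_ge_1[OF X intX _ mean]) (use s in linarith)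
  have C: "0 \<le> C j" for j unfolding C_def by (intro integral_nonneg_AE) simp
  have b: "\<bar>exp_moment X j s / exp_moment X 0 s\<bar> \<le> C j" for j
  proof -
    have "\<bar>exp_moment X j s / exp_moment X 0 s\<bar> = \<bar>exp_moment X j s\<bar> / exp_moment X 0 s" using p by simp
    also have "\<dots> \<le> \<bar>exp_moment X j s\<bar> / 1" using p by (intro divide_left_mono) auto
    also have "\<dots> \<le> C j" unfolding C_def using abs_exp_moment_le[OF X Q int le s] by simp
    finally show ?thesis .
  qed
  show "cumulant2 X s \<le> C 2"
    using b[of 2] zero_le_power2[of "exp_moment X 1 s / exp_moment X 0 s"] unfolding cumulant2_def by linarith
  define r1 r2 r3 where "r1 = exp_moment X 1 s / exp_moment X 0 s" and "r2 = exp_moment X 2 s / exp_moment X 0 s"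
    and "r3 = exp_moment X 3 s / exp_moment X 0 s"
  have "\<bar>r3 - 3 * r1 * r2 + 2 * r1 ^ 3\<bar> \<le> \<bar>r3\<bar> + 3 * (\<bar>r1\<bar> * \<bar>r2\<bar>) + 2 * \<bar>r1\<bar> ^ 3"
    using abs_triangle_ineq[of "r3 - 3 * r1 * r2" "2 * r1 ^ 3"] abs_triangle_ineq4[of r3 "3 * r1 * r2"]
    by (simp add: abs_mult power_abs)
  also have "\<dots> \<le> C 3 + 3 * (C 1 * C 2) + 2 * C 1 ^ 3"
    using b[of 1] b[of 2] b[of 3] C unfolding r1_def r2_def r3_def
    by (intro add_mono mult_left_mono mult_mono power_mono) auto
  finally show "\<bar>cumulant3 X s\<bar> \<le> C 3 + 3 * C 1 * C 2 + 2 * C 1 ^ 3"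
    unfolding cumulant3_def r1_def r2_def r3_def by (simp add: mult.assoc)
qed

lemma cumulant2_diff_le:
  assumes X: "X \<in> borel_measurable M" and Q: "Q \<in> borel_measurable M"
    and int: "integrable M (\<lambda>\<omega>. exp (c * \<bar>Q \<omega>\<bar>))" and le: "\<And>\<omega>. \<bar>X \<omega>\<bar> \<le> \<bar>Q \<omega>\<bar>"
    and mean: "expectation X = 0" and s: "\<bar>s\<bar> \<le> d" "d < c"
  defines "C \<equiv> \<lambda>j. expectation (\<lambda>\<omega>. \<bar>Q \<omega>\<bar> ^ j * exp (d * \<bar>Q \<omega>\<bar>))"
  shows "\<bar>cumulant2 X s - expectation (\<lambda>\<omega>. (X \<omega>)\<^sup>2)\<bar> \<le> (C 3 + 3 * C 1 * C 2 + 2 * C 1 ^ 3) * \<bar>s\<bar>"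
proof -
  have intX: "integrable M (\<lambda>\<omega>. exp (c * \<bar>X \<omega>\<bar>))"
  proof (rule Bochner_Integration.integrable_bound[OF int])
    show "AE \<omega> in M. norm (exp (c * \<bar>X \<omega>\<bar>)) \<le> norm (exp (c * \<bar>Q \<omega>\<bar>))"
      using s le by (auto intro!: mult_left_mono)
  qed (use X in measurable)
  have "norm (cumulant2 X s - cumulant2 X 0) \<le> (C 3 + 3 * C 1 * C 2 + 2 * C 1 ^ 3) * norm (s - 0)"
  proof (rule field_differentiable_bound[where S = "{-d..d}" and f = "cumulant2 X" and f' = "cumulant3 X"])
    fix z assume "z \<in> {-d..d}"
    then have z: "\<bar>z\<bar> \<le> d" by auto
    show "(cumulant2 X has_field_derivative cumulant3 X z) (at z within {-d..d})"
      by (rule has_field_derivative_at_within, rule has_real_derivative_cumulants[OF X intX _ mean]) (use z s in linarith)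
    show "norm (cumulant3 X z) \<le> C 3 + 3 * C 1 * C 2 + 2 * C 1 ^ 3"
      using cumulant_bounds(2)[OF X Q int le mean z s(2)] unfolding C_def by simp
  next
    show "s \<in> {-d..d}" "0 \<in> {-d..d}" using s by auto
  qed (rule convex_real_interval)
  then show ?thesis unfolding cumulants_0(3)[OF mean] by (simp only: real_norm_def diff_zero)
qed

end


text \<open>Here \<open>k\<close> is the cumulant generating function of a centred variable and \<open>\<mu>\<close> the negative drift;
  the saddle point \<open>- s\<close> solves \<open>k' s = \<mu>\<close>.\<close>

lemma saddle_point_analysis:
  fixes h k k1 k2 :: "real \<Rightarrow> real"
  assumes h: "\<And>\<zeta>. \<bar>\<zeta>\<bar> < c \<Longrightarrow> h \<zeta> = \<mu> * \<zeta> + k (- \<zeta>)"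
    and d1: "\<And>s. \<bar>s\<bar> < c \<Longrightarrow> (k has_real_derivative k1 s) (at s)"
    and d2: "\<And>s. \<bar>s\<bar> < c \<Longrightarrow> (k1 has_real_derivative k2 s) (at s)"
    and k2: "\<And>s. \<bar>s\<bar> \<le> \<delta> \<Longrightarrow> \<bar>k2 s - v\<bar> \<le> K * \<bar>s\<bar>"
    and k1: "k1 0 = 0" and \<delta>: "0 < \<delta>" "\<delta> < c" "K * \<delta> \<le> v / 2" and K: "0 \<le> K" and v: "0 < v"
    and \<mu>: "0 < \<mu>" "\<mu> < v / 2 * \<delta>"
  obtains s where "0 < s" "s \<le> \<delta>" "s \<le> 2 * \<mu> / v" "v / 2 \<le> k2 s" "k2 s \<le> 2 * v" "\<bar>\<mu> - s * k2 s\<bar> \<le> 2 * K * s\<^sup>2"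
    "\<exists>!\<zeta>. is_saddle_point h \<delta> \<zeta>" "saddle_point h \<delta> = - s" "saddle_sigma h \<delta> = sqrt (k2 s)"
proof -
  \<comment> \<open>A quantitative form of convexity: on the whole interval the second derivative
    stays between two positive multiples of \<open>v\<close>.\<close>
  have k2_ge: "v / 2 \<le> k2 s" and k2_le: "k2 s \<le> 2 * v" if "\<bar>s\<bar> \<le> \<delta>" for s
  proof -
    have "K * \<bar>s\<bar> \<le> v / 2" using mult_left_mono[OF that K] \<delta> by linarith
    then show "v / 2 \<le> k2 s" "k2 s \<le> 2 * v" using k2[OF that] v by linarith+
  qed
  have mvt: "\<exists>z. x < z \<and> z < y \<and> k1 y - k1 x = (y - x) * k2 z" if "x < y" "0 \<le> x" "y \<le> \<delta>" for x y
    by (rule MVT2[OF that(1)]) (use that \<delta> in \<open>auto intro!: d2\<close>)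
  have mono: "k1 x < k1 y" if xy: "x < y" "0 \<le> x" "y \<le> \<delta>" for x y
  proof -
    obtain z where z: "x < z" "z < y" "k1 y - k1 x = (y - x) * k2 z" using mvt[OF xy] by blast
    have "0 < k2 z" using k2_ge[of z] z xy v by auto
    then have "0 < (y - x) * k2 z" using xy by simp
    then show ?thesis using z by simp
  qed
  \<comment> \<open>At the right end of the interval \<open>k1\<close> is at least v * \<delta> / 2,
    which exceeds \<mu>; the intermediate value theorem yields s, and strict monotonicity will make
    it unique.\<close>
  obtain s where s: "0 < s" "s \<le> \<delta>" "k1 s = \<mu>"
  proof -
    obtain z where z: "0 < z" "z < \<delta>" "k1 \<delta> - k1 0 = (\<delta> - 0) * k2 z" using mvt[OF \<delta>(1)] by auto
    have "\<delta> * (v / 2) \<le> \<delta> * k2 z" using z \<delta> by (intro mult_left_mono k2_ge) auto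
    moreover have "k1 \<delta> = \<delta> * k2 z" using z k1 by simp
    moreover have "v / 2 * \<delta> = \<delta> * (v / 2)" by simp
    ultimately have le: "\<mu> \<le> k1 \<delta>" using \<mu> by linarith
    have cont: "continuous_on {0..\<delta>} k1"
    proof (intro continuous_at_imp_continuous_on ballI)
      fix x assume "x \<in> {0..\<delta>}"
      then show "isCont k1 x" using \<delta> by (intro DERIV_isCont[OF d2]) auto
    qed
    obtain s where "0 \<le> s" "s \<le> \<delta>" "k1 s = \<mu>"
      using IVT'[OF _ le _ cont] \<mu> \<delta> k1 by auto
    moreover have "s \<noteq> 0" using \<open>k1 s = \<mu>\<close> k1 \<mu> by auto
    ultimately show thesis by (intro that[of s]) auto
  qed
  have dh: "(h has_real_derivative \<mu> - k1 (- \<zeta>)) (at \<zeta>)" if "\<bar>\<zeta>\<bar> < c" for \<zeta>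
  proof -
    have "((\<lambda>\<zeta>. k (- \<zeta>)) has_real_derivative k1 (- \<zeta>) * - 1) (at \<zeta>)"
      by (rule DERIV_chain2[OF d1]) (use that in \<open>auto intro!: derivative_eq_intros\<close>)
    then have "((\<lambda>\<zeta>. \<mu> * \<zeta> + k (- \<zeta>)) has_real_derivative \<mu> - k1 (- \<zeta>)) (at \<zeta>)"
      by (auto intro!: derivative_eq_intros)
    then show ?thesis
      by (rule has_field_derivative_transform_within_open[where S = "{-c<..<c}"]) (use that h in auto)
  qed
  have sp_iff: "is_saddle_point h \<delta> \<zeta> \<longleftrightarrow> \<zeta> = - s" for \<zeta>
  proof
    assume "is_saddle_point h \<delta> \<zeta>"
    then have \<zeta>: "- \<delta> \<le> \<zeta>" "\<zeta> \<le> 0" "(h has_real_derivative 0) (at \<zeta>)" by (auto simp: is_saddle_point_def)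
    then have "k1 (- \<zeta>) = \<mu>" using DERIV_unique[OF dh \<zeta>(3)] \<delta> by auto
    then show "\<zeta> = - s" using mono[of s "- \<zeta>"] mono[of "- \<zeta>" s] s \<zeta> by (cases s "- \<zeta>" rule: linorder_cases) auto
  next
    assume "\<zeta> = - s"
    then show "is_saddle_point h \<delta> \<zeta>" using dh[of "- s"] s \<delta> by (simp add: is_saddle_point_def)
  qed
  then have ex: "\<exists>!\<zeta>. is_saddle_point h \<delta> \<zeta>" and sp: "saddle_point h \<delta> = - s"
    by (auto simp: saddle_point_def)
  have "(deriv h has_real_derivative k2 s) (at (- s))"
  proof -
    have "((\<lambda>\<zeta>. k1 (- \<zeta>)) has_real_derivative k2 (- (- s)) * - 1) (at (- s))"
      by (rule DERIV_chain2[OF d2]) (use s \<delta> in \<open>auto intro!: derivative_eq_intros\<close>)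
    then have "((\<lambda>\<zeta>. \<mu> - k1 (- \<zeta>)) has_real_derivative k2 s) (at (- s))"
      by (auto intro!: derivative_eq_intros)
    then show ?thesis
      by (rule has_field_derivative_transform_within_open[where S = "{-c<..<c}"])
         (use s(1,2) \<delta>(2) DERIV_imp_deriv[OF dh] in \<open>auto simp: abs_less_iff\<close>)
  qed
  then have sigma: "saddle_sigma h \<delta> = sqrt (k2 s)"
    by (simp add: saddle_sigma_def sp DERIV_imp_deriv)
  \<comment> \<open>The saddle point equation now reads \<mu> = s * k2 z with z between 0 and s. The
    lower bound on \<open>k2\<close> gives the size of s, and comparing \<open>k2\<close> at z and
    at s through their distances to \<open>v\<close> gives the quadratic error.\<close>
  obtain z where z: "0 < z" "z < s" "k1 s - k1 0 = (s - 0) * k2 z" using mvt[OF s(1)] s by auto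
  have \<mu>_eq: "\<mu> = s * k2 z" using z s k1 by simp
  have "s * (v / 2) \<le> s * k2 z" using s z by (intro mult_left_mono k2_ge) auto
  then have s_le: "s \<le> 2 * \<mu> / v" using \<mu>_eq v by (simp add: field_simps)
  have "\<bar>k2 z - k2 s\<bar> \<le> 2 * K * s"
  proof -
    have "K * \<bar>z\<bar> \<le> K * s" using z K by (intro mult_left_mono) auto
    then show ?thesis using k2[of z] k2[of s] z s by simp
  qed
  then have "s * \<bar>k2 z - k2 s\<bar> \<le> s * (2 * K * s)" using s by (intro mult_left_mono) auto
  moreover have "\<bar>\<mu> - s * k2 s\<bar> = s * \<bar>k2 z - k2 s\<bar>"
    using s by (simp add: \<mu>_eq right_diff_distrib[symmetric] abs_mult)
  ultimately have e: "\<bar>\<mu> - s * k2 s\<bar> \<le> 2 * K * s\<^sup>2" by (simp add: power2_eq_square mult_ac)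
  have "\<bar>s\<bar> \<le> \<delta>" using s by simp
  from that[OF s(1) s(2) s_le k2_ge[OF this] k2_le[OF this] e ex sp sigma] show thesis .
qed

section \<open>Normal approximation of sample means\<close>

context prob_space
begin

lemma indep_vars_nn_integral_exp_sum:
  fixes X :: "'i \<Rightarrow> 'a \<Rightarrow> real"
  assumes "finite I" and ind: "indep_vars (\<lambda>_. borel) X I"
  shows "(\<integral>\<^sup>+\<omega>. ennreal (exp (t * (\<Sum>i\<in>I. X i \<omega>))) \<partial>M) = (\<Prod>i\<in>I. \<integral>\<^sup>+\<omega>. ennreal (exp (t * X i \<omega>)) \<partial>M)"
proof -
  have "indep_vars (\<lambda>_. borel) (\<lambda>i \<omega>. ennreal (exp (t * X i \<omega>))) I"
    by (rule indep_vars_compose2[OF ind]) simp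
  from indep_vars_nn_integral[OF assms(1) this]
  have "(\<Prod>i\<in>I. \<integral>\<^sup>+\<omega>. ennreal (exp (t * X i \<omega>)) \<partial>M) = (\<integral>\<^sup>+\<omega>. (\<Prod>i\<in>I. ennreal (exp (t * X i \<omega>))) \<partial>M)"
    by simp
  also have "\<dots> = (\<integral>\<^sup>+\<omega>. ennreal (exp (t * (\<Sum>i\<in>I. X i \<omega>))) \<partial>M)"
    by (simp add: prod_ennreal exp_sum[OF assms(1), symmetric] sum_distrib_left)
  finally show ?thesis ..
qed

text \<open>In exp x \<le> 1 + x + x^2 exp |x| the linear term has expectation 0, so only a term
  quadratic in s survives; this is what makes n factors with s of order 1 / sqrt n harmless.\<close>

lemma exp_moment_0_le:
  assumes X[measurable]: "X \<in> borel_measurable M" and Q[measurable]: "Q \<in> borel_measurable M"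
    and int: "integrable M (\<lambda>\<omega>. exp (c * \<bar>Q \<omega>\<bar>))" and le: "\<And>\<omega>. \<bar>X \<omega>\<bar> \<le> \<bar>Q \<omega>\<bar>"
    and mean: "expectation X = 0" and s: "\<bar>s\<bar> \<le> d" "d < c"
  shows "exp_moment X 0 s \<le> exp (s\<^sup>2 * expectation (\<lambda>\<omega>. \<bar>Q \<omega>\<bar> ^ 2 * exp (d * \<bar>Q \<omega>\<bar>)))"
proof -
  have sc: "\<bar>s\<bar> < c" using s by linarith
  have iX: "integrable M X"
    using integrable_exp_moment[OF X Q int le, of 0 1] sc by simp
  have iQ: "integrable M (\<lambda>\<omega>. \<bar>Q \<omega>\<bar> ^ 2 * exp (d * \<bar>Q \<omega>\<bar>))"
    by (rule integrable_power_exp_abs[OF Q int s(2)])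
  have pw: "X \<omega> ^ 0 * exp (s * X \<omega>) \<le> 1 + s * X \<omega> + s\<^sup>2 * (\<bar>Q \<omega>\<bar> ^ 2 * exp (d * \<bar>Q \<omega>\<bar>))" for \<omega>
  proof -
    have "exp (s * X \<omega>) - 1 - s * X \<omega> \<le> (s * X \<omega>)\<^sup>2 * exp \<bar>s * X \<omega>\<bar>"
      using abs_exp_taylor2_le[of "s * X \<omega>"] by linarith
    also have "\<dots> = s\<^sup>2 * (\<bar>X \<omega>\<bar> ^ 2 * exp (\<bar>s\<bar> * \<bar>X \<omega>\<bar>))"
      by (simp add: power_mult_distrib abs_mult)
    also have "\<dots> \<le> s\<^sup>2 * (\<bar>Q \<omega>\<bar> ^ 2 * exp (d * \<bar>Q \<omega>\<bar>))"
    proof (intro mult_left_mono mult_mono power_mono le)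
      have "\<bar>s\<bar> * \<bar>X \<omega>\<bar> \<le> d * \<bar>Q \<omega>\<bar>" by (rule mult_mono[OF s(1) le]) (use s in auto)
      then show "exp (\<bar>s\<bar> * \<bar>X \<omega>\<bar>) \<le> exp (d * \<bar>Q \<omega>\<bar>)" by simp
    qed simp_all
    finally show ?thesis by simp
  qed
  have "exp_moment X 0 s \<le> expectation (\<lambda>\<omega>. 1 + s * X \<omega> + s\<^sup>2 * (\<bar>Q \<omega>\<bar> ^ 2 * exp (d * \<bar>Q \<omega>\<bar>)))"
    unfolding exp_moment_def
  proof (rule integral_mono[OF integrable_exp_moment[OF X Q int le sc] _ pw])
    show "integrable M (\<lambda>\<omega>. 1 + s * X \<omega> + s\<^sup>2 * (\<bar>Q \<omega>\<bar> ^ 2 * exp (d * \<bar>Q \<omega>\<bar>)))"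
      by (rule Bochner_Integration.integrable_add[OF Bochner_Integration.integrable_add[OF
          integrable_const integrable_mult_right[OF iX]] integrable_mult_right[OF iQ]])
  qed
  also have "\<dots> = 1 + s\<^sup>2 * expectation (\<lambda>\<omega>. \<bar>Q \<omega>\<bar> ^ 2 * exp (d * \<bar>Q \<omega>\<bar>))"
    using iX iQ by (simp add: mean prob_space)
  also have "\<dots> \<le> exp (s\<^sup>2 * expectation (\<lambda>\<omega>. \<bar>Q \<omega>\<bar> ^ 2 * exp (d * \<bar>Q \<omega>\<bar>)))" by simp
  finally show ?thesis .
qed

lemma nn_integral_exp_moment_le:
  assumes X[measurable]: "X \<in> borel_measurable M" and Q[measurable]: "Q \<in> borel_measurable M"
    and int: "integrable M (\<lambda>\<omega>. exp (c * \<bar>Q \<omega>\<bar>))" and le: "\<And>\<omega>. \<bar>X \<omega>\<bar> \<le> \<bar>Q \<omega>\<bar>"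
    and mean: "expectation X = 0" and s: "\<bar>s\<bar> \<le> d" "d < c"
  shows "(\<integral>\<^sup>+\<omega>. ennreal (exp (s * X \<omega>)) \<partial>M)
    \<le> ennreal (exp (s\<^sup>2 * expectation (\<lambda>\<omega>. \<bar>Q \<omega>\<bar> ^ 2 * exp (d * \<bar>Q \<omega>\<bar>))))"
proof -
  have sc: "\<bar>s\<bar> < c" using s by linarith
  have "(\<integral>\<^sup>+\<omega>. ennreal (exp (s * X \<omega>)) \<partial>M) = ennreal (exp_moment X 0 s)"
    unfolding exp_moment_def using integrable_exp_moment[OF X Q int le sc, of 0]
    by (subst nn_integral_eq_integral[symmetric]) auto
  also have "\<dots> \<le> ennreal (exp (s\<^sup>2 * expectation (\<lambda>\<omega>. \<bar>Q \<omega>\<bar> ^ 2 * exp (d * \<bar>Q \<omega>\<bar>))))"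
    by (rule ennreal_leI[OF exp_moment_0_le[OF assms]])
  finally show ?thesis .
qed

lemma nn_integral_PiM_coordinate:
  fixes Y :: "'a \<Rightarrow> real" and f :: "real \<Rightarrow> ennreal"
  assumes [measurable]: "Y \<in> borel_measurable M" "f \<in> borel_measurable borel" and i: "i \<in> I"
  shows "(\<integral>\<^sup>+x. f (x i) \<partial>PiM I (\<lambda>_. distr M borel Y)) = (\<integral>\<^sup>+\<omega>. f (Y \<omega>) \<partial>M)"
proof -
  interpret D: prob_space "distr M borel Y" by (rule prob_space_distr) simp
  have m: "(\<lambda>x. x i) \<in> measurable (PiM I (\<lambda>_. distr M borel Y)) (distr M borel Y)"
    by (rule measurable_component_singleton[OF i])
  have "(\<integral>\<^sup>+x. f (x i) \<partial>PiM I (\<lambda>_. distr M borel Y)) = (\<integral>\<^sup>+u. f u \<partial>distr (PiM I (\<lambda>_. distr M borel Y)) (distr M borel Y) (\<lambda>x. x i))"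
    by (rule nn_integral_distr[OF m, symmetric]) simp
  also have "distr (PiM I (\<lambda>_. distr M borel Y)) (distr M borel Y) (\<lambda>x. x i) = distr M borel Y"
    by (rule distr_PiM_component[OF D.prob_space_axioms i])
  also have "(\<integral>\<^sup>+u. f u \<partial>distr M borel Y) = (\<integral>\<^sup>+\<omega>. f (Y \<omega>) \<partial>M)"
    by (rule nn_integral_distr) simp_all
  finally show ?thesis .
qed

lemma integral_PiM_coordinate:
  fixes Y f :: "_ \<Rightarrow> real"
  assumes [measurable]: "Y \<in> borel_measurable M" "f \<in> borel_measurable borel" and i: "i \<in> I"
  shows "(LINT x|PiM I (\<lambda>_. distr M borel Y). f (x i)) = expectation (\<lambda>\<omega>. f (Y \<omega>))"
    and "integrable (PiM I (\<lambda>_. distr M borel Y)) (\<lambda>x. f (x i)) \<longleftrightarrow> integrable M (\<lambda>\<omega>. f (Y \<omega>))"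
proof -
  interpret D: prob_space "distr M borel Y" by (rule prob_space_distr) simp
  have m: "(\<lambda>x. x i) \<in> measurable (PiM I (\<lambda>_. distr M borel Y)) (distr M borel Y)"
    by (rule measurable_component_singleton[OF i])
  have eq: "distr (PiM I (\<lambda>_. distr M borel Y)) (distr M borel Y) (\<lambda>x. x i) = distr M borel Y"
    by (rule distr_PiM_component[OF D.prob_space_axioms i])
  have f: "f \<in> borel_measurable (distr M borel Y)" by simp
  have "(LINT x|PiM I (\<lambda>_. distr M borel Y). f (x i)) = (LINT u|distr M borel Y. f u)"
    using integral_distr[OF m f] unfolding eq by simp
  also have "\<dots> = expectation (\<lambda>\<omega>. f (Y \<omega>))" by (rule integral_distr) simp_all
  finally show "(LINT x|PiM I (\<lambda>_. distr M borel Y). f (x i)) = expectation (\<lambda>\<omega>. f (Y \<omega>))" .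
  have "integrable (PiM I (\<lambda>_. distr M borel Y)) (\<lambda>x. f (x i)) \<longleftrightarrow> integrable (distr M borel Y) f"
    using integrable_distr_eq[OF m f] unfolding eq by simp
  also have "\<dots> \<longleftrightarrow> integrable M (\<lambda>\<omega>. f (Y \<omega>))" by (rule integrable_distr_eq) simp_all
  finally show "integrable (PiM I (\<lambda>_. distr M borel Y)) (\<lambda>x. f (x i)) \<longleftrightarrow> integrable M (\<lambda>\<omega>. f (Y \<omega>))" .
qed

text \<open>Per summand the exponent is \<theta> / (\<sigma> * sqrt n). Over n summands the mean
  contributes exactly \<theta> times the scaled mean, while the centred parts add only a term
  quadratic in \<theta>. For small \<theta> a negative mean therefore prevails.\<close>

lemma scaled_sample_mean_exp_moment_le:
  assumes X[measurable]: "X \<in> borel_measurable M" and Q[measurable]: "Q \<in> borel_measurable M"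
    and int: "integrable M (\<lambda>\<omega>. exp (c * \<bar>Q \<omega>\<bar>))" and le: "\<And>\<omega>. \<bar>X \<omega>\<bar> \<le> \<bar>Q \<omega>\<bar>"
    and mean: "expectation X = 0" and d: "d < c" and n: "1 \<le> n" and \<sigma>: "0 < \<sigma>"
    and \<theta>: "0 \<le> \<theta>" "\<theta> / (\<sigma> * sqrt n) \<le> d"
  shows "(\<integral>\<^sup>+x. ennreal (exp (\<theta> * x)) \<partial>distr (sample_mean_law (distr M borel (\<lambda>\<omega>. m + X \<omega>)) n) borel (\<lambda>x. sqrt n / \<sigma> * x))
    \<le> ennreal (exp (\<theta> * (sqrt n * m / \<sigma>) + \<theta>\<^sup>2 * expectation (\<lambda>\<omega>. \<bar>Q \<omega>\<bar> ^ 2 * exp (d * \<bar>Q \<omega>\<bar>)) / \<sigma>\<^sup>2))"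
proof -
  define Y where "Y = (\<lambda>\<omega>. m + X \<omega>)"
  have Y[measurable]: "Y \<in> borel_measurable M" unfolding Y_def by simp
  define C where "C = expectation (\<lambda>\<omega>. \<bar>Q \<omega>\<bar> ^ 2 * exp (d * \<bar>Q \<omega>\<bar>))"
  define s where "s = \<theta> / (\<sigma> * sqrt n)"
  have s: "\<bar>s\<bar> \<le> d" using \<theta> \<sigma> by (simp add: s_def)
  have sn: "0 < sqrt n" "sqrt n * sqrt n = n" using n by simp_all
  have D: "real_distribution (distr M borel Y)" by simp
  interpret D: real_distribution "distr M borel Y" by (rule D)
  interpret P: prob_space "PiM {1..n} (\<lambda>_. distr M borel Y)" by (intro prob_space_PiM D.prob_space_axioms)
  have ne: "{1..n} \<noteq> {}" using n by simp
  have m: "(\<lambda>x. x i) \<in> borel_measurable (PiM {1..n} (\<lambda>_. distr M borel Y))" if "i \<in> {1..n}" for i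
    using measurable_component_singleton[OF that, of "\<lambda>_. distr M borel Y"] by simp
  have sm: "(\<lambda>x. (\<Sum>i=1..n. x i) / n) \<in> borel_measurable (PiM {1..n} (\<lambda>_. distr M borel Y))"
    by (intro borel_measurable_divide borel_measurable_sum m) simp_all
  have arg: "\<theta> * (sqrt n / \<sigma> * (z / n)) = s * z" for z
    using sn \<sigma> by (simp add: s_def field_simps)
  have "(\<integral>\<^sup>+x. ennreal (exp (\<theta> * x)) \<partial>distr (sample_mean_law (distr M borel Y) n) borel (\<lambda>x. sqrt n / \<sigma> * x))
    = (\<integral>\<^sup>+x. ennreal (exp (\<theta> * (sqrt n / \<sigma> * x))) \<partial>sample_mean_law (distr M borel Y) n)"
    by (rule nn_integral_distr) (simp_all add: sample_mean_law_def)
  also have "\<dots> = (\<integral>\<^sup>+x. ennreal (exp (s * (\<Sum>i\<in>{1..n}. x i))) \<partial>PiM {1..n} (\<lambda>_. distr M borel Y))"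
    unfolding sample_mean_law_def by (subst nn_integral_distr[OF sm]) (simp_all only: arg, measurable)
  also have "\<dots> = (\<Prod>i\<in>{1..n}. \<integral>\<^sup>+x. ennreal (exp (s * x i)) \<partial>PiM {1..n} (\<lambda>_. distr M borel Y))"
    by (rule P.indep_vars_nn_integral_exp_sum[OF _ indep_vars_PiM_coordinates[OF D ne]]) simp
  also have "\<dots> = (\<Prod>i\<in>{1..n}. ennreal (exp (s * m)) * (\<integral>\<^sup>+\<omega>. ennreal (exp (s * X \<omega>)) \<partial>M))"
  proof (rule prod.cong[OF refl])
    fix i assume "i \<in> {1..n}"
    from nn_integral_PiM_coordinate[OF Y _ this, of "\<lambda>u. ennreal (exp (s * u))"]
    show "(\<integral>\<^sup>+x. ennreal (exp (s * x i)) \<partial>PiM {1..n} (\<lambda>_. distr M borel Y)) = ennreal (exp (s * m)) * (\<integral>\<^sup>+\<omega>. ennreal (exp (s * X \<omega>)) \<partial>M)"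
      by (simp add: Y_def distrib_left exp_add ennreal_mult nn_integral_cmult)
  qed
  also have "\<dots> \<le> (\<Prod>i\<in>{1..n}. ennreal (exp (s * m)) * ennreal (exp (s\<^sup>2 * C)))"
    unfolding C_def
    by (intro prod_mono_ennreal mult_left_mono nn_integral_exp_moment_le[OF X Q int le mean s d]) simp
  also have "\<dots> = ennreal (exp (s * m + s\<^sup>2 * C) ^ n)"
    by (simp add: ennreal_mult'[symmetric] mult_exp_exp ennreal_power)
  also have "exp (s * m + s\<^sup>2 * C) ^ n = exp (n * (s * m + s\<^sup>2 * C))"
    by (rule exp_of_nat_mult[symmetric])
  also have "n * (s * m + s\<^sup>2 * C) = \<theta> * (sqrt n * m / \<sigma>) + \<theta>\<^sup>2 * C / \<sigma>\<^sup>2"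
  proof -
    have "n * s = \<theta> * sqrt n / \<sigma>" using sn \<sigma> by (simp add: s_def field_simps)
    moreover have "n * s\<^sup>2 = \<theta>\<^sup>2 / \<sigma>\<^sup>2" using sn \<sigma> by (simp add: s_def field_simps power2_eq_square)
    moreover have "n * (s * m + s\<^sup>2 * C) = (n * s) * m + (n * s\<^sup>2) * C" by (simp add: distrib_left mult.assoc)
    ultimately show ?thesis by simp
  qed
  finally show ?thesis by (simp add: C_def Y_def)
qed

lemma prod_const_le_power: "x \<ge> 1 \<Longrightarrow> card J \<le> n \<Longrightarrow> (\<Prod>i\<in>J. x) \<le> x ^ n" for x :: ennreal
  by (simp add: power_increasing)

text \<open>\<open>Z\<close> is the law of the standardised sum. With summands scaled by r = 1 /
  sqrt (v * n), the two contributions in the Stein bound are r * C 1 and n * r^3 * C 3, both of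
  order 1 / sqrt n. The condition on \<open>a\<close> ensures a * r \<le> d, so that the weights of
  single summands are covered by the exponential moment of \<open>Q\<close>.\<close>

theorem sample_mean_normal_approx:
  assumes X[measurable]: "X \<in> borel_measurable M" and Q[measurable]: "Q \<in> borel_measurable M"
    and int: "integrable M (\<lambda>\<omega>. exp (c * \<bar>Q \<omega>\<bar>))" and le: "\<And>\<omega>. \<bar>X \<omega>\<bar> \<le> \<bar>Q \<omega>\<bar>"
    and mean: "expectation X = 0" and d: "d < c" and n: "1 \<le> n"
    and v: "v = expectation (\<lambda>\<omega>. (X \<omega>)\<^sup>2)" "0 < v"
    and a: "0 \<le> a" "a \<le> 1 / 2" "a \<le> d * sqrt v * sqrt n"
  defines "C \<equiv> \<lambda>j. expectation (\<lambda>\<omega>. \<bar>Q \<omega>\<bar> ^ j * exp (d * \<bar>Q \<omega>\<bar>))"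
  obtains Z where "real_distribution Z"
    "sample_mean_law (distr M borel (\<lambda>\<omega>. m + X \<omega>)) n = distr Z borel (\<lambda>u. m + sqrt v / sqrt n * u)"
    "tail_dist a Z std_normal_distribution
      \<le> ennreal (4 * (1 + 2 * exp (a\<^sup>2 * C 2 / v)) * (C 1 / sqrt v + C 3 / sqrt v ^ 3) / sqrt n)"
proof -
  define Y where "Y = (\<lambda>\<omega>. m + X \<omega>)"
  have Y[measurable]: "Y \<in> borel_measurable M" unfolding Y_def by simp
  define r where "r = 1 / (sqrt v * sqrt n)"
  have sn: "0 < sqrt n" "sqrt n * sqrt n = n" using n by simp_all
  have sv: "0 < sqrt v" "sqrt v * sqrt v = v" using v by simp_all
  have r: "0 < r" "a * r \<le> d" "n * r\<^sup>2 = 1 / v"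
    using sn sv a by (simp_all add: r_def field_simps power2_eq_square)
  have d0: "0 \<le> d" using r a by (meson mult_nonneg_nonneg less_imp_le order_trans)
  have C_nonneg: "0 \<le> C j" for j unfolding C_def by (intro integral_nonneg_AE) simp
  have c0: "0 < c" using d d0 by linarith
  have D: "real_distribution (distr M borel Y)" by simp
  interpret D: real_distribution "distr M borel Y" by (rule D)
  define P where "P = PiM {1..n} (\<lambda>_. distr M borel Y)"
  interpret P: prob_space P unfolding P_def by (intro prob_space_PiM D.prob_space_axioms)
  have ne: "{1..n} \<noteq> {}" using n by simp
  have coord[measurable]: "(\<lambda>x. x i) \<in> borel_measurable P" if "i \<in> {1..n}" for i
    unfolding P_def using measurable_component_singleton[OF that, of "\<lambda>_. distr M borel Y"] by simp
  define \<xi> where "\<xi> = (\<lambda>i (x :: nat \<Rightarrow> real). r * (x i - m))"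
  have ind: "P.indep_vars (\<lambda>_. borel) \<xi> {1..n}"
    unfolding \<xi>_def P_def
    by (rule P.indep_vars_compose2[unfolded P_def, OF indep_vars_PiM_coordinates[OF D ne]]) simp
  have \<xi>_m[measurable]: "\<xi> i \<in> borel_measurable P" if "i \<in> {1..n}" for i
    unfolding \<xi>_def using coord[OF that] by simp
  define Z where "Z = distr P borel (\<lambda>x. \<Sum>i\<in>{1..n}. \<xi> i x)"
  have sum_m: "(\<lambda>x. \<Sum>i\<in>{1..n}. \<xi> i x) \<in> borel_measurable P"
    by (intro borel_measurable_sum \<xi>_m)
  have Z: "real_distribution Z" unfolding Z_def by (rule P.real_distribution_distr[OF sum_m])
  have "sample_mean_law (distr M borel Y) n = distr P borel (\<lambda>x. (\<Sum>i\<in>{1..n}. x i) / n)"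
    by (simp add: sample_mean_law_def P_def)
  also have "\<dots> = distr P borel (\<lambda>x. m + sqrt v / sqrt n * (\<Sum>i\<in>{1..n}. \<xi> i x))"
  proof (rule distr_cong[OF refl refl])
    fix x :: "nat \<Rightarrow> real"
    have "(\<Sum>i\<in>{1..n}. \<xi> i x) = r * ((\<Sum>i\<in>{1..n}. x i) - n * m)"
      by (simp add: \<xi>_def sum_distrib_left[symmetric] sum_subtractf)
    moreover have "sqrt v / sqrt n * r = 1 / n" using sn sv by (simp add: r_def field_simps)
    ultimately have "sqrt v / sqrt n * (\<Sum>i\<in>{1..n}. \<xi> i x) = 1 / n * ((\<Sum>i\<in>{1..n}. x i) - n * m)"
      by (metis mult.assoc)
    then show "(\<Sum>i\<in>{1..n}. x i) / n = m + sqrt v / sqrt n * (\<Sum>i\<in>{1..n}. \<xi> i x)"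
      using n by (simp add: field_simps)
  qed
  also have "\<dots> = distr Z borel (\<lambda>u. m + sqrt v / sqrt n * u)"
    unfolding Z_def using sum_m by (subst distr_distr) (auto simp: comp_def)
  finally have repr: "sample_mean_law (distr M borel Y) n = distr Z borel (\<lambda>u. m + sqrt v / sqrt n * u)" .
  have \<xi>_nn: "(\<integral>\<^sup>+x. f (\<xi> i x) \<partial>P) = (\<integral>\<^sup>+\<omega>. f (r * X \<omega>) \<partial>M)"
    if "i \<in> {1..n}" and [measurable]: "f \<in> borel_measurable borel" for i and f :: "real \<Rightarrow> ennreal"
    using nn_integral_PiM_coordinate[OF Y _ that(1), of "\<lambda>u. f (r * (u - m))"]
    by (simp add: P_def \<xi>_def Y_def)
  have iX2: "integrable M (\<lambda>\<omega>. (X \<omega>)\<^sup>2)"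
    using integrable_exp_moment[OF X Q int le, of 0 2] c0 by simp
  have abs_moment: "(\<integral>\<^sup>+x. ennreal (\<bar>\<xi> i x\<bar> ^ j * exp (a * \<bar>\<xi> i x\<bar>)) \<partial>P) \<le> ennreal (r ^ j * C j)"
    if i: "i \<in> {1..n}" for i j
  proof -
    have "(\<integral>\<^sup>+x. ennreal (\<bar>\<xi> i x\<bar> ^ j * exp (a * \<bar>\<xi> i x\<bar>)) \<partial>P)
      = (\<integral>\<^sup>+\<omega>. ennreal (\<bar>r * X \<omega>\<bar> ^ j * exp (a * \<bar>r * X \<omega>\<bar>)) \<partial>M)"
      by (rule \<xi>_nn[OF i]) measurable
    also have "\<dots> \<le> (\<integral>\<^sup>+\<omega>. ennreal (r ^ j * (\<bar>Q \<omega>\<bar> ^ j * exp (d * \<bar>Q \<omega>\<bar>))) \<partial>M)"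
    proof (rule nn_integral_mono, rule ennreal_leI)
      fix \<omega>
      have "a * \<bar>r * X \<omega>\<bar> = (a * r) * \<bar>X \<omega>\<bar>" using r by (simp add: abs_mult)
      also have "\<dots> \<le> d * \<bar>Q \<omega>\<bar>" by (rule mult_mono[OF r(2) le d0]) simp
      finally have "exp (a * \<bar>r * X \<omega>\<bar>) \<le> exp (d * \<bar>Q \<omega>\<bar>)" by simp
      moreover have "\<bar>r * X \<omega>\<bar> ^ j \<le> r ^ j * \<bar>Q \<omega>\<bar> ^ j"
        using r power_mono[OF le[of \<omega>], of j] by (simp add: abs_mult power_mult_distrib)
      ultimately have "\<bar>r * X \<omega>\<bar> ^ j * exp (a * \<bar>r * X \<omega>\<bar>) \<le> (r ^ j * \<bar>Q \<omega>\<bar> ^ j) * exp (d * \<bar>Q \<omega>\<bar>)"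
        using r by (intro mult_mono) simp_all
      then show "\<bar>r * X \<omega>\<bar> ^ j * exp (a * \<bar>r * X \<omega>\<bar>) \<le> r ^ j * (\<bar>Q \<omega>\<bar> ^ j * exp (d * \<bar>Q \<omega>\<bar>))"
        by (simp only: mult.assoc)
    qed
    also have "\<dots> = ennreal (r ^ j * C j)"
      unfolding C_def
      by (subst nn_integral_eq_integral)
         (use r integrable_power_exp_abs[OF Q int d, of j] in \<open>auto intro!: integrable_mult_right\<close>)
    finally show ?thesis .
  qed
  have exp_sum: "(\<integral>\<^sup>+x. ennreal (exp (a * (\<Sum>j\<in>{1..n} - {i}. \<xi> j x))) \<partial>P) \<le> ennreal (exp (a\<^sup>2 * C 2 / v))" for i
  proof -
    have ar: "\<bar>a * r\<bar> \<le> d" using a r by simp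
    have "(\<integral>\<^sup>+x. ennreal (exp (a * (\<Sum>j\<in>{1..n} - {i}. \<xi> j x))) \<partial>P)
      = (\<Prod>j\<in>{1..n} - {i}. \<integral>\<^sup>+x. ennreal (exp (a * \<xi> j x)) \<partial>P)"
      by (rule P.indep_vars_nn_integral_exp_sum[OF _ P.indep_vars_subset[OF ind]]) auto
    also have "\<dots> = (\<Prod>j\<in>{1..n} - {i}. \<integral>\<^sup>+\<omega>. ennreal (exp ((a * r) * X \<omega>)) \<partial>M)"
    proof (rule prod.cong[OF refl])
      fix j assume "j \<in> {1..n} - {i}"
      then have j: "j \<in> {1..n}" by simp
      show "(\<integral>\<^sup>+x. ennreal (exp (a * \<xi> j x)) \<partial>P) = (\<integral>\<^sup>+\<omega>. ennreal (exp ((a * r) * X \<omega>)) \<partial>M)"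
        using \<xi>_nn[OF j, of "\<lambda>u. ennreal (exp (a * u))"] by (simp add: mult.assoc)
    qed
    also have "\<dots> \<le> (\<Prod>j\<in>{1..n} - {i}. ennreal (exp ((a * r)\<^sup>2 * C 2)))"
      unfolding C_def by (intro prod_mono_ennreal nn_integral_exp_moment_le[OF X Q int le mean ar d])
    \<comment> \<open>A leave-one-out sum has n - 1 factors; filling up to n is allowed because each
      factor is at least 1, and it makes n * r^2 * v = 1 applicable.\<close>
    also have "\<dots> \<le> ennreal (exp ((a * r)\<^sup>2 * C 2)) ^ n"
    proof (rule prod_const_le_power)
      show "1 \<le> ennreal (exp ((a * r)\<^sup>2 * C 2))" using C_nonneg[of 2] by simp
      show "card ({1..n} - {i}) \<le> n" using card_mono[of "{1..n}" "{1..n} - {i}"] by simp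
    qed
    also have "\<dots> = ennreal (exp (n * ((a * r)\<^sup>2 * C 2)))"
      by (simp add: ennreal_power exp_of_nat_mult)
    also have "n * ((a * r)\<^sup>2 * C 2) = a\<^sup>2 * C 2 * (n * r\<^sup>2)" by (simp add: power_mult_distrib)
    also have "\<dots> = a\<^sup>2 * C 2 / v" by (simp add: r)
    finally show ?thesis .
  qed
  have "(\<integral>\<^sup>+s. ennreal (exp (a * s) * \<bar>P.prob {x\<in>space P. s < (\<Sum>i\<in>{1..n}. \<xi> i x)} - normal_tail s\<bar>) \<partial>lborel)
    \<le> ennreal (4 * (1 + 2 * exp (a\<^sup>2 * C 2 / v)) * (r ^ 1 * C 1 + card {1..n} * (r ^ 3 * C 3)))"
  proof (rule P.stein_tail_L1_bound[OF _ ind])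
    fix i assume i: "i \<in> {1..n}"
    have sq: "(LINT x|P. (\<xi> i x)\<^sup>2) = r\<^sup>2 * v" and "integrable P (\<lambda>x. (\<xi> i x)\<^sup>2)"
      using integral_PiM_coordinate[OF Y _ i, of "\<lambda>u. (r * (u - m))\<^sup>2"] iX2
      by (simp_all add: P_def \<xi>_def Y_def power_mult_distrib v)
    then show "integrable P (\<lambda>x. (\<xi> i x)\<^sup>2)" by simp
    show "P.expectation (\<xi> i) = 0"
      using integral_PiM_coordinate(1)[OF Y _ i, of "\<lambda>u. r * (u - m)"] mean
      by (simp add: P_def \<xi>_def Y_def)
    show "(\<integral>\<^sup>+x. ennreal (exp (a * (\<Sum>j\<in>{1..n} - {i}. \<xi> j x))) \<partial>P) \<le> ennreal (exp (a\<^sup>2 * C 2 / v))"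
      by (rule exp_sum)
    show "(\<integral>\<^sup>+x. ennreal (\<bar>\<xi> i x\<bar> * exp (a * \<bar>\<xi> i x\<bar>)) \<partial>P) \<le> ennreal (r ^ 1 * C 1)"
      using abs_moment[OF i, of 1] by simp
    show "(\<integral>\<^sup>+x. ennreal (\<bar>\<xi> i x\<bar> ^ 3 * exp (a * \<bar>\<xi> i x\<bar>)) \<partial>P) \<le> ennreal (r ^ 3 * C 3)"
      by (rule abs_moment[OF i])
  next
    have "(LINT x|P. (\<xi> i x)\<^sup>2) = r\<^sup>2 * v" if i: "i \<in> {1..n}" for i
      using integral_PiM_coordinate(1)[OF Y _ i, of "\<lambda>u. (r * (u - m))\<^sup>2"]
      by (simp add: P_def \<xi>_def Y_def power_mult_distrib v)
    then have "(\<Sum>i\<in>{1..n}. LINT x|P. (\<xi> i x)\<^sup>2) = (n * r\<^sup>2) * v" by simp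
    also have "\<dots> = 1" unfolding r using v by simp
    finally show "(\<Sum>i\<in>{1..n}. P.expectation (\<lambda>x. (\<xi> i x)\<^sup>2)) = 1" .
  qed (use a r C_nonneg in simp_all)
  also have "(\<lambda>s. P.prob {x\<in>space P. s < (\<Sum>i\<in>{1..n}. \<xi> i x)}) = (\<lambda>s. measure Z {s<..})"
    unfolding Z_def using sum_m by (auto simp: measure_distr fun_eq_iff intro!: arg_cong[where f = P.prob])
  also have "r ^ 1 * C 1 + card {1..n} * (r ^ 3 * C 3) = (C 1 / sqrt v + C 3 / sqrt v ^ 3) / sqrt n"
    using sn sv by (simp add: r_def field_simps power3_eq_cube)
  finally have "tail_dist a Z std_normal_distribution
      \<le> ennreal (4 * (1 + 2 * exp (a\<^sup>2 * C 2 / v)) * ((C 1 / sqrt v + C 3 / sqrt v ^ 3) / sqrt n))"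
    by (simp add: tail_dist_def normal_tail_def)
  with Z repr show thesis by (intro that[of Z]) (auto simp: Y_def)
qed

end

text \<open>Two comparisons: from the scaled mean to the normal law with the same mean and variance,
  by the Stein bound carried over by the affine map, and from there to the normal law with drift
  \<beta> and variance 1, by coupling. The bounds \<theta> \<le> 1 / 4 and sqrt v \<le> 2 * \<sigma>
  keep the exponent after the change of scale at most 1 / 2, as the Stein bound requires.\<close>

lemma (in prob_space) scaled_sample_mean_tail_dist_le:
  assumes X: "X \<in> borel_measurable M" and Q: "Q \<in> borel_measurable M"
    and int: "integrable M (\<lambda>\<omega>. exp (c * \<bar>Q \<omega>\<bar>))" and le: "\<And>\<omega>. \<bar>X \<omega>\<bar> \<le> \<bar>Q \<omega>\<bar>"
    and mean: "expectation X = 0" and d: "d < c" and n: "1 \<le> n"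
    and v: "v = expectation (\<lambda>\<omega>. (X \<omega>)\<^sup>2)" "0 < v"
    and \<sigma>: "0 < \<sigma>" "sqrt v \<le> 2 * \<sigma>" and \<theta>: "0 \<le> \<theta>" "\<theta> \<le> 1 / 4" and dn: "1 / 2 \<le> d * sqrt v * sqrt n"
    and b: "b = - (sqrt n * m / \<sigma>)" "0 \<le> b" and \<beta>: "0 \<le> \<beta>"
  defines "C \<equiv> \<lambda>j. expectation (\<lambda>\<omega>. \<bar>Q \<omega>\<bar> ^ j * exp (d * \<bar>Q \<omega>\<bar>))"
  shows "tail_dist \<theta> (distr (sample_mean_law (distr M borel (\<lambda>\<omega>. m + X \<omega>)) n) borel (\<lambda>x. sqrt n / \<sigma> * x)) (normal_law \<beta>)
    \<le> ennreal (8 * (1 + 2 * exp (C 2 / v)) * (C 1 / sqrt v + C 3 / sqrt v ^ 3) / sqrt n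
        + 2 * exp 2 * (\<bar>b - \<beta>\<bar> + \<bar>sqrt v / \<sigma> - 1\<bar>))"
proof -
  define \<tau> where "\<tau> = sqrt v / \<sigma>"
  define a where "a = \<theta> * \<tau>"
  have \<tau>: "0 < \<tau>" "\<tau> \<le> 2" using v \<sigma> by (simp_all add: \<tau>_def field_simps)
  have "\<theta> * \<tau> \<le> 1 / 4 * 2" using \<theta> \<tau> by (intro mult_mono) simp_all
  then have a: "0 \<le> a" "a \<le> 1 / 2" "a \<le> d * sqrt v * sqrt n" using \<theta> \<tau> dn by (simp_all add: a_def)
  have C_nonneg: "0 \<le> C j" for j unfolding C_def by (intro integral_nonneg_AE) simp
  obtain Z where Z: "real_distribution Z"
    and repr: "sample_mean_law (distr M borel (\<lambda>\<omega>. m + X \<omega>)) n = distr Z borel (\<lambda>u. m + sqrt v / sqrt n * u)"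
    and bound: "tail_dist a Z std_normal_distribution
      \<le> ennreal (4 * (1 + 2 * exp (a\<^sup>2 * C 2 / v)) * (C 1 / sqrt v + C 3 / sqrt v ^ 3) / sqrt n)"
    unfolding C_def by (rule sample_mean_normal_approx[OF X Q int le mean d n v a, where m = m])
  interpret Z: real_distribution Z by (rule Z)
  have sn: "0 < sqrt n" using n by simp
  have arg: "sqrt n / \<sigma> * (m + sqrt v / sqrt n * u) = \<tau> * u - b" for u
    using sn \<sigma> by (simp add: b \<tau>_def distrib_left)
  define A where "A = distr (sample_mean_law (distr M borel (\<lambda>\<omega>. m + X \<omega>)) n) borel (\<lambda>x. sqrt n / \<sigma> * x)"
  have A: "A = distr Z borel (\<lambda>u. \<tau> * u - b)"
  proof -
    have "A = distr Z borel ((\<lambda>x. sqrt n / \<sigma> * x) \<circ> (\<lambda>u. m + sqrt v / sqrt n * u))"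
      unfolding A_def repr by (rule distr_distr) simp_all
    then show ?thesis by (simp only: comp_def arg)
  qed
  define G where "G = distr std_normal_distribution borel (\<lambda>u. \<tau> * u - b)"
  have rA: "real_distribution A" unfolding A by (rule Z.real_distribution_distr) simp
  have rG: "real_distribution G" unfolding G_def by (rule std_normal.real_distribution_distr) simp
  define B where "B = 4 * (1 + 2 * exp (C 2 / v)) * (C 1 / sqrt v + C 3 / sqrt v ^ 3) / sqrt n"
  have cc: "0 \<le> (C 1 / sqrt v + C 3 / sqrt v ^ 3) / sqrt n" using C_nonneg v by simp
  have B_nonneg: "0 \<le> B" unfolding B_def using C_nonneg v by simp
  have tb: "tail_dist (\<theta> * \<tau>) Z std_normal_distribution \<le> ennreal B"
    unfolding a_def[symmetric]
  proof (rule order_trans[OF bound ennreal_leI])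
    have "a\<^sup>2 \<le> 1" using a power_mono[of a 1 2] by simp
    then have "a\<^sup>2 * C 2 \<le> C 2" by (rule mult_left_le_one_le[OF C_nonneg zero_le_power2])
    then have "a\<^sup>2 * C 2 / v \<le> C 2 / v" by (rule divide_right_mono) (use v in simp)
    then have "exp (a\<^sup>2 * C 2 / v) \<le> exp (C 2 / v)" by (rule iffD2[OF exp_le_cancel_iff])
    moreover have "4 * (1 + 2 * x) \<le> 4 * (1 + 2 * y)" if "x \<le> y" for x y :: real using that by simp
    ultimately have "4 * (1 + 2 * exp (a\<^sup>2 * C 2 / v)) \<le> 4 * (1 + 2 * exp (C 2 / v))" by blast
    from mult_right_mono[OF this cc] show "4 * (1 + 2 * exp (a\<^sup>2 * C 2 / v)) * (C 1 / sqrt v + C 3 / sqrt v ^ 3) / sqrt n \<le> B"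
      by (simp add: B_def)
  qed
  have te: "\<tau> * exp (- \<theta> * b) \<le> 2 * 1"
  proof (rule mult_mono[OF \<tau>(2)])
    have "0 \<le> \<theta> * b" by (rule mult_nonneg_nonneg[OF \<theta>(1) b(2)])
    then show "exp (- \<theta> * b) \<le> 1"
      by (simp only: exp_le_one_iff mult_minus_left neg_le_0_iff_le)
  qed simp_all
  have "ennreal (\<tau> * exp (- \<theta> * b)) * tail_dist (\<theta> * \<tau>) Z std_normal_distribution \<le> ennreal (2 * 1) * ennreal B"
    by (rule mult_mono[OF ennreal_leI[OF te] tb]) simp_all
  also have "\<dots> = ennreal (2 * B)" using B_nonneg by (simp add: ennreal_mult)
  finally have 1: "tail_dist \<theta> A G \<le> ennreal (2 * B)"
    unfolding A G_def tail_dist_affine[OF Z real_dist_normal_dist \<tau>(1)] .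
  have 2: "tail_dist \<theta> G (normal_law \<beta>) \<le> ennreal (2 * exp 2 * (\<bar>b - \<beta>\<bar> + \<bar>\<tau> - 1\<bar>))"
    unfolding G_def by (rule tail_dist_normal_le) (use \<theta> \<tau> b(2) \<beta> in simp_all)
  have "tail_dist \<theta> A (normal_law \<beta>) \<le> ennreal (2 * B) + ennreal (2 * exp 2 * (\<bar>b - \<beta>\<bar> + \<bar>\<tau> - 1\<bar>))"
    by (rule order_trans[OF tail_dist_triangle[OF rA rG real_distribution_normal_law] add_mono[OF 1 2]])
  also have "\<dots> = ennreal (2 * B + 2 * exp 2 * (\<bar>b - \<beta>\<bar> + \<bar>\<tau> - 1\<bar>))"
    using B_nonneg by (intro ennreal_plus[symmetric]) simp_all
  also have "2 * B = 8 * (1 + 2 * exp (C 2 / v)) * (C 1 / sqrt v + C 3 / sqrt v ^ 3) / sqrt n"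
    by (simp add: B_def)
  finally show ?thesis by (simp only: A_def \<tau>_def)
qed

text \<open>Here r stands for sqrt n, \<mu> for the drift and s for the distance of the saddle point
  from 0. Since s is of order 1 / r, the error of order s^2 in the saddle point equation is still of
  order 1 / r after multiplication by r, and so is the difference of order s between \<sigma>^2 and
  the variance.\<close>

lemma saddle_parameter_bounds:
  fixes r s \<sigma> v v0 \<mu> K S :: real
  assumes r: "0 < r" and v: "0 < v0" "v0 \<le> v" and \<sigma>: "0 < \<sigma>" "v / 2 \<le> \<sigma>\<^sup>2"
    and s: "0 < s" "s \<le> S / r" and K: "0 \<le> K"
    and e: "\<bar>\<mu> - s * \<sigma>\<^sup>2\<bar> \<le> 2 * K * s\<^sup>2" "\<bar>\<sigma>\<^sup>2 - v\<bar> \<le> K * s"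
  shows "\<bar>r * \<mu> / \<sigma> - s * \<sigma> * r\<bar> \<le> 2 * K * S\<^sup>2 / sqrt (v0 / 2) / r"
    and "\<bar>sqrt v / \<sigma> - 1\<bar> \<le> 2 * K * S / v0 / r"
    and "sqrt v \<le> 2 * \<sigma>"
proof -
  have \<sigma>_ge: "sqrt (v0 / 2) \<le> \<sigma>" using \<sigma> v by (intro real_le_lsqrt) simp_all
  have v02: "0 < sqrt (v0 / 2)" using v by simp
  have "r * \<mu> / \<sigma> - s * \<sigma> * r = r / \<sigma> * (\<mu> - s * \<sigma>\<^sup>2)"
    using \<sigma> by (simp add: field_simps power2_eq_square)
  then have "\<bar>r * \<mu> / \<sigma> - s * \<sigma> * r\<bar> = r / \<sigma> * \<bar>\<mu> - s * \<sigma>\<^sup>2\<bar>" using r \<sigma> by (simp add: abs_mult)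
  also have "\<dots> \<le> r / sqrt (v0 / 2) * (2 * K * (S / r)\<^sup>2)"
  proof (rule mult_mono)
    show "r / \<sigma> \<le> r / sqrt (v0 / 2)"
      by (rule divide_left_mono[OF \<sigma>_ge less_imp_le[OF r] mult_pos_pos[OF \<sigma>(1) v02]])
    have "2 * K * s\<^sup>2 \<le> 2 * K * (S / r)\<^sup>2" using s K by (intro mult_left_mono power_mono) simp_all
    then show "\<bar>\<mu> - s * \<sigma>\<^sup>2\<bar> \<le> 2 * K * (S / r)\<^sup>2" using e by linarith
  qed (use r v02 in simp_all)
  also have "\<dots> = 2 * K * S\<^sup>2 / sqrt (v0 / 2) / r" using r by (simp add: field_simps power2_eq_square)
  finally show "\<bar>r * \<mu> / \<sigma> - s * \<sigma> * r\<bar> \<le> 2 * K * S\<^sup>2 / sqrt (v0 / 2) / r" .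
  define \<tau> where "\<tau> = sqrt v / \<sigma>"
  have \<tau>: "0 \<le> \<tau>" "\<tau>\<^sup>2 = v / \<sigma>\<^sup>2" using v \<sigma> by (simp_all add: \<tau>_def power_divide)
  \<comment> \<open>Multiplying by \<tau> + 1, which is at least 1, turns the difference into one of
    squares, and these are controlled by the variances.\<close>
  have "\<bar>\<tau> - 1\<bar> \<le> \<bar>\<tau> - 1\<bar> * (\<tau> + 1)" using \<tau> by (simp add: mult_le_cancel_left1)
  also have "\<dots> = \<bar>(\<tau> - 1) * (\<tau> + 1)\<bar>" using \<tau>(1) by (simp only: abs_mult)
  also have "(\<tau> - 1) * (\<tau> + 1) = \<tau>\<^sup>2 - 1" by (simp add: power2_eq_square algebra_simps)
  also have "\<tau>\<^sup>2 - 1 = (v - \<sigma>\<^sup>2) / \<sigma>\<^sup>2" using \<sigma>(1) by (simp add: \<tau>(2) diff_divide_distrib)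
  also have "\<bar>\<dots>\<bar> = \<bar>\<sigma>\<^sup>2 - v\<bar> / \<sigma>\<^sup>2" by (simp add: abs_divide abs_minus_commute)
  also have "\<dots> \<le> (K * (S / r)) / (v0 / 2)"
  proof (rule frac_le)
    show "\<bar>\<sigma>\<^sup>2 - v\<bar> \<le> K * (S / r)" using e(2) mult_left_mono[OF s(2) K] by linarith
    then show "0 \<le> K * (S / r)" using abs_ge_zero order_trans by blast
  qed (use v \<sigma> in simp_all)
  finally show "\<bar>sqrt v / \<sigma> - 1\<bar> \<le> 2 * K * S / v0 / r" by (simp add: \<tau>_def field_simps)
  have "v \<le> (2 * \<sigma>)\<^sup>2" using v \<sigma> by (simp add: power_mult_distrib)
  then show "sqrt v \<le> 2 * \<sigma>" using \<sigma> by (intro real_le_lsqrt) simp_all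
qed

text \<open>The open strip contains both end points, so the exponents \<delta> and - \<delta> are
  both admissible, and the sum of the two exponentials dominates the one with the absolute
  value.\<close>

lemma mgf_strip_integrable_exp_abs:
  assumes "mgf_analytic_on_strip M X \<delta>" "0 < \<delta>" and [measurable]: "X \<in> borel_measurable M"
  shows "integrable M (\<lambda>\<omega>. exp (\<delta> * \<bar>X \<omega>\<bar>))"
proof -
  have exp_int: "integrable M (\<lambda>\<omega>. exp (t * X \<omega>))" if "t = \<delta> \<or> t = - \<delta>" for t
  proof -
    obtain a b where ab: "a < - \<delta>" "\<delta> < b"
      and strip: "\<And>z::complex. a < Re z \<Longrightarrow> Re z < b \<Longrightarrow> integrable M (\<lambda>\<omega>. exp (z * of_real (X \<omega>)))"
      using assms(1) unfolding mgf_analytic_on_strip_def by blast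
    have "integrable M (\<lambda>\<omega>. exp (complex_of_real t * of_real (X \<omega>)))"
      by (rule strip) (use ab that assms(2) in auto)
    from integrable_norm[OF this] show ?thesis by (simp add: norm_exp_eq_Re)
  qed
  show ?thesis
  proof (rule Bochner_Integration.integrable_bound[OF Bochner_Integration.integrable_add[OF exp_int[of \<delta>] exp_int[of "- \<delta>"]]])
    show "AE \<omega> in M. norm (exp (\<delta> * \<bar>X \<omega>\<bar>)) \<le> norm (exp (\<delta> * X \<omega>) + exp (- \<delta> * X \<omega>))"
    proof (rule AE_I2)
      fix \<omega>
      have "exp (\<delta> * \<bar>X \<omega>\<bar>) \<le> exp (\<delta> * X \<omega>) + exp (- \<delta> * X \<omega>)"
        by (cases "0 \<le> X \<omega>") simp_all
      then show "norm (exp (\<delta> * \<bar>X \<omega>\<bar>)) \<le> norm (exp (\<delta> * X \<omega>) + exp (- \<delta> * X \<omega>))"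
        by (simp only: real_norm_def abs_of_nonneg add_nonneg_nonneg exp_ge_zero)
    qed
  qed simp_all
qed

section \<open>Moments of the waiting time\<close>

text \<open>The saddle point depends on the interval in which it is sought, and its
  \<open>THE\<close> term is meaningful only under uniqueness; hence uniqueness is part of the
  conclusion, and the interval may be any sufficiently short one that is fixed before n.
  Integrability of both powers is asserted as well, because the default value 0 of an undefined
  integral would make the estimate empty.\<close>

theorem mainTheorem6:
  fixes M :: "'a measure" and V U :: "'a \<Rightarrow> real"
    and N :: "nat \<Rightarrow> 'b measure" and W :: "nat \<Rightarrow> 'b \<Rightarrow> real"
    and \<rho> :: "nat \<Rightarrow> real" and \<delta>\<^sub>0 \<beta>\<^sub>1 \<beta>\<^sub>2 :: real
  assumes "prob_space M"
    and "V \<in> borel_measurable M" and "U \<in> borel_measurable M"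
    and "AE \<omega> in M. 0 \<le> V \<omega>" and "AE \<omega> in M. 0 \<le> U \<omega>"
    and "prob_space.indep_var M borel V borel U"
    and "integrable M V" and "prob_space.expectation M V = 1"
    and "integrable M U" and "prob_space.expectation M U = 1"
    and "integrable M (\<lambda>\<omega>. (V \<omega>)\<^sup>2)" and "integrable M (\<lambda>\<omega>. (U \<omega>)\<^sup>2)"
    and "0 < prob_space.variance M V + prob_space.variance M U"
    and "\<delta>\<^sub>0 > 0"
    and "mgf_analytic_on_strip M V \<delta>\<^sub>0" and "mgf_analytic_on_strip M U \<delta>\<^sub>0"
    and "separation_assumption M V U"
    and "\<And>n. n \<ge> 1 \<Longrightarrow> 0 < \<rho> n \<and> \<rho> n < 1"
    and "0 < \<beta>\<^sub>1" and "\<beta>\<^sub>1 \<le> \<beta>\<^sub>2"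
    and "\<And>n. n \<ge> 1 \<Longrightarrow> (1 - \<rho> n) * sqrt (real n) \<in> {\<beta>\<^sub>1..\<beta>\<^sub>2}"
    and "\<And>n. n \<ge> 1 \<Longrightarrow> prob_space (N n)"
    and "\<And>n. n \<ge> 1 \<Longrightarrow> W n \<in> borel_measurable (N n)"
    and "\<And>n. n \<ge> 1 \<Longrightarrow> AE \<omega> in N n. 0 \<le> W n \<omega>"
    and "\<And>n. n \<ge> 1 \<Longrightarrow>
      stationary_waiting_law (distr M borel V) (distr M borel U) (\<rho> n) n (distr (N n) borel (W n))"
  shows "\<exists>\<delta>\<^sub>1>0. \<forall>\<delta>'. 0 < \<delta>' \<and> \<delta>' \<le> \<delta>\<^sub>1 \<longrightarrow>
    (\<forall>\<^sub>F n in sequentially. \<exists>!\<zeta>. is_saddle_point (log_psi M V U (\<rho> n)) \<delta>' \<zeta>) \<and>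
    (\<forall>k\<ge>1.
      (\<forall>\<^sub>F n in sequentially.
        integrable (N n) (\<lambda>\<omega>. (sqrt (real n) / saddle_sigma (log_psi M V U (\<rho> n)) \<delta>' * W n \<omega>) ^ k) \<and>
        integrable (gaussian_increments (saddle_beta (log_psi M V U (\<rho> n)) \<delta>' n))
          (\<lambda>x. walk_max x ^ k)) \<and>
      (\<lambda>n. (LINT \<omega>|N n. (sqrt (real n) / saddle_sigma (log_psi M V U (\<rho> n)) \<delta>' * W n \<omega>) ^ k)
           - walk_max_moment k (saddle_beta (log_psi M V U (\<rho> n)) \<delta>' n))
        \<in> O(\<lambda>n. 1 / sqrt (real n)))"
proof -
  interpret prob_space M by fact
  have V[measurable]: "V \<in> borel_measurable M" and U[measurable]: "U \<in> borel_measurable M" by fact+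
  have ind: "indep_var borel V borel U" by fact
  have iV: "integrable M V" "expectation V = 1" and iU: "integrable M U" "expectation U = 1" by fact+
  have iV2: "integrable M (\<lambda>\<omega>. (V \<omega>)\<^sup>2)" and iU2: "integrable M (\<lambda>\<omega>. (U \<omega>)\<^sup>2)" by fact+
  have \<delta>0: "0 < \<delta>\<^sub>0" by fact
  have \<rho>: "0 < \<rho> n" "\<rho> n < 1" "\<beta>\<^sub>1 \<le> (1 - \<rho> n) * sqrt n" "(1 - \<rho> n) * sqrt n \<le> \<beta>\<^sub>2" if "1 \<le> n" for n
    using assms(18)[OF that] assms(21)[OF that] by auto
  have \<beta>: "0 < \<beta>\<^sub>1" "\<beta>\<^sub>1 \<le> \<beta>\<^sub>2" by fact+

  \<comment> \<open>Dominates the centred increment for every traffic intensity of at least 1 / 2,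
    as then 1 / \<rho> \<le> 2. All constants below are built from moments of this variable and do
    not depend on n.\<close>
  define Q where "Q = (\<lambda>\<omega>. \<bar>V \<omega> - 1\<bar> + 2 * \<bar>U \<omega> - 1\<bar>)"
  \<comment> \<open>\<open>Q\<close> is at most 4 + 4 * max |V| |U|, so a quarter of the exponent
    available for V and U remains for \<open>Q\<close>. The smaller exponent \<open>d\<close> leaves
    room for polynomial factors.\<close>
  define c where "c = \<delta>\<^sub>0 / 4"
  define d where "d = c / 2"
  have cd: "0 < d" "d < c" "0 < c" using \<delta>0 by (simp_all add: c_def d_def)
  have Q[measurable]: "Q \<in> borel_measurable M" unfolding Q_def by measurable
  have int: "integrable M (\<lambda>\<omega>. exp (c * \<bar>Q \<omega>\<bar>))"
  proof (rule Bochner_Integration.integrable_bound[OF integrable_mult_right[OF Bochner_Integration.integrable_add[OF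
          mgf_strip_integrable_exp_abs[OF assms(15) \<delta>0 V] mgf_strip_integrable_exp_abs[OF assms(16) \<delta>0 U]], of "exp \<delta>\<^sub>0"]])
    have pw: "exp (c * \<bar>Q \<omega>\<bar>) \<le> exp \<delta>\<^sub>0 * (exp (\<delta>\<^sub>0 * \<bar>V \<omega>\<bar>) + exp (\<delta>\<^sub>0 * \<bar>U \<omega>\<bar>))" for \<omega>
    proof -
      define m where "m = max \<bar>V \<omega>\<bar> \<bar>U \<omega>\<bar>"
      have "\<bar>V \<omega>\<bar> \<le> m" "\<bar>U \<omega>\<bar> \<le> m" by (simp_all add: m_def)
      then have "\<bar>V \<omega> - 1\<bar> \<le> 1 + m" "\<bar>U \<omega> - 1\<bar> \<le> 1 + m" "0 \<le> m" by linarith+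
      moreover have "\<bar>Q \<omega>\<bar> = \<bar>V \<omega> - 1\<bar> + 2 * \<bar>U \<omega> - 1\<bar>" by (simp add: Q_def)
      moreover have "q \<le> 4 + 4 * m" if "x \<le> 1 + m" "y \<le> 1 + m" "0 \<le> m" "q = x + 2 * y" for q x y
        using that by linarith
      ultimately have "\<bar>Q \<omega>\<bar> \<le> 4 + 4 * m" by blast
      from mult_left_mono[OF this, of c] have "c * \<bar>Q \<omega>\<bar> \<le> \<delta>\<^sub>0 + \<delta>\<^sub>0 * m"
        using cd by (simp add: c_def distrib_left)
      then have "exp (c * \<bar>Q \<omega>\<bar>) \<le> exp \<delta>\<^sub>0 * exp (\<delta>\<^sub>0 * m)" by (simp add: mult_exp_exp)
      also have "exp (\<delta>\<^sub>0 * m) \<le> exp (\<delta>\<^sub>0 * \<bar>V \<omega>\<bar>) + exp (\<delta>\<^sub>0 * \<bar>U \<omega>\<bar>)"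
        unfolding m_def max_def by simp
      finally show ?thesis by simp
    qed
    then show "AE \<omega> in M. norm (exp (c * \<bar>Q \<omega>\<bar>)) \<le> norm (exp \<delta>\<^sub>0 * (exp (\<delta>\<^sub>0 * \<bar>V \<omega>\<bar>) + exp (\<delta>\<^sub>0 * \<bar>U \<omega>\<bar>)))"
      by (intro AE_I2) (simp add: abs_mult)
  qed simp
  define C where "C = (\<lambda>j. expectation (\<lambda>\<omega>. \<bar>Q \<omega>\<bar> ^ j * exp (d * \<bar>Q \<omega>\<bar>)))"
  have C_nonneg: "0 \<le> C j" for j unfolding C_def by (intro integral_nonneg_AE) simp
  \<comment> \<open>The bound on the third cumulant from \<open>cumulant_bounds\<close>, hence a
    Lipschitz constant at 0 for the second cumulant.\<close>
  define K where "K = C 3 + 3 * C 1 * C 2 + 2 * C 1 ^ 3"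
  have K: "0 \<le> K" unfolding K_def using C_nonneg by (intro add_nonneg_nonneg mult_nonneg_nonneg) simp_all

  define v0 where "v0 = variance V + variance U"
  have v0: "0 < v0" unfolding v0_def by fact
  define X where "X = (\<lambda>\<rho> \<omega>. (V \<omega> - 1) - (U \<omega> - 1) / \<rho>)"
  define v where "v = (\<lambda>\<rho>. expectation (\<lambda>\<omega>. (X \<rho> \<omega>)\<^sup>2))"
  have X[measurable]: "X r \<in> borel_measurable M" for r unfolding X_def by measurable
  have VU: "V \<omega> - U \<omega> / r = (1 - 1 / r) + X r \<omega>" for r \<omega> by (simp add: X_def diff_divide_distrib)
  have mean: "expectation (X r) = 0" for r unfolding X_def using iV iU by (simp add: prob_space)
  have X_le: "\<bar>X r \<omega>\<bar> \<le> \<bar>Q \<omega>\<bar>" if "1 / 2 \<le> r" for r \<omega>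
  proof -
    have "\<bar>U \<omega> - 1\<bar> * 1 \<le> \<bar>U \<omega> - 1\<bar> * (2 * r)" using that by (intro mult_left_mono) simp_all
    then have "\<bar>(U \<omega> - 1) / r\<bar> \<le> 2 * \<bar>U \<omega> - 1\<bar>" using that by (simp add: abs_divide field_simps)
    then show ?thesis unfolding X_def Q_def by linarith
  qed
  \<comment> \<open>Independence removes the cross term, and 1 / r \<ge> 1 can only increase the
    contribution of U; so the variances of all increments are bounded below by
    \<open>v0\<close>.\<close>
  have v_ge: "v0 \<le> v r" if r: "1 / 2 \<le> r" "r < 1" for r
  proof -
    define V' U' where "V' = (\<lambda>\<omega>. V \<omega> - 1)" and "U' = (\<lambda>\<omega>. U \<omega> - 1)"
    have i2: "integrable M (\<lambda>\<omega>. (V' \<omega>)\<^sup>2)" "integrable M (\<lambda>\<omega>. (U' \<omega>)\<^sup>2)"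
      unfolding V'_def U'_def using iV iU iV2 iU2 by (simp_all add: power2_diff)
    have i1: "integrable M V'" "integrable M U'" unfolding V'_def U'_def using iV iU by simp_all
    have m0: "expectation V' = 0" unfolding V'_def using iV by (simp add: prob_space)
    have ind': "indep_var borel V' borel U'"
      unfolding V'_def U'_def
      using indep_var_compose[OF ind, of "\<lambda>x. x - 1" borel "\<lambda>x. x - 1" borel] by (simp add: comp_def)
    have cross: "expectation (\<lambda>\<omega>. V' \<omega> * U' \<omega>) = 0"
      using indep_var_lebesgue_integral[OF ind' i1] m0 by simp
    have icross: "integrable M (\<lambda>\<omega>. V' \<omega> * U' \<omega>)" by (rule indep_var_integrable[OF ind' i1])
    have "(X r \<omega>)\<^sup>2 = (V' \<omega>)\<^sup>2 - 2 / r * (V' \<omega> * U' \<omega>) + (1 / r)\<^sup>2 * (U' \<omega>)\<^sup>2" for \<omega>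
    proof -
      have "X r \<omega> = V' \<omega> - 1 / r * U' \<omega>" by (simp add: X_def V'_def U'_def)
      then show ?thesis by (simp add: power2_diff power_mult_distrib power_divide)
    qed
    then have "v r = expectation (\<lambda>\<omega>. (V' \<omega>)\<^sup>2) + (1 / r)\<^sup>2 * expectation (\<lambda>\<omega>. (U' \<omega>)\<^sup>2)"
      unfolding v_def using i2 icross cross by simp
    moreover have "1\<^sup>2 \<le> (1 / r)\<^sup>2" using r by (intro power_mono) simp_all
    then have "1 * expectation (\<lambda>\<omega>. (U' \<omega>)\<^sup>2) \<le> (1 / r)\<^sup>2 * expectation (\<lambda>\<omega>. (U' \<omega>)\<^sup>2)"
      by (intro mult_right_mono integral_nonneg_AE) simp_all
    ultimately show ?thesis by (simp add: v0_def V'_def U'_def iV iU)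
  qed
  \<comment> \<open>Separates the drift from the centred part, which is the form that
    \<open>saddle_point_analysis\<close> expects, with the cumulant generating function of
    \<open>X r\<close> as k.\<close>
  have h_eq: "log_psi M V U r \<zeta> = (1 / r - 1) * \<zeta> + ln (exp_moment (X r) 0 (- \<zeta>))" if r: "1 / 2 \<le> r" and \<zeta>: "\<bar>\<zeta>\<bar> < c" for r \<zeta>
  proof -
    have intX: "integrable M (\<lambda>\<omega>. exp (c * \<bar>X r \<omega>\<bar>))"
    proof (rule Bochner_Integration.integrable_bound[OF int])
      show "AE \<omega> in M. norm (exp (c * \<bar>X r \<omega>\<bar>)) \<le> norm (exp (c * \<bar>Q \<omega>\<bar>))"
        using X_le[OF r] cd by (intro AE_I2) simp
    qed simp
    have p: "1 \<le> exp_moment (X r) 0 (- \<zeta>)"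
      by (rule exp_moment_0_ge_1[OF X intX _ mean]) (use \<zeta> in simp)
    have "psi M V U r (- \<zeta>) = expectation (\<lambda>\<omega>. exp ((1 / r - 1) * \<zeta>) * exp (- \<zeta> * X r \<omega>))"
      unfolding psi_def
    proof (rule Bochner_Integration.integral_cong[OF refl])
      fix \<omega>
      have "- \<zeta> * (V \<omega> - U \<omega> / r) = (1 / r - 1) * \<zeta> + - \<zeta> * X r \<omega>"
        unfolding VU by (simp add: algebra_simps)
      then show "exp (- \<zeta> * of_real (V \<omega> - U \<omega> / r)) = exp ((1 / r - 1) * \<zeta>) * exp (- \<zeta> * X r \<omega>)"
        by (simp only: of_real_eq_id id_apply exp_add)
    qed
    then have "psi M V U r (- \<zeta>) = exp ((1 / r - 1) * \<zeta>) * exp_moment (X r) 0 (- \<zeta>)"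
      by (simp add: exp_moment_def)
    then show ?thesis unfolding log_psi_def using p by (simp add: ln_mult)
  qed

  \<comment> \<open>The cumulant bounds hold up to \<open>d\<close>, and \<open>K\<close> times the
    length of the interval must not exceed half of the variance, so that the second derivative stays
    away from 0. The 1 added to \<open>K\<close> avoids a division by zero.\<close>
  define \<delta>\<^sub>1 where "\<delta>\<^sub>1 = min d (v0 / (2 * (K + 1)))"
  have \<delta>1: "0 < \<delta>\<^sub>1" "\<delta>\<^sub>1 \<le> d" "K * \<delta>\<^sub>1 \<le> v0 / 2"
  proof -
    show "0 < \<delta>\<^sub>1" "\<delta>\<^sub>1 \<le> d" using cd v0 K by (simp_all add: \<delta>\<^sub>1_def)
    have "K * \<delta>\<^sub>1 \<le> K * (v0 / (2 * (K + 1)))" unfolding \<delta>\<^sub>1_def by (intro mult_left_mono K) simp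
    also have "\<dots> \<le> v0 / 2" using K v0 by (simp add: divide_simps mult_left_mono)
    finally show "K * \<delta>\<^sub>1 \<le> v0 / 2" .
  qed

  \<comment> \<open>The saddle point will satisfy s \<le> S / sqrt n, because s \<le> 2 * \<mu> / w,
    where \<mu> is at most \<open>2 * \<beta>\<^sub>2 / sqrt n\<close> and w at least
    \<open>v0\<close>. \<open>Cb\<close> and \<open>Ct\<close> are the constants of
    \<open>saddle_parameter_bounds\<close>; \<open>Cd\<close> is the resulting constant for the
    distance of the increment laws.\<close>
  define S where "S = 4 * \<beta>\<^sub>2 / v0"
  define Cb where "Cb = 2 * K * S\<^sup>2 / sqrt (v0 / 2)"
  define Ct where "Ct = 2 * K * S / v0"
  define Cd where "Cd = 8 * (1 + 2 * exp (C 2 / v0)) * (C 1 / sqrt v0 + C 3 / sqrt v0 ^ 3) + 2 * exp 2 * (Cb + Ct)"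
  \<comment> \<open>A lower bound for the scaled drift r * \<mu> / \<sigma>: the numerator is at
    least \<open>\<beta>\<^sub>1\<close>, and \<sigma>^2 is a second cumulant and thus at most
    \<open>C 2\<close>. Adding 1 keeps the denominator positive.\<close>
  define b0 where "b0 = \<beta>\<^sub>1 / sqrt (C 2 + 1)"
  \<comment> \<open>The value 1 / 4 is the limit for the Stein bound. The second term makes
    \<theta>^2 / 2 at most half of \<theta> * b0 / 2 for the normal law, whose drift is at least b0
    / 2. The third one makes \<theta>^2 * C 2 / \<sigma>^2 at most half of \<theta> * b0 for the
    queue, as \<sigma>^2 is at least v0 / 2. Both exponents are then at most - \<theta> * b0 / 4,
    the logarithm of \<gamma>.\<close>
  define \<theta> where "\<theta> = min (1 / 4) (min (b0 / 2) (b0 * v0 / (4 * (C 2 + 1))))"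
  define \<gamma> where "\<gamma> = exp (- (\<theta> * b0 / 4))"
  have S: "0 < S" using \<beta> v0 by (simp add: S_def)
  have Cbt: "0 \<le> Cb" "0 \<le> Ct" using K S v0 by (simp_all add: Cb_def Ct_def)
  have C21: "0 < C 2 + 1" using C_nonneg[of 2] by linarith
  have b0: "0 < b0" using \<beta> C21 by (simp add: b0_def)
  have \<theta>: "0 < \<theta>" "\<theta> \<le> 1 / 4" "\<theta> \<le> b0 / 2" "\<theta> \<le> b0 * v0 / (4 * (C 2 + 1))"
  proof -
    show "0 < \<theta>" using b0 v0 C21 by (simp add: \<theta>_def)
    show "\<theta> \<le> 1 / 4" unfolding \<theta>_def by (rule min.cobounded1)
    show "\<theta> \<le> b0 / 2" unfolding \<theta>_def by (rule min.coboundedI2[OF min.cobounded1])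
    show "\<theta> \<le> b0 * v0 / (4 * (C 2 + 1))" unfolding \<theta>_def by (rule min.coboundedI2[OF min.cobounded2])
  qed
  have \<gamma>: "0 \<le> \<gamma>" "\<gamma> < 1" using \<theta> b0 by (simp_all add: \<gamma>_def)

  let ?h = "\<lambda>n. log_psi M V U (\<rho> n)"
  \<comment> \<open>An explicit bound whose constant is free of n. The power of \<theta> is k - 1
    because the moment of order Suc j is an integral of the tail against t^j.\<close>
  define approx where "approx = (\<lambda>n \<delta>' k.
      integrable (N n) (\<lambda>\<omega>. (sqrt n / saddle_sigma (?h n) \<delta>' * W n \<omega>) ^ k) \<and>
      integrable (gaussian_increments (saddle_beta (?h n) \<delta>' n)) (\<lambda>x. walk_max x ^ k) \<and>
      \<bar>(LINT \<omega>|N n. (sqrt n / saddle_sigma (?h n) \<delta>' * W n \<omega>) ^ k) - walk_max_moment k (saddle_beta (?h n) \<delta>' n)\<bar>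
        \<le> fact k / \<theta> ^ (k - 1) / (1 - \<gamma>)\<^sup>2 * Cd * (1 / sqrt n))"
  \<comment> \<open>The five thresholds serve, in this order, to have \<open>\<rho> n\<close> at
    least 1 / 2, to have \<mu> small enough for a saddle point in the given interval, to have the
    exponent per summand at most \<open>d\<close>, to make the Stein exponent admissible for the
    summands, and to keep the error Cb / sqrt n below b0 / 2.\<close>
  have main: "(\<exists>!\<zeta>. is_saddle_point (?h n) \<delta>' \<zeta>) \<and>
      (\<forall>k\<ge>1. approx n \<delta>' k)"
    if \<delta>': "0 < \<delta>'" "\<delta>' \<le> \<delta>\<^sub>1" and n: "1 \<le> n"
      and R: "2 * \<beta>\<^sub>2 \<le> sqrt n" "4 * \<beta>\<^sub>2 / (v0 * \<delta>') < sqrt n" "\<theta> / (sqrt (v0 / 2) * d) \<le> sqrt n"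
        "1 / (2 * d * sqrt v0) \<le> sqrt n" "2 * Cb / b0 \<le> sqrt n" for \<delta>' n
  proof -
    define r where "r = sqrt n"
    have r: "0 < r" using n by (simp add: r_def)
    define h where "h = log_psi M V U (\<rho> n)"
    define \<mu> where "\<mu> = 1 / \<rho> n - 1"
    define w where "w = v (\<rho> n)"
    have \<rho>_half: "1 / 2 \<le> \<rho> n"
    proof -
      have "(1 - \<rho> n) * r \<le> 1 / 2 * r" using \<rho>(4)[OF n] R(1) by (simp add: r_def)
      then show ?thesis using r by simp
    qed
    note \<rho>n = \<rho>(1,2)[OF n]
    have \<mu>: "0 < \<mu>" "1 - \<rho> n \<le> \<mu>" "\<mu> \<le> 2 * (1 - \<rho> n)"
    proof -
      have eq: "\<mu> = (1 - \<rho> n) / \<rho> n" using \<rho>n by (simp add: \<mu>_def diff_divide_distrib)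
      show "0 < \<mu>" unfolding eq using \<rho>n by simp
      have "(1 - \<rho> n) * \<rho> n \<le> (1 - \<rho> n) * 1" using \<rho>n by (intro mult_left_mono) simp_all
      then show "1 - \<rho> n \<le> \<mu>" unfolding eq using \<rho>n by (simp add: pos_le_divide_eq)
      have "(1 - \<rho> n) * 1 \<le> (1 - \<rho> n) * (2 * \<rho> n)" using \<rho>n \<rho>_half by (intro mult_left_mono) simp_all
      then show "\<mu> \<le> 2 * (1 - \<rho> n)" unfolding eq using \<rho>n by (simp add: pos_divide_le_eq mult_ac)
    qed
    have \<mu>_r: "\<beta>\<^sub>1 \<le> r * \<mu>" "\<mu> \<le> 2 * \<beta>\<^sub>2 / r"
    proof -
      have "(1 - \<rho> n) * r \<le> \<mu> * r" using \<mu> r by (intro mult_right_mono) simp_all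
      then show "\<beta>\<^sub>1 \<le> r * \<mu>" using \<rho>(3)[OF n] by (simp add: r_def mult.commute)
      have "\<mu> * r \<le> 2 * (1 - \<rho> n) * r" using \<mu> r by (intro mult_right_mono) simp_all
      moreover have "2 * (1 - \<rho> n) * r = 2 * ((1 - \<rho> n) * r)" by simp
      ultimately have "\<mu> * r \<le> 2 * \<beta>\<^sub>2" using \<rho>(4)[OF n, folded r_def] by linarith
      then show "\<mu> \<le> 2 * \<beta>\<^sub>2 / r" using r by (simp add: pos_le_divide_eq)
    qed
    have w: "v0 \<le> w" "0 < w" using v_ge[OF \<rho>_half \<rho>n(2)] v0 by (simp_all add: w_def)
    note le = X_le[OF \<rho>_half]
    have intX: "integrable M (\<lambda>\<omega>. exp (c * \<bar>X (\<rho> n) \<omega>\<bar>))"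
    proof (rule Bochner_Integration.integrable_bound[OF int])
      show "AE \<omega> in M. norm (exp (c * \<bar>X (\<rho> n) \<omega>\<bar>)) \<le> norm (exp (c * \<bar>Q \<omega>\<bar>))"
        using le cd by (intro AE_I2) simp
    qed simp
    have K\<delta>': "K * \<delta>' \<le> w / 2" using mult_left_mono[OF \<delta>'(2) K] \<delta>1(3) w by linarith
    have \<mu>_small: "\<mu> < w / 2 * \<delta>'"
    proof -
      have "4 * \<beta>\<^sub>2 < r * (v0 * \<delta>')" using R(2) v0 \<delta>'(1) by (simp add: r_def pos_divide_less_eq)
      then have "2 * \<beta>\<^sub>2 / r < v0 / 2 * \<delta>'" using r by (simp add: pos_divide_less_eq mult_ac)
      also have "\<dots> \<le> w / 2 * \<delta>'" using w \<delta>' by (intro mult_right_mono) simp_all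
      finally show ?thesis using \<mu>_r(2) by linarith
    qed
    have k2_diff: "\<bar>cumulant2 (X (\<rho> n)) s - w\<bar> \<le> K * \<bar>s\<bar>" if "\<bar>s\<bar> \<le> \<delta>'" for s
      unfolding w_def v_def K_def C_def
      by (rule cumulant2_diff_le[OF X Q int le mean _ cd(2)]) (use that \<delta>' \<delta>1 in linarith)
    obtain s where s: "0 < s" "s \<le> \<delta>'" "s \<le> 2 * \<mu> / w" "w / 2 \<le> cumulant2 (X (\<rho> n)) s" "cumulant2 (X (\<rho> n)) s \<le> 2 * w"
        "\<bar>\<mu> - s * cumulant2 (X (\<rho> n)) s\<bar> \<le> 2 * K * s\<^sup>2"
      and ex: "\<exists>!\<zeta>. is_saddle_point h \<delta>' \<zeta>" and sp: "saddle_point h \<delta>' = - s"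
      and sg: "saddle_sigma h \<delta>' = sqrt (cumulant2 (X (\<rho> n)) s)"
    proof (rule saddle_point_analysis[of c h \<mu> "\<lambda>s. ln (exp_moment (X (\<rho> n)) 0 s)" "cumulant1 (X (\<rho> n))" "cumulant2 (X (\<rho> n))" \<delta>' w K])
      show "h \<zeta> = \<mu> * \<zeta> + ln (exp_moment (X (\<rho> n)) 0 (- \<zeta>))" if "\<bar>\<zeta>\<bar> < c" for \<zeta>
        unfolding h_def \<mu>_def by (rule h_eq[OF \<rho>_half that])
      show "((\<lambda>s. ln (exp_moment (X (\<rho> n)) 0 s)) has_real_derivative cumulant1 (X (\<rho> n)) s) (at s)"
        "(cumulant1 (X (\<rho> n)) has_real_derivative cumulant2 (X (\<rho> n)) s) (at s)" if "\<bar>s\<bar> < c" for s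
        by (rule has_real_derivative_cumulants[OF X intX that mean])+
      show "cumulant1 (X (\<rho> n)) 0 = 0" by (rule cumulants_0[OF mean])
    qed (use k2_diff \<delta>' \<delta>1 cd K\<delta>' K w \<mu> \<mu>_small in \<open>simp_all\<close>)
    define \<sigma> where "\<sigma> = saddle_sigma h \<delta>'"
    have \<sigma>2: "\<sigma>\<^sup>2 = cumulant2 (X (\<rho> n)) s" and \<sigma>: "0 < \<sigma>" using s w by (simp_all add: \<sigma>_def sg)
    \<comment> \<open>\<open>b\<close> is the negative drift of the scaled increment of the queue,
      while \<beta> is that of the Gaussian walk in the claim. The saddle point equation says \<mu>
      = s * \<sigma>^2 up to order s^2, so the two differ by a multiple of 1 / r.\<close>
    define b where "b = r * \<mu> / \<sigma>"
    define \<beta> where "\<beta> = s * \<sigma> * r"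
    have \<beta>_eq: "saddle_beta h \<delta>' n = \<beta>" by (simp add: saddle_beta_def sp \<beta>_def \<sigma>_def r_def)
    have "s \<le> S / r"
    proof -
      have "2 * \<mu> / w \<le> 2 * (2 * \<beta>\<^sub>2 / r) / v0"
        using \<mu>_r(2) w v0 \<mu> by (intro frac_le) simp_all
      then show ?thesis using s(3) by (simp add: S_def mult_ac)
    qed
    note bounds = saddle_parameter_bounds[OF r v0 w(1) \<sigma> s(4)[folded \<sigma>2] s(1) this K s(6)[folded \<sigma>2]
        k2_diff[of s, unfolded abs_of_pos[OF s(1)], OF s(2), folded \<sigma>2]]
    have \<beta>_diff: "\<bar>b - \<beta>\<bar> \<le> Cb / r" using bounds(1) by (simp add: b_def \<beta>_def Cb_def)
    have \<tau>_diff: "\<bar>sqrt w / \<sigma> - 1\<bar> \<le> Ct / r" using bounds(2) by (simp add: Ct_def)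
    have \<sigma>2_le: "\<sigma>\<^sup>2 \<le> C 2" unfolding \<sigma>2 C_def
      by (rule cumulant_bounds(1)[OF X Q int le mean _ cd(2)]) (use s \<delta>' \<delta>1 in simp)
    have b_ge: "b0 \<le> b"
    proof -
      have "\<sigma> \<le> sqrt (C 2 + 1)" using \<sigma>2_le by (intro real_le_rsqrt) simp
      then show ?thesis unfolding b0_def b_def using \<mu>_r(1) \<beta>(1) \<sigma> assms(19) by (intro frac_le) simp_all
    qed
    have \<beta>_ge: "b0 / 2 \<le> \<beta>"
    proof -
      have "Cb / r \<le> b0 / 2" using R(5) b0 r by (simp add: r_def field_simps)
      then show ?thesis using \<beta>_diff b_ge by linarith
    qed
    then have \<beta>_pos: "0 < \<beta>" using b0 by linarith
    define A where "A = distr (sample_mean_law (distr M borel (\<lambda>\<omega>. V \<omega> - U \<omega> / \<rho> n)) n) borel (\<lambda>x. r / \<sigma> * x)"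
    define L where "L = distr (distr (N n) borel (W n)) borel (\<lambda>x. r / \<sigma> * x)"
    have L: "lindley_stationary A L"
      unfolding A_def L_def
      by (rule lindley_stationary_scale[OF lindley_stationary_waiting_law[OF ind n assms(25)[OF n]]]) (use r \<sigma> in simp)
    have A_eq: "A = distr (sample_mean_law (distr M borel (\<lambda>\<omega>. - \<mu> + X (\<rho> n) \<omega>)) n) borel (\<lambda>x. sqrt n / \<sigma> * x)"
      unfolding A_def VU r_def \<mu>_def by (simp only: minus_diff_eq)
    have gA: "(\<integral>\<^sup>+x. ennreal (exp (\<theta> * x)) \<partial>A) \<le> ennreal \<gamma>"
    proof -
      have s0: "\<theta> / (\<sigma> * sqrt n) \<le> d"
      proof -
        have "sqrt (v0 / 2) \<le> \<sigma>" using \<sigma> \<sigma>2 s(4) w by (intro real_le_lsqrt) simp_all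
        have "\<theta> \<le> r * (sqrt (v0 / 2) * d)" using R(3) v0 cd by (simp add: r_def pos_divide_le_eq)
        also have "\<dots> \<le> r * (\<sigma> * d)" using \<open>sqrt (v0 / 2) \<le> \<sigma>\<close> r cd by (intro mult_left_mono mult_right_mono) simp_all
        finally show ?thesis using \<sigma> r by (simp add: r_def pos_divide_le_eq mult_ac)
      qed
      have "(\<integral>\<^sup>+x. ennreal (exp (\<theta> * x)) \<partial>A) \<le> ennreal (exp (\<theta> * (sqrt n * (- \<mu>) / \<sigma>) + \<theta>\<^sup>2 * C 2 / \<sigma>\<^sup>2))"
        unfolding A_eq C_def
        by (rule scaled_sample_mean_exp_moment_le[OF X Q int le mean cd(2) n \<sigma> _ s0]) (use \<theta> in simp)
      also have "\<dots> \<le> ennreal \<gamma>"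
        unfolding \<gamma>_def
      proof (intro ennreal_leI iffD2[OF exp_le_cancel_iff])
        have "\<theta>\<^sup>2 * C 2 / \<sigma>\<^sup>2 \<le> \<theta>\<^sup>2 * (C 2 + 1) / (v0 / 2)"
          using s(4) w v0 C_nonneg[of 2] by (intro frac_le mult_left_mono) (simp_all add: \<sigma>2)
        also have "\<dots> = \<theta> * (\<theta> * (4 * (C 2 + 1))) / (2 * v0)"
          using v0 by (simp add: power2_eq_square field_simps)
        also have "\<dots> \<le> \<theta> * (b0 * v0) / (2 * v0)"
          using \<theta> v0 C21 by (intro divide_right_mono mult_left_mono) (simp_all add: pos_le_divide_eq)
        also have "\<dots> = \<theta> * b0 / 2" using v0 by simp
        finally have "\<theta>\<^sup>2 * C 2 / \<sigma>\<^sup>2 \<le> \<theta> * b0 / 2" .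
        moreover have "\<theta> * (sqrt n * (- \<mu>) / \<sigma>) = - (\<theta> * b)" by (simp add: b_def r_def)
        moreover have "\<theta> * b0 \<le> \<theta> * b" using \<theta> b_ge by (intro mult_left_mono) simp_all
        moreover have "0 \<le> \<theta> * b0" using \<theta> b0 by simp
        ultimately show "\<theta> * (sqrt n * (- \<mu>) / \<sigma>) + \<theta>\<^sup>2 * C 2 / \<sigma>\<^sup>2 \<le> - (\<theta> * b0 / 4)" by linarith
      qed
      finally show ?thesis .
    qed
    have gB: "(\<integral>\<^sup>+x. ennreal (exp (\<theta> * x)) \<partial>normal_law \<beta>) \<le> ennreal \<gamma>"
      unfolding normal_law_exp_moment \<gamma>_def
    proof (intro ennreal_leI iffD2[OF exp_le_cancel_iff])
      have "\<theta> * (b0 / 2) \<le> \<theta> * \<beta>" using \<theta> \<beta>_ge by (intro mult_left_mono) simp_all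
      moreover have "\<theta> * \<theta> \<le> \<theta> * (b0 / 2)" using \<theta> by (intro mult_left_mono) simp_all
      ultimately show "\<theta>\<^sup>2 / 2 - \<theta> * \<beta> \<le> - (\<theta> * b0 / 4)" by (simp add: power2_eq_square)
    qed
    have td: "tail_dist \<theta> A (normal_law \<beta>) \<le> ennreal (Cd * (1 / r))"
    proof (rule order_trans)
      have dn: "1 / 2 \<le> d * sqrt w * sqrt n"
      proof -
        have "1 / 2 \<le> d * sqrt v0 * r" using R(4) cd v0 by (simp add: r_def field_simps)
        also have "\<dots> \<le> d * sqrt w * r" using w cd r by (intro mult_right_mono mult_left_mono) simp_all
        finally show ?thesis by (simp add: r_def)
      qed
      show "tail_dist \<theta> A (normal_law \<beta>) \<le> ennreal (8 * (1 + 2 * exp (C 2 / w)) * (C 1 / sqrt w + C 3 / sqrt w ^ 3) / sqrt n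
          + 2 * exp 2 * (\<bar>b - \<beta>\<bar> + \<bar>sqrt w / \<sigma> - 1\<bar>))"
        unfolding A_eq C_def
        by (rule scaled_sample_mean_tail_dist_le[OF X Q int le mean cd(2) n _ w(2) \<sigma> bounds(3) _ \<theta>(2) dn])
           (use \<theta> b_ge b0 \<beta>_pos in \<open>simp_all add: w_def v_def b_def r_def\<close>)
      have "8 * (1 + 2 * exp (C 2 / w)) * (C 1 / sqrt w + C 3 / sqrt w ^ 3)
        \<le> 8 * (1 + 2 * exp (C 2 / v0)) * (C 1 / sqrt v0 + C 3 / sqrt v0 ^ 3)"
        using w v0 C_nonneg
        by (intro mult_mono add_mono divide_left_mono power_mono mult_left_mono iffD2[OF exp_le_cancel_iff])
           (simp_all add: add_nonneg_nonneg)
      then have "8 * (1 + 2 * exp (C 2 / w)) * (C 1 / sqrt w + C 3 / sqrt w ^ 3) / r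
        \<le> 8 * (1 + 2 * exp (C 2 / v0)) * (C 1 / sqrt v0 + C 3 / sqrt v0 ^ 3) / r"
        using r by (intro divide_right_mono) simp_all
      moreover have "2 * exp 2 * (\<bar>b - \<beta>\<bar> + \<bar>sqrt w / \<sigma> - 1\<bar>) \<le> 2 * exp 2 * (Cb / r + Ct / r)"
        by (intro mult_left_mono add_mono \<beta>_diff \<tau>_diff) simp
      ultimately have "8 * (1 + 2 * exp (C 2 / w)) * (C 1 / sqrt w + C 3 / sqrt w ^ 3) / r
          + 2 * exp 2 * (\<bar>b - \<beta>\<bar> + \<bar>sqrt w / \<sigma> - 1\<bar>)
        \<le> 8 * (1 + 2 * exp (C 2 / v0)) * (C 1 / sqrt v0 + C 3 / sqrt v0 ^ 3) / r + 2 * exp 2 * (Cb / r + Ct / r)"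
        by linarith
      also have "\<dots> = Cd * (1 / r)" by (simp add: Cd_def add_divide_distrib distrib_left)
      finally show "ennreal (8 * (1 + 2 * exp (C 2 / w)) * (C 1 / sqrt w + C 3 / sqrt w ^ 3) / sqrt n
          + 2 * exp 2 * (\<bar>b - \<beta>\<bar> + \<bar>sqrt w / \<sigma> - 1\<bar>)) \<le> ennreal (Cd * (1 / r))"
        unfolding r_def by (rule ennreal_leI)
    qed
    have Cd_nonneg: "0 \<le> Cd * (1 / r)"
      unfolding Cd_def using C_nonneg v0 Cbt r
      by (intro mult_nonneg_nonneg add_nonneg_nonneg divide_nonneg_nonneg) simp_all
    note K\<beta> = lindley_stationary_walk_max[OF \<beta>_pos]
    have W: "W n \<in> borel_measurable (N n)" using assms(23)[OF n] .
    have int_L: "(LINT x|L. x ^ k) = (LINT \<omega>|N n. (r / \<sigma> * W n \<omega>) ^ k)"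
      "integrable L (\<lambda>x. x ^ k) \<longleftrightarrow> integrable (N n) (\<lambda>\<omega>. (r / \<sigma> * W n \<omega>) ^ k)" for k
    proof -
      have L_eq: "L = distr (N n) borel (\<lambda>\<omega>. r / \<sigma> * W n \<omega>)"
        unfolding L_def using W by (subst distr_distr) (simp_all add: comp_def)
      have m: "(\<lambda>\<omega>. r / \<sigma> * W n \<omega>) \<in> borel_measurable (N n)" using W by simp
      show "(LINT x|L. x ^ k) = (LINT \<omega>|N n. (r / \<sigma> * W n \<omega>) ^ k)"
        unfolding L_eq by (rule integral_distr[OF m]) simp
      show "integrable L (\<lambda>x. x ^ k) \<longleftrightarrow> integrable (N n) (\<lambda>\<omega>. (r / \<sigma> * W n \<omega>) ^ k)"
        unfolding L_eq by (rule integrable_distr_eq[OF m]) simp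
    qed
    have "integrable (N n) (\<lambda>\<omega>. (r / \<sigma> * W n \<omega>) ^ k) \<and>
        integrable (gaussian_increments \<beta>) (\<lambda>x. walk_max x ^ k) \<and>
        \<bar>(LINT \<omega>|N n. (r / \<sigma> * W n \<omega>) ^ k) - walk_max_moment k \<beta>\<bar>
          \<le> fact k / \<theta> ^ (k - 1) / (1 - \<gamma>)\<^sup>2 * Cd * (1 / r)" if k: "1 \<le> k" for k
    proof -
      obtain j where j: "k = Suc j" using k by (cases k) auto
      note bound = stationary_moment_diff_le[OF L K\<beta> \<theta>(1) gA gB \<gamma> td Cd_nonneg, of j]
      show ?thesis
        using bound unfolding j int_L walk_max_moment_eq integrable_walk_max_power
        by (simp only: diff_Suc_1 mult.assoc simp_thms)
    qed
    then show ?thesis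
      using ex unfolding approx_def h_def[symmetric] \<sigma>_def[symmetric] \<beta>_eq r_def[symmetric] by blast
  qed

  show ?thesis
  proof (intro exI[of _ \<delta>\<^sub>1] conjI \<delta>1(1) allI impI)
    fix \<delta>' assume \<delta>': "0 < \<delta>' \<and> \<delta>' \<le> \<delta>\<^sub>1"
    define R where "R = Max {2 * \<beta>\<^sub>2, 4 * \<beta>\<^sub>2 / (v0 * \<delta>'), \<theta> / (sqrt (v0 / 2) * d), 1 / (2 * d * sqrt v0), 2 * Cb / b0}"
    have "\<forall>\<^sub>F n in sequentially. R < sqrt (real n)"
      by (rule filterlim_at_top_dense[THEN iffD1, rule_format]) real_asymp
    then have ev: "\<forall>\<^sub>F n in sequentially. 1 \<le> n \<and> R < sqrt (real n)"
      using eventually_ge_at_top[of 1] by eventually_elim simp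
    have "(\<exists>!\<zeta>. is_saddle_point (?h n) \<delta>' \<zeta>) \<and>
      (\<forall>k\<ge>1. approx n \<delta>' k)" if "1 \<le> n \<and> R < sqrt (real n)" for n
      by (rule main) (use that \<delta>' in \<open>simp_all add: R_def\<close>)
    note good = this[unfolded approx_def]
    show "\<forall>\<^sub>F n in sequentially. \<exists>!\<zeta>. is_saddle_point (?h n) \<delta>' \<zeta>"
      using ev by eventually_elim (use good in blast)
    fix k :: nat assume k: "1 \<le> k"
    show "\<forall>\<^sub>F n in sequentially.
        integrable (N n) (\<lambda>\<omega>. (sqrt (real n) / saddle_sigma (?h n) \<delta>' * W n \<omega>) ^ k) \<and>
        integrable (gaussian_increments (saddle_beta (?h n) \<delta>' n)) (\<lambda>x. walk_max x ^ k)"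
      using ev by eventually_elim (use good k in blast)
    show "(\<lambda>n. (LINT \<omega>|N n. (sqrt (real n) / saddle_sigma (?h n) \<delta>' * W n \<omega>) ^ k)
           - walk_max_moment k (saddle_beta (?h n) \<delta>' n))
        \<in> O(\<lambda>n. 1 / sqrt (real n))"
    proof (rule bigoI[where c = "fact k / \<theta> ^ (k - 1) / (1 - \<gamma>)\<^sup>2 * Cd"])
      show "\<forall>\<^sub>F n in sequentially.
        norm ((LINT \<omega>|N n. (sqrt (real n) / saddle_sigma (?h n) \<delta>' * W n \<omega>) ^ k)
           - walk_max_moment k (saddle_beta (?h n) \<delta>' n))
        \<le> fact k / \<theta> ^ (k - 1) / (1 - \<gamma>)\<^sup>2 * Cd * norm (1 / sqrt (real n))"
        using ev
      proof eventually_elim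
        case (elim n)
        have "norm (1 / sqrt (real n)) = 1 / sqrt (real n)" by simp
        then show ?case using good[OF elim] k by (simp only: real_norm_def)
      qed
    qed
  qed
qed

end
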